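(* Let $\beta\in\{1,2\}$. Let $(\mathcal N_{k,j})_{k\ge 1,\,1\le j\le k}$ be i.i.d. standard real ($\beta=1$) or standard complex ($\beta=2$) Gaussian random variables, and let $(b_k)_{k\ge1}$ be positive random variables with $b_k\sim\frac{1}{\sqrt\beta}\chi_{k\beta}$, all of these variables being independent. Let $H_n$ be the $n\times n$ Hessenberg matrix with entries $(H_n)_{k,j}=\mathcal N_{k,j}$ for $j\le k$, $(H_n)_{k,k+1}=b_k$ for $1\le k\le n-1$, and $(H_n)_{k,j}=0$ for $j>k+1$. For $\lambda\in\mathbb{C}$ let $X_1(\lambda)=1$ and define $X_{k+1}(\lambda)$ recursively for $k\ge 1$ by $$\sum_{j=1}^k \mathcal N_{k,j}X_j(\lambda)+b_kX_{k+1}(\lambda)=\lambda X_k(\lambda).$$ Then: (1) for every $n\ge1$, the characteristic polynomial of $H_n$ has the same distribution as the characteristic polynomial of the $n\times n$ matrix with i.i.d. standard real ($\beta=1$) or complex ($\beta=2$) Gaussian entries; (2) for every $n\ge 1$, the polynomial $X_{n+1}(\lambda)$ is a (nonzero) random constant times the characteristic polynomial of $H_n$; (3) let $\mathcal F_k$ be the $\sigma$-field generated by the first $k-1$ rows (that is, by $\mathcal N_{i,j}$ and $b_i$ for $j\le i\le k-1$) together with $b_k$. For every $k\ge1$, conditionally on $\mathcal F_k$, $X_{k+1}$ is a random field on $\mathbb{C}$ whose real and imaginary parts are jointly Gaussian, with mean $m_k(\lambda)=\lambda X_k(\lambda)/b_k$ and covariance structure $$\mathbf{E}\big[(X_{k+1}-m_k)(\lambda)\,\overline{(X_{k+1}-m_k)(\mu)}\,\big|\,\mathcal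 F_k\big]=\frac{1}{b_k^{2}}\sum_{j=1}^kX_j(\lambda)\overline{X_j(\mu)},$$ $$\mathbf{E}\big[(X_{k+1}-m_k)(\lambda)\,(X_{k+1}-m_k)(\mu)\,\big|\,\mathcal F_k\big]=\begin{cases}\dfrac{1}{b_k^{2}}\displaystyle\sum_{j=1}^kX_j(\lambda)X_j(\mu), & \beta=1,\\ 0, & \beta=2.\end{cases}$$
   Context: A standard real Gaussian is $N(0,1)$; a standard complex Gaussian is $X+iY$ with $X,Y$ i.i.d. $N(0,1/2)$. $\chi_m$ denotes the distribution of the Euclidean length of a vector of $m$ independent standard real Gaussians. *)

theory Defs
  imports "HOL-Probability.Probability" "Jordan_Normal_Form.Char_Poly"
begin

(* For beta = 1 the real line is embedded in the complex numbers, so that the cases beta = 1 and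
   beta = 2 share one type of entries. *)
definition std_gaussian :: "nat \<Rightarrow> complex measure" where
  "std_gaussian \<beta> =
     (if \<beta> = 1 then distr std_normal_distribution borel complex_of_real
      else distr (density lborel (normal_density 0 (sqrt (1/2))) \<Otimes>\<^sub>M
                  density lborel (normal_density 0 (sqrt (1/2)))) borel (\<lambda>(x, y). Complex x y))"

definition chi_distribution :: "nat \<Rightarrow> real measure" where
  "chi_distribution m =
     distr (\<Pi>\<^sub>M i\<in>{..<m}. std_normal_distribution) borel (\<lambda>x. L2_set x {..<m})"

(* Matrices of type mat are indexed from 0; N and b are indexed from 1. *)
definition hessenberg :: "(nat \<Rightarrow> nat \<Rightarrow> complex) \<Rightarrow> (nat \<Rightarrow> real) \<Rightarrow> nat \<Rightarrow> complex mat" where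
  "hessenberg N b n = mat n n (\<lambda>(r, c).
     let k = r + 1; j = c + 1 in
       if j \<le> k then N k j else if j = k + 1 then complex_of_real (b k) else 0)"

(* The measurable space of complex polynomials, with the coarsest sigma-algebra making all
   coefficients measurable (only its sigma-algebra matters, not its measure). *)
definition poly_space :: "complex poly measure" where
  "poly_space = vimage_algebra UNIV coeff (\<Pi>\<^sub>M i\<in>(UNIV :: nat set). (borel :: complex measure))"

definition field_space :: "(complex \<Rightarrow> complex) measure" where
  "field_space = (\<Pi>\<^sub>M z\<in>(UNIV :: complex set). (borel :: complex measure))"

definition row_filtration ::
  "'w measure \<Rightarrow> (nat \<Rightarrow> nat \<Rightarrow> 'w \<Rightarrow> complex) \<Rightarrow> (nat \<Rightarrow> 'w \<Rightarrow> real) \<Rightarrow> nat \<Rightarrow> 'w measure" where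
  "row_filtration M N b k = sigma (space M)
     ({N i j -` A \<inter> space M | i j A. 1 \<le> j \<and> j \<le> i \<and> i < k \<and> A \<in> sets borel} \<union>
      {b i -` A \<inter> space M | i A. 1 \<le> i \<and> i \<le> k \<and> A \<in> sets borel})"

(* real_cond_exp is built from the conditional expectations of the positive and negative parts, so
   it is meaningful for conditionally integrable f even when f itself is not integrable. This is
   needed: for beta = 1 the variable 1 / b 1 is not integrable. *)
definition complex_cond_exp :: "'w measure \<Rightarrow> 'w measure \<Rightarrow> ('w \<Rightarrow> complex) \<Rightarrow> 'w \<Rightarrow> complex" where
  "complex_cond_exp M F f \<omega> =
     Complex (real_cond_exp M F (\<lambda>\<omega>. Re (f \<omega>)) \<omega>) (real_cond_exp M F (\<lambda>\<omega>. Im (f \<omega>)) \<omega>)"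

definition regular_cond_distr ::
  "'w measure \<Rightarrow> 'w measure \<Rightarrow> 'a measure \<Rightarrow> ('w \<Rightarrow> 'a) \<Rightarrow> ('w \<Rightarrow> 'a measure) \<Rightarrow> bool" where
  "regular_cond_distr M F S Y \<kappa> \<longleftrightarrow>
     Y \<in> M \<rightarrow>\<^sub>M S \<and> \<kappa> \<in> F \<rightarrow>\<^sub>M prob_algebra S \<and>
     (\<forall>A\<in>sets S. AE \<omega> in M.
        real_cond_exp M F (\<lambda>\<omega>. indicator A (Y \<omega>)) \<omega> = measure (\<kappa> \<omega>) A)"

(* Point masses (s = 0) count as Gaussian; for example the imaginary parts vanish when beta = 1
   and the argument is real. *)
definition gaussian_law :: "real measure \<Rightarrow> bool" where
  "gaussian_law P \<longleftrightarrow> (\<exists>m s. P = distr std_normal_distribution borel (\<lambda>x. m + s * x))"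

definition jointly_gaussian_field :: "(complex \<Rightarrow> complex) measure \<Rightarrow> bool" where
  "jointly_gaussian_field P \<longleftrightarrow>
     (\<forall>\<Lambda> s t. finite \<Lambda> \<longrightarrow>
        gaussian_law (distr P borel (\<lambda>x. \<Sum>z\<in>\<Lambda>. s z * Re (x z) + t z * Im (x z))))"

end

theory Submission
  imports Defs
begin

text \<open>Part (1). Condition on the entries \<open>v\<close> of column \<open>k + 1\<close> above the diagonal. Conjugation by
  phases and real plane rotations acting on the first \<open>k\<close> coordinates moves \<open>v\<close> to
  \<open>(0, \<dots>, 0, |v|)\<close> without changing the characteristic polynomial, and the joint law of the remaining
  Gaussian entries is invariant under it. Since \<open>|v|\<close> has the law of \<open>b k\<close>, the column may be
  replaced by its Hessenberg form; going from the last column to the second one turns the matrix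
  with i.i.d. entries into \<open>H\<close>. Because \<open>v\<close> is frozen, no measurable choice of the rotations is
  needed.

  Part (3). \<open>X (k + 1)\<close> is an affine function of row \<open>k\<close> with coefficients measurable for the
  \<open>\<sigma>\<close>-field, and row \<open>k\<close> is independent of it, so conditional expectations are obtained by
  integrating out the row. This works with positive and negative parts separately and needs no
  integrability of \<open>X (k + 1)\<close> itself.\<close>

subsection \<open>Rotation invariance of the standard Gaussian\<close>

text \<open>The order of the columns is forced. Conjugation by a rotation or phase of the first k
  coordinates acts on rows \<open>0..<k\<close> from the left and on columns \<open>0..<k\<close>
  from the right. Columns after column k (counted from 0) are already Hessenberg and vanish in rows
  \<open>0..<k\<close>, so the left factor does not see them; columns before it are Gaussian in all
  n rows, so both factors preserve their law.

  Everything about Gaussians rests on one fact: a pair of independent copies is invariant under real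
  plane rotations. Phases for \<beta> = 2 are rotations of real and imaginary part; once phases have
  made the vector nonnegative, real rotations suffice; and \<open>a x + d y\<close> is a rotated
  coordinate times \<open>sqrt (a^2 + d^2)\<close>, which makes linear combinations Gaussian.

  Laws are compared through integrals of arbitrary nonnegative functions, so that Tonelli applies
  without integrability conditions.\<close>

lemma measure_eqI_nn_integral:
  assumes sets: "sets A = sets B"
    and eq: "\<And>f. f \<in> borel_measurable B \<Longrightarrow> (\<integral>\<^sup>+x. f x \<partial>A) = (\<integral>\<^sup>+x. f x \<partial>B)"
  shows "A = B"
proof (rule measure_eqI[OF sets])
  fix X assume X: "X \<in> sets A"
  then have X': "X \<in> sets B" using sets by simp
  have "(\<integral>\<^sup>+x. indicator X x \<partial>A) = (\<integral>\<^sup>+x. indicator X x \<partial>B)"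
    using X' by (intro eq) simp
  with X X' show "emeasure A X = emeasure B X" by simp
qed

text \<open>For a fixed value of the other coordinate a shear is a translation, so translation
  invariance of \<open>L\<close> on each fibre is enough; the shear of the outer coordinate needs
  the order of integration exchanged and exchanged back.\<close>

lemma nn_integral_shear:
  fixes L :: "'a::euclidean_space measure"
  assumes sf: "sigma_finite_measure L" and sL [measurable_cong]: "sets L = sets borel"
    and shift: "\<And>t g. g \<in> borel_measurable borel \<Longrightarrow> (\<integral>\<^sup>+z. g (z + t) \<partial>L) = (\<integral>\<^sup>+z. g z \<partial>L)"
    and f [measurable]: "f \<in> borel_measurable (borel \<Otimes>\<^sub>M borel)"
  shows "(\<integral>\<^sup>+z. \<integral>\<^sup>+w. f (z, w + a *\<^sub>R z) \<partial>L \<partial>L) = (\<integral>\<^sup>+z. \<integral>\<^sup>+w. f (z, w) \<partial>L \<partial>L)"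
    and "(\<integral>\<^sup>+z. \<integral>\<^sup>+w. f (z + a *\<^sub>R w, w) \<partial>L \<partial>L) = (\<integral>\<^sup>+z. \<integral>\<^sup>+w. f (z, w) \<partial>L \<partial>L)"
proof -
  interpret sigma_finite_measure L by (rule sf)
  interpret pair_sigma_finite L L by standard
  show "(\<integral>\<^sup>+z. \<integral>\<^sup>+w. f (z, w + a *\<^sub>R z) \<partial>L \<partial>L) = (\<integral>\<^sup>+z. \<integral>\<^sup>+w. f (z, w) \<partial>L \<partial>L)"
    by (intro nn_integral_cong shift[of "\<lambda>w. f (_, w)"]) measurable
  have "(\<integral>\<^sup>+z. \<integral>\<^sup>+w. f (z + a *\<^sub>R w, w) \<partial>L \<partial>L) = (\<integral>\<^sup>+w. \<integral>\<^sup>+z. f (z + a *\<^sub>R w, w) \<partial>L \<partial>L)"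
    by (rule Fubini'[symmetric]) measurable
  also have "\<dots> = (\<integral>\<^sup>+w. \<integral>\<^sup>+z. f (z, w) \<partial>L \<partial>L)"
    by (intro nn_integral_cong shift[of "\<lambda>z. f (z, _)"]) measurable
  also have "\<dots> = (\<integral>\<^sup>+z. \<integral>\<^sup>+w. f (z, w) \<partial>L \<partial>L)"
    by (rule Fubini') measurable
  finally show "(\<integral>\<^sup>+z. \<integral>\<^sup>+w. f (z + a *\<^sub>R w, w) \<partial>L \<partial>L) = (\<integral>\<^sup>+z. \<integral>\<^sup>+w. f (z, w) \<partial>L \<partial>L)" .
qed

text \<open>Stated for iterated integrals, the shape that appears after two coordinates are peeled
  off a product. The coefficients are real even when \<open>'a\<close> is the complex plane: the
  rotation mixes two copies of \<open>'a\<close> and ignores the structure inside it.\<close>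

definition rotation_invariant :: "'a::euclidean_space measure \<Rightarrow> bool" where
  "rotation_invariant P \<longleftrightarrow> (\<forall>c s. \<forall>f\<in>borel_measurable (borel \<Otimes>\<^sub>M borel). c\<^sup>2 + s\<^sup>2 = 1 \<longrightarrow>
     (\<integral>\<^sup>+z. \<integral>\<^sup>+w. f (c *\<^sub>R z + s *\<^sub>R w, c *\<^sub>R w - s *\<^sub>R z) \<partial>P \<partial>P) = (\<integral>\<^sup>+z. \<integral>\<^sup>+w. f (z, w) \<partial>P \<partial>P))"

lemma rotation_invariantD:
  assumes "rotation_invariant P" "f \<in> borel_measurable (borel \<Otimes>\<^sub>M borel)" "c\<^sup>2 + s\<^sup>2 = 1"
  shows "(\<integral>\<^sup>+z. \<integral>\<^sup>+w. f (c *\<^sub>R z + s *\<^sub>R w, c *\<^sub>R w - s *\<^sub>R z) \<partial>P \<partial>P) = (\<integral>\<^sup>+z. \<integral>\<^sup>+w. f (z, w) \<partial>P \<partial>P)"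
  using assms unfolding rotation_invariant_def by blast

text \<open>A plane rotation is a product of three shears, and shears preserve \<open>L \<Otimes>\<^sub>M L\<close>.\<close>

lemma rotation_invariant_gaussian_density:
  fixes L :: "'a::euclidean_space measure"
  assumes sf: "sigma_finite_measure L" and sL [measurable_cong]: "sets L = sets borel"
    and shift: "\<And>t g. g \<in> borel_measurable borel \<Longrightarrow> (\<integral>\<^sup>+z. g (z + t) \<partial>L) = (\<integral>\<^sup>+z. g z \<partial>L)"
    and C: "0 \<le> C"
  shows "rotation_invariant (density L (\<lambda>z. ennreal (C * exp (- k * (norm z)\<^sup>2))))"
proof -
  define p where "p z = ennreal (C * exp (- k * (norm z)\<^sup>2))" for z :: 'a
  have [measurable]: "p \<in> borel_measurable borel" unfolding p_def by measurable
  have int: "(\<integral>\<^sup>+z. \<integral>\<^sup>+w. g (z, w) \<partial>density L p \<partial>density L p)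
      = (\<integral>\<^sup>+z. \<integral>\<^sup>+w. p z * p w * g (z, w) \<partial>L \<partial>L)"
    if [measurable]: "g \<in> borel_measurable (borel \<Otimes>\<^sub>M borel)" for g
  proof -
    interpret sigma_finite_measure L by (rule sf)
    have "(\<integral>\<^sup>+z. \<integral>\<^sup>+w. g (z, w) \<partial>density L p \<partial>density L p)
        = (\<integral>\<^sup>+z. \<integral>\<^sup>+w. p w * g (z, w) \<partial>L \<partial>density L p)"
      by (intro nn_integral_cong nn_integral_density) (simp_all, measurable)
    also have "\<dots> = (\<integral>\<^sup>+z. p z * (\<integral>\<^sup>+w. p w * g (z, w) \<partial>L) \<partial>L)"
      by (rule nn_integral_density) (simp_all, measurable)
    also have "\<dots> = (\<integral>\<^sup>+z. \<integral>\<^sup>+w. p z * p w * g (z, w) \<partial>L \<partial>L)"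
      by (intro nn_integral_cong) (simp add: mult.assoc nn_integral_cmult)
    finally show ?thesis .
  qed
  \<comment> \<open>The product density depends only on \<open>|z|^2 + |w|^2\<close>, which the
    rotation keeps.\<close>
  have pp: "p (c *\<^sub>R z + s *\<^sub>R w) * p (c *\<^sub>R w - s *\<^sub>R z) = p z * p w" if "c\<^sup>2 + s\<^sup>2 = 1" for c s z w
  proof -
    have "(norm (c *\<^sub>R z + s *\<^sub>R w))\<^sup>2 + (norm (c *\<^sub>R w - s *\<^sub>R z))\<^sup>2
        = (c\<^sup>2 + s\<^sup>2) * ((norm z)\<^sup>2 + (norm w)\<^sup>2)"
      unfolding power2_norm_eq_inner
      by (simp add: inner_add_left inner_add_right inner_diff_left inner_diff_right
          inner_commute[of w z] algebra_simps power2_eq_square)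
    then have "k * (norm (c *\<^sub>R z + s *\<^sub>R w))\<^sup>2 + k * (norm (c *\<^sub>R w - s *\<^sub>R z))\<^sup>2 = k * (norm z)\<^sup>2 + k * (norm w)\<^sup>2"
      by (simp add: that flip: distrib_left)
    then have "exp (- k * (norm (c *\<^sub>R z + s *\<^sub>R w))\<^sup>2) * exp (- k * (norm (c *\<^sub>R w - s *\<^sub>R z))\<^sup>2)
        = exp (- k * (norm z)\<^sup>2) * exp (- k * (norm w)\<^sup>2)"
      by (simp flip: exp_add)
    then show ?thesis unfolding p_def using C
      by (simp flip: ennreal_mult add: mult_ac)
  qed
  have rot: "(\<integral>\<^sup>+z. \<integral>\<^sup>+w. f (c *\<^sub>R z + s *\<^sub>R w, c *\<^sub>R w - s *\<^sub>R z) \<partial>density L p \<partial>density L p)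
      = (\<integral>\<^sup>+z. \<integral>\<^sup>+w. f (z, w) \<partial>density L p \<partial>density L p)"
    if f [measurable]: "f \<in> borel_measurable (borel \<Otimes>\<^sub>M borel)" and cs: "c\<^sup>2 + s\<^sup>2 = 1" and s: "s \<noteq> 0" for f c s
  proof -
    define F where "F = (\<lambda>(z, w). p z * p w * f (z, w))"
    \<comment> \<open>With c the cosine and s the sine of an angle, this is the tangent of half the
      angle. The rotation is the shear by x, then by -s, then by x again; the half-angle identities
      used below are \<open>1 - s x = c\<close> and \<open>x (1 + c) = s\<close>.\<close>
    define x where "x = (1 - c) / s"
    have [measurable]: "F \<in> borel_measurable (borel \<Otimes>\<^sub>M borel)" unfolding F_def by measurable
    define G where "G = (\<lambda>(z, w). F (z + x *\<^sub>R w, w))"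
    have [measurable]: "G \<in> borel_measurable (borel \<Otimes>\<^sub>M borel)" unfolding G_def by measurable
    define H where "H = (\<lambda>(z, w). G (z, w + (- s) *\<^sub>R z))"
    have [measurable]: "H \<in> borel_measurable (borel \<Otimes>\<^sub>M borel)" unfolding H_def by measurable
    have H: "H (z + x *\<^sub>R w, w) = F (c *\<^sub>R z + s *\<^sub>R w, c *\<^sub>R w - s *\<^sub>R z)" for z w
    proof -
      have 1: "1 - s * x = c" using s by (simp add: x_def)
      have "s * (x * (1 + c)) = (1 - c) * (1 + c)" using s by (simp add: x_def)
      also have "\<dots> = s * s" using cs by (simp add: power2_eq_square algebra_simps)
      finally have "s * (x * (1 + c)) = s * s" .
      then have 2: "x * (1 + c) = s" using s by simp
      have w: "w + (- s) *\<^sub>R (z + x *\<^sub>R w) = c *\<^sub>R w - s *\<^sub>R z"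
        by (subst 1[symmetric]) (simp add: algebra_simps)
      have "z + x *\<^sub>R w + x *\<^sub>R (c *\<^sub>R w - s *\<^sub>R z) = (1 - s * x) *\<^sub>R z + (x * (1 + c)) *\<^sub>R w"
        by (simp add: algebra_simps)
      then have z: "z + x *\<^sub>R w + x *\<^sub>R (c *\<^sub>R w - s *\<^sub>R z) = c *\<^sub>R z + s *\<^sub>R w"
        unfolding 1 2 .
      show ?thesis unfolding H_def G_def by (simp only: prod.case w z)
    qed
    have "(\<integral>\<^sup>+z. \<integral>\<^sup>+w. f (c *\<^sub>R z + s *\<^sub>R w, c *\<^sub>R w - s *\<^sub>R z) \<partial>density L p \<partial>density L p)
        = (\<integral>\<^sup>+z. \<integral>\<^sup>+w. p z * p w * f (c *\<^sub>R z + s *\<^sub>R w, c *\<^sub>R w - s *\<^sub>R z) \<partial>L \<partial>L)"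
      by (rule int[of "\<lambda>(z, w). f (c *\<^sub>R z + s *\<^sub>R w, c *\<^sub>R w - s *\<^sub>R z)", unfolded prod.case]) measurable
    also have "\<dots> = (\<integral>\<^sup>+z. \<integral>\<^sup>+w. H (z + x *\<^sub>R w, w) \<partial>L \<partial>L)"
      by (simp add: H F_def pp[OF cs])
    also have "\<dots> = (\<integral>\<^sup>+z. \<integral>\<^sup>+w. H (z, w) \<partial>L \<partial>L)"
      by (rule nn_integral_shear(2)[OF sf sL shift]) simp_all
    also have "\<dots> = (\<integral>\<^sup>+z. \<integral>\<^sup>+w. G (z, w + (- s) *\<^sub>R z) \<partial>L \<partial>L)" by (simp add: H_def)
    also have "\<dots> = (\<integral>\<^sup>+z. \<integral>\<^sup>+w. G (z, w) \<partial>L \<partial>L)"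
      by (rule nn_integral_shear(1)[OF sf sL shift]) simp_all
    also have "\<dots> = (\<integral>\<^sup>+z. \<integral>\<^sup>+w. F (z + x *\<^sub>R w, w) \<partial>L \<partial>L)" by (simp add: G_def)
    also have "\<dots> = (\<integral>\<^sup>+z. \<integral>\<^sup>+w. F (z, w) \<partial>L \<partial>L)"
      by (rule nn_integral_shear(2)[OF sf sL shift]) simp_all
    also have "\<dots> = (\<integral>\<^sup>+z. \<integral>\<^sup>+w. f (z, w) \<partial>density L p \<partial>density L p)"
      by (subst int[OF f]) (simp add: F_def)
    finally show ?thesis .
  qed
  show ?thesis unfolding rotation_invariant_def p_def[symmetric]
  proof (intro allI ballI impI)
    fix c s :: real and f :: "'a \<times> 'a \<Rightarrow> ennreal"
    assume f [measurable]: "f \<in> borel_measurable (borel \<Otimes>\<^sub>M borel)" and cs: "c\<^sup>2 + s\<^sup>2 = 1"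
    show "(\<integral>\<^sup>+z. \<integral>\<^sup>+w. f (c *\<^sub>R z + s *\<^sub>R w, c *\<^sub>R w - s *\<^sub>R z) \<partial>density L p \<partial>density L p)
      = (\<integral>\<^sup>+z. \<integral>\<^sup>+w. f (z, w) \<partial>density L p \<partial>density L p)"
    proof (cases "s = 0")
      case False
      then show ?thesis by (intro rot f cs)
    next
      case True
      then consider "c = 1" | "c = -1" using cs by (auto simp: power2_eq_1_iff)
      then show ?thesis
      proof cases
        case 1
        then show ?thesis using True by simp
      next
        case 2
        have "(\<integral>\<^sup>+z. \<integral>\<^sup>+w. f (- z, - w) \<partial>density L p \<partial>density L p)
            = (\<integral>\<^sup>+z. \<integral>\<^sup>+w. f (w, - z) \<partial>density L p \<partial>density L p)"
          using rot[of "\<lambda>(z, w). f (w, - z)" 0 1] by simp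
        also have "\<dots> = (\<integral>\<^sup>+z. \<integral>\<^sup>+w. f (z, w) \<partial>density L p \<partial>density L p)"
          using rot[of f 0 1] by simp
        finally show ?thesis using True 2 by simp
      qed
    qed
  qed
qed

lemma nn_integral_lborel_shift:
  fixes g :: "real \<Rightarrow> ennreal"
  assumes [measurable]: "g \<in> borel_measurable borel"
  shows "(\<integral>\<^sup>+x. g (x + t) \<partial>lborel) = (\<integral>\<^sup>+x. g x \<partial>lborel)"
  using nn_integral_real_affine[of g 1 t] by (simp add: add.commute)

lemma rotation_invariant_normal:
  assumes "0 < \<sigma>"
  shows "rotation_invariant (density lborel (normal_density 0 \<sigma>))"
proof -
  have "density lborel (normal_density 0 \<sigma>) =
      density lborel (\<lambda>z. ennreal (1 / sqrt (2 * pi * \<sigma>\<^sup>2) * exp (- (1 / (2 * \<sigma>\<^sup>2)) * (norm z)\<^sup>2)))"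
    by (simp add: normal_density_def)
  then show ?thesis
    by (simp only:) (rule rotation_invariant_gaussian_density,
        simp_all add: nn_integral_lborel_shift lborel.sigma_finite_measure_axioms)
qed

lemma borel_measurable_Complex_pair [measurable]:
  "(\<lambda>(x, y). Complex x y) \<in> borel_measurable (borel \<Otimes>\<^sub>M borel)"
proof -
  have "(\<lambda>p. of_real (fst p) + \<i> * of_real (snd p)) \<in> borel_measurable (borel \<Otimes>\<^sub>M borel)"
    by measurable
  then show ?thesis by (simp add: Complex_eq case_prod_beta')
qed

lemma borel_measurable_Complex [measurable (raw)]:
  assumes "f \<in> borel_measurable M" "g \<in> borel_measurable M"
  shows "(\<lambda>x. Complex (f x) (g x)) \<in> borel_measurable M"
  unfolding Complex_eq using assms by measurable

abbreviation half_normal :: "real measure" where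
  "half_normal \<equiv> density lborel (normal_density 0 (sqrt (1/2)))"

lemma std_gaussian_1: "std_gaussian 1 = distr std_normal_distribution borel complex_of_real"
  and std_gaussian_2: "std_gaussian 2 = distr (half_normal \<Otimes>\<^sub>M half_normal) borel (\<lambda>(x, y). Complex x y)"
  by (simp_all add: std_gaussian_def)

lemma sets_std_gaussian [simp, measurable_cong]: "sets (std_gaussian \<beta>) = sets borel"
  and space_std_gaussian [simp]: "space (std_gaussian \<beta>) = UNIV"
  by (simp_all add: std_gaussian_def)

lemma nn_integral_std_gaussian_1:
  assumes [measurable]: "f \<in> borel_measurable borel"
  shows "(\<integral>\<^sup>+z. f z \<partial>std_gaussian 1) = (\<integral>\<^sup>+x. f (complex_of_real x) \<partial>std_normal_distribution)"
  unfolding std_gaussian_1 by (subst nn_integral_distr) simp_all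

lemma nn_integral_std_gaussian_2:
  assumes [measurable]: "f \<in> borel_measurable borel"
  shows "(\<integral>\<^sup>+z. f z \<partial>std_gaussian 2) = (\<integral>\<^sup>+x. \<integral>\<^sup>+y. f (Complex x y) \<partial>half_normal \<partial>half_normal)"
proof -
  interpret h: prob_space half_normal by (rule prob_space_normal_density) simp
  interpret pair_sigma_finite half_normal half_normal ..
  have "(\<integral>\<^sup>+z. f z \<partial>std_gaussian 2) = (\<integral>\<^sup>+p. f (case p of (x, y) \<Rightarrow> Complex x y) \<partial>(half_normal \<Otimes>\<^sub>M half_normal))"
    unfolding std_gaussian_2 by (rule nn_integral_distr) measurable
  also have "\<dots> = (\<integral>\<^sup>+x. \<integral>\<^sup>+y. f (Complex x y) \<partial>half_normal \<partial>half_normal)"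
    by (subst h.nn_integral_fst[symmetric]) simp_all
  finally show ?thesis .
qed

lemma prob_space_std_gaussian: "prob_space (std_gaussian \<beta>)"
proof (cases "\<beta> = 1")
  case True
  interpret s: prob_space std_normal_distribution by (rule prob_space_normal_density) simp
  show ?thesis unfolding True std_gaussian_1 by (rule s.prob_space_distr) simp
next
  case False
  interpret h: prob_space half_normal by (rule prob_space_normal_density) simp
  interpret pair_prob_space half_normal half_normal ..
  have "std_gaussian \<beta> = std_gaussian 2" using False by (simp add: std_gaussian_def)
  then show ?thesis unfolding std_gaussian_2 by (simp add: prob_space_distr)
qed

text \<open>\<open>std_gaussian 2\<close> has a density with respect to the image of \<open>lborel \<Otimes>\<^sub>M lborel\<close> under
  \<open>Complex\<close>, which is translation invariant.\<close>

lemma rotation_invariant_std_gaussian: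
  assumes "\<beta> \<in> {1, 2}"
  shows "rotation_invariant (std_gaussian \<beta>)"
proof (cases "\<beta> = 1")
  case True
  \<comment> \<open>This law sits on the real axis and has no density on the plane. The rotation is
    carried out on real variables; as c and s are real, embedding the reals commutes with
    it.\<close>
  have "rotation_invariant (std_gaussian 1)"
    unfolding rotation_invariant_def
  proof (intro allI ballI impI)
    fix c s :: real and f :: "complex \<times> complex \<Rightarrow> ennreal"
    assume f [measurable]: "f \<in> borel_measurable (borel \<Otimes>\<^sub>M borel)" and cs: "c\<^sup>2 + s\<^sup>2 = 1"
    interpret s: prob_space std_normal_distribution by (rule prob_space_normal_density) simp
    interpret g: prob_space "std_gaussian 1" by (rule prob_space_std_gaussian)
    have int: "(\<integral>\<^sup>+z. \<integral>\<^sup>+w. g (z, w) \<partial>std_gaussian 1 \<partial>std_gaussian 1)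
      = (\<integral>\<^sup>+x. \<integral>\<^sup>+y. g (of_real x, of_real y) \<partial>std_normal_distribution \<partial>std_normal_distribution)"
      if [measurable]: "g \<in> borel_measurable (borel \<Otimes>\<^sub>M borel)" for g
    proof -
      have "(\<integral>\<^sup>+z. \<integral>\<^sup>+w. g (z, w) \<partial>std_gaussian 1 \<partial>std_gaussian 1)
          = (\<integral>\<^sup>+x. \<integral>\<^sup>+w. g (of_real x, w) \<partial>std_gaussian 1 \<partial>std_normal_distribution)"
        by (rule nn_integral_std_gaussian_1) measurable
      also have "\<dots> = (\<integral>\<^sup>+x. \<integral>\<^sup>+y. g (of_real x, of_real y) \<partial>std_normal_distribution \<partial>std_normal_distribution)"
        by (intro nn_integral_cong nn_integral_std_gaussian_1) measurable
      finally show ?thesis .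
    qed
    show "(\<integral>\<^sup>+z. \<integral>\<^sup>+w. f (c *\<^sub>R z + s *\<^sub>R w, c *\<^sub>R w - s *\<^sub>R z) \<partial>std_gaussian 1 \<partial>std_gaussian 1)
      = (\<integral>\<^sup>+z. \<integral>\<^sup>+w. f (z, w) \<partial>std_gaussian 1 \<partial>std_gaussian 1)"
      using int[of "\<lambda>(z, w). f (c *\<^sub>R z + s *\<^sub>R w, c *\<^sub>R w - s *\<^sub>R z)"] int[of f]
        rotation_invariantD[OF rotation_invariant_normal[of 1] _ cs, of "\<lambda>(x, y). f (of_real x, of_real y)"]
      by (simp add: scaleR_conv_of_real)
  qed
  then show ?thesis by (simp add: True)
next
  case False
  then have \<beta>: "\<beta> = 2" using assms by simp
  define L where "L = distr (lborel \<Otimes>\<^sub>M lborel) borel (\<lambda>(x, y). Complex x y)"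
  have intL: "(\<integral>\<^sup>+z. g z \<partial>L) = (\<integral>\<^sup>+x. \<integral>\<^sup>+y. g (Complex x y) \<partial>lborel \<partial>lborel)"
    if [measurable]: "g \<in> borel_measurable borel" for g
  proof -
    have "(\<integral>\<^sup>+z. g z \<partial>L) = (\<integral>\<^sup>+p. g (case p of (x, y) \<Rightarrow> Complex x y) \<partial>(lborel \<Otimes>\<^sub>M lborel))"
      unfolding L_def by (rule nn_integral_distr) measurable
    also have "\<dots> = (\<integral>\<^sup>+x. \<integral>\<^sup>+y. g (Complex x y) \<partial>lborel \<partial>lborel)"
      by (subst lborel.nn_integral_fst[symmetric]) simp_all
    finally show ?thesis .
  qed
  have sL [measurable_cong]: "sets L = sets borel" by (simp add: L_def)
  have Complex_plus: "Complex x y + t = Complex (x + Re t) (y + Im t)" for x y t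
    by (simp add: complex_eq_iff)
  have shift: "(\<integral>\<^sup>+z. g (z + t) \<partial>L) = (\<integral>\<^sup>+z. g z \<partial>L)" if [measurable]: "g \<in> borel_measurable borel" for t g
  proof -
    have "(\<integral>\<^sup>+z. g (z + t) \<partial>L) = (\<integral>\<^sup>+x. \<integral>\<^sup>+y. g (Complex (x + Re t) (y + Im t)) \<partial>lborel \<partial>lborel)"
      by (subst intL) (simp_all add: Complex_plus)
    also have "\<dots> = (\<integral>\<^sup>+x. \<integral>\<^sup>+y. g (Complex (x + Re t) y) \<partial>lborel \<partial>lborel)"
      by (intro nn_integral_cong nn_integral_lborel_shift) measurable
    also have "\<dots> = (\<integral>\<^sup>+x. \<integral>\<^sup>+y. g (Complex x y) \<partial>lborel \<partial>lborel)"
      by (rule nn_integral_lborel_shift) measurable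
    finally show ?thesis by (simp add: intL)
  qed
  \<comment> \<open>\<sigma>-finiteness is pulled back along \<open>(Re, Im)\<close>, whose image of
    \<open>L\<close> is the plane Lebesgue measure.\<close>
  have sf: "sigma_finite_measure L"
  proof -
    have sf: "sigma_finite_measure (lborel \<Otimes>\<^sub>M lborel :: (real \<times> real) measure)"
      by (rule sigma_finite_pair_measure) (rule lborel.sigma_finite_measure_axioms)+
    have "distr L (lborel \<Otimes>\<^sub>M lborel) (\<lambda>z. (Re z, Im z)) = lborel \<Otimes>\<^sub>M lborel"
      unfolding L_def by (subst distr_distr) (simp_all add: comp_def case_prod_beta' distr_id2)
    then show ?thesis
      using sf
      by (intro sigma_finite_measure_distr[of L "lborel \<Otimes>\<^sub>M lborel" "\<lambda>z. (Re z, Im z)"]) (simp_all add: L_def)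
  qed
  define p where "p z = ennreal (1 / pi * exp (- 1 * (norm z)\<^sup>2))" for z :: complex
  have [measurable]: "p \<in> borel_measurable borel" unfolding p_def by measurable
  have p: "p (Complex x y) = ennreal (normal_density 0 (sqrt (1/2)) x) * ennreal (normal_density 0 (sqrt (1/2)) y)" for x y
  proof -
    have "normal_density 0 (sqrt (1/2)) x * normal_density 0 (sqrt (1/2)) y = 1 / pi * exp (- (x\<^sup>2) - y\<^sup>2)"
      by (simp add: normal_density_def exp_diff exp_minus field_simps flip: exp_add)
    then show ?thesis
      by (simp add: p_def cmod_power2 flip: ennreal_mult)
  qed
  have "std_gaussian 2 = density L p"
  proof (rule measure_eqI_nn_integral)
    show "sets (std_gaussian 2) = sets (density L p)" by (simp add: sL)
  next
    fix f :: "complex \<Rightarrow> ennreal" assume "f \<in> borel_measurable (density L p)"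
    then have [measurable]: "f \<in> borel_measurable borel" by (simp add: sL cong: measurable_cong_sets)
    have "(\<integral>\<^sup>+z. f z \<partial>density L p) = (\<integral>\<^sup>+z. p z * f z \<partial>L)" by (rule nn_integral_density) measurable
    also have "\<dots> = (\<integral>\<^sup>+x. \<integral>\<^sup>+y. p (Complex x y) * f (Complex x y) \<partial>lborel \<partial>lborel)"
      by (rule intL) measurable
    also have "\<dots> = (\<integral>\<^sup>+x. ennreal (normal_density 0 (sqrt (1/2)) x) * (\<integral>\<^sup>+y. ennreal (normal_density 0 (sqrt (1/2)) y) * f (Complex x y) \<partial>lborel) \<partial>lborel)"
      by (simp add: p mult.assoc nn_integral_cmult)
    also have "\<dots> = (\<integral>\<^sup>+x. \<integral>\<^sup>+y. ennreal (normal_density 0 (sqrt (1/2)) y) * f (Complex x y) \<partial>lborel \<partial>half_normal)"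
      by (rule nn_integral_density[symmetric]) measurable
    also have "\<dots> = (\<integral>\<^sup>+x. \<integral>\<^sup>+y. f (Complex x y) \<partial>half_normal \<partial>half_normal)"
      by (intro nn_integral_cong nn_integral_density[symmetric]) measurable
    also have "\<dots> = (\<integral>\<^sup>+z. f z \<partial>std_gaussian 2)" by (simp add: nn_integral_std_gaussian_2)
    finally show "(\<integral>\<^sup>+z. f z \<partial>std_gaussian 2) = (\<integral>\<^sup>+z. f z \<partial>density L p)" by simp
  qed
  moreover have "rotation_invariant (density L p)"
    unfolding p_def by (rule rotation_invariant_gaussian_density[OF sf sL shift]) auto
  ultimately show ?thesis by (simp add: \<beta>)
qed

subsection \<open>Orthogonal maps preserving Gaussian products\<close>

text \<open>For \<beta> = 1 the phase is 1 or -1, a rotation with s = 0 of which only the first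
  coordinate is read. For \<beta> = 2 multiplication by u rotates the independent pair
  \<open>(Re z, Im z)\<close>, with \<open>c = Re u\<close> and \<open>s = - Im u\<close>.\<close>

lemma nn_integral_std_gaussian_phase:
  assumes \<beta>: "\<beta> \<in> {1, 2}" and u: "cmod u = 1" "\<beta> = 1 \<Longrightarrow> u \<in> \<real>"
    and f [measurable]: "f \<in> borel_measurable borel"
  shows "(\<integral>\<^sup>+z. f (u * z) \<partial>std_gaussian \<beta>) = (\<integral>\<^sup>+z. f z \<partial>std_gaussian \<beta>)"
proof (cases "\<beta> = 1")
  case True
  interpret prob_space "std_gaussian \<beta>" by (rule prob_space_std_gaussian)
  from True u(2) obtain r where r: "u = complex_of_real r" by (auto elim: Reals_cases)
  with u(1) have "r\<^sup>2 = 1" by (simp add: abs_square_eq_1)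
  then have "r\<^sup>2 + 0\<^sup>2 = 1" by simp
  from rotation_invariantD[OF rotation_invariant_std_gaussian[OF \<beta>] _ this, of "\<lambda>(z, w). f z"]
  show ?thesis by (simp add: emeasure_space_1[simplified] scaleR_conv_of_real r)
next
  case False
  then have "\<beta> = 2" using \<beta> by simp
  have "u * Complex x y = Complex (Re u *\<^sub>R x + (- Im u) *\<^sub>R y) (Re u *\<^sub>R y - (- Im u) *\<^sub>R x)" for x y
    by (simp add: complex_eq_iff)
  moreover have "(Re u)\<^sup>2 + (- Im u)\<^sup>2 = 1" using u(1) by (simp add: cmod_def)
  ultimately show ?thesis
    using rotation_invariantD[OF rotation_invariant_normal[of "sqrt (1/2)"], of "\<lambda>(x, y). f (Complex x y)" "Re u" "- Im u"]
    by (simp add: \<open>\<beta> = 2\<close> nn_integral_std_gaussian_2)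
qed

definition preserves :: "'a measure \<Rightarrow> ('a \<Rightarrow> 'a) \<Rightarrow> bool" where
  "preserves P T \<longleftrightarrow> T \<in> P \<rightarrow>\<^sub>M P \<and> distr P P T = P"

lemma preserves_comp:
  "preserves P S \<Longrightarrow> preserves P T \<Longrightarrow> preserves P (\<lambda>x. S (T x))"
  unfolding preserves_def using distr_distr[of S P P T P] by (auto simp: comp_def)

lemma preserves_nn_integral:
  "preserves P T \<Longrightarrow> f \<in> borel_measurable P \<Longrightarrow> (\<integral>\<^sup>+x. f (T x) \<partial>P) = (\<integral>\<^sup>+x. f x \<partial>P)"
  unfolding preserves_def by (metis nn_integral_distr measurable_distr_eq1)

lemma preservesI:
  assumes "T \<in> P \<rightarrow>\<^sub>M P"
    and "\<And>f. f \<in> borel_measurable P \<Longrightarrow> (\<integral>\<^sup>+x. f (T x) \<partial>P) = (\<integral>\<^sup>+x. f x \<partial>P)"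
  shows "preserves P T"
  unfolding preserves_def using assms
  by (auto intro!: measure_eqI_nn_integral simp: nn_integral_distr)

text \<open>The coordinate laws may differ: Gaussian entries and superdiagonal chi entries, embedded
  in the complex numbers, live in one product.\<close>

definition complex_product :: "('i \<Rightarrow> complex measure) \<Rightarrow> bool" where
  "complex_product D \<longleftrightarrow> (\<forall>i. prob_space (D i) \<and> sets (D i) = sets borel)"

lemma complex_productD:
  assumes "complex_product D"
  shows "product_prob_space D" "sets (D i) = sets borel" "space (D i) = UNIV" "prob_space (D i)"
proof -
  show s: "sets (D i) = sets borel" and "prob_space (D i)" using assms by (auto simp: complex_product_def)
  show "space (D i) = UNIV" using sets_eq_imp_space_eq[OF s] by simp
  show "product_prob_space D"
    using assms by (intro product_prob_space.intro product_sigma_finite.intro product_prob_space_axioms.intro)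
      (auto simp: complex_product_def intro: prob_space_imp_sigma_finite)
qed

lemma preserves_phase:
  assumes CP: "complex_product D"
    and J: "finite J" "i \<in> J" and D: "D i = std_gaussian \<beta>"
    and \<beta>: "\<beta> \<in> {1, 2}" and u: "cmod u = 1" "\<beta> = 1 \<Longrightarrow> u \<in> \<real>"
  shows "preserves (Pi\<^sub>M J D) (\<lambda>x. x(i := u * x i))"
proof (rule preservesI)
  interpret product_prob_space D by (rule complex_productD[OF CP])
  note [measurable_cong, simp] = complex_productD(2)[OF CP]
  note [simp] = complex_productD(3)[OF CP]
  show T: "(\<lambda>x. x(i := u * x i)) \<in> Pi\<^sub>M J D \<rightarrow>\<^sub>M Pi\<^sub>M J D"
    using J by (intro measurable_fun_upd[where J=J]) auto
  fix f :: "('a \<Rightarrow> complex) \<Rightarrow> ennreal" assume f [measurable]: "f \<in> borel_measurable (Pi\<^sub>M J D)"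
  define K where "K = J - {i}"
  have K: "finite K" "i \<notin> K" "J = insert i K" using J by (auto simp: K_def)
  have f': "f \<in> borel_measurable (Pi\<^sub>M (insert i K) D)" using f K by simp
  have fT: "(\<lambda>x. f (x(i := u * x i))) \<in> borel_measurable (Pi\<^sub>M (insert i K) D)"
    using measurable_comp[OF T f] K by (simp add: comp_def)
  show "(\<integral>\<^sup>+x. f (x(i := u * x i)) \<partial>Pi\<^sub>M J D) = (\<integral>\<^sup>+x. f x \<partial>Pi\<^sub>M J D)"
    unfolding K(3) product_nn_integral_insert[OF K(1,2) f'] product_nn_integral_insert[OF K(1,2) fT]
  proof (rule nn_integral_cong)
    fix x assume x: "x \<in> space (Pi\<^sub>M K D)"
    have "(\<lambda>z. x(i := z)) \<in> D i \<rightarrow>\<^sub>M Pi\<^sub>M (insert i K) D"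
      using x K(2) by (rule measurable_component_update)
    then have "(\<lambda>z. f (x(i := z))) \<in> borel_measurable (D i)" using f' by measurable
    then have "(\<lambda>z. f (x(i := z))) \<in> borel_measurable borel" by (simp cong: measurable_cong_sets)
    then show "(\<integral>\<^sup>+z. f ((x(i := z))(i := u * (x(i := z)) i)) \<partial>D i) = (\<integral>\<^sup>+z. f (x(i := z)) \<partial>D i)"
      using nn_integral_std_gaussian_phase[OF \<beta> u, of "\<lambda>z. f (x(i := z))"] D by simp
  qed
qed

lemma preserves_rotation:
  assumes CP: "complex_product D"
    and J: "finite J" "i \<in> J" "j \<in> J" "i \<noteq> j" and D: "D i = P" "D j = P"
    and rotP: "rotation_invariant P" and cs: "c\<^sup>2 + s\<^sup>2 = 1"
  shows "preserves (Pi\<^sub>M J D) (\<lambda>x. x(i := c *\<^sub>R x i + s *\<^sub>R x j, j := c *\<^sub>R x j - s *\<^sub>R x i))" (is "preserves _ ?T")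
proof (rule preservesI)
  interpret product_prob_space D by (rule complex_productD[OF CP])
  note [measurable_cong, simp] = complex_productD(2)[OF CP]
  note [simp] = complex_productD(3)[OF CP]
  have "(\<lambda>x. x(i := c *\<^sub>R x i + s *\<^sub>R x j)) \<in> Pi\<^sub>M J D \<rightarrow>\<^sub>M Pi\<^sub>M J D"
    using J by (intro measurable_fun_upd[where J=J]) auto
  then show T: "?T \<in> Pi\<^sub>M J D \<rightarrow>\<^sub>M Pi\<^sub>M J D"
    using J by (intro measurable_fun_upd[where J=J]) auto
  fix f :: "('a \<Rightarrow> complex) \<Rightarrow> ennreal" assume f [measurable]: "f \<in> borel_measurable (Pi\<^sub>M J D)"
  define K where "K = J - {i, j}"
  have K: "finite K" "j \<notin> K" "finite (insert j K)" "i \<notin> insert j K" "J = insert i (insert j K)"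
    using J by (auto simp: K_def)
  have int: "(\<integral>\<^sup>+x. g x \<partial>Pi\<^sub>M J D) = (\<integral>\<^sup>+x. \<integral>\<^sup>+w. \<integral>\<^sup>+z. g (x(j := w, i := z)) \<partial>P \<partial>P \<partial>Pi\<^sub>M K D)"
    if g: "g \<in> borel_measurable (Pi\<^sub>M J D)" for g
  proof -
    have g': "g \<in> borel_measurable (Pi\<^sub>M (insert i (insert j K)) D)" using g K(5) by simp
    have g2: "(\<lambda>x. \<integral>\<^sup>+z. g (x(i := z)) \<partial>D i) \<in> borel_measurable (Pi\<^sub>M (insert j K) D)"
    proof (rule sigma_finite_measure.borel_measurable_nn_integral[OF sigma_finite_measures])
      have "(\<lambda>p. (fst p)(i := snd p)) \<in> Pi\<^sub>M (insert j K) D \<Otimes>\<^sub>M D i \<rightarrow>\<^sub>M Pi\<^sub>M (insert i (insert j K)) D"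
        by (rule measurable_fun_upd[where J="insert j K"]) auto
      from measurable_compose[OF this g']
      show "(\<lambda>(x, z). g (x(i := z))) \<in> borel_measurable (Pi\<^sub>M (insert j K) D \<Otimes>\<^sub>M D i)"
        by (simp add: case_prod_beta')
    qed
    show ?thesis
      unfolding K(5) product_nn_integral_insert[OF K(3,4) g'] D product_nn_integral_insert[OF K(1,2) g2[unfolded D]] D ..
  qed
  have fT: "(\<lambda>x. f (?T x)) \<in> borel_measurable (Pi\<^sub>M J D)"
    using measurable_comp[OF T f] by (simp add: comp_def)
  have sP: "sets P = sets borel" using D complex_productD(2)[OF CP] by metis
  show "(\<integral>\<^sup>+x. f (?T x) \<partial>Pi\<^sub>M J D) = (\<integral>\<^sup>+x. f x \<partial>Pi\<^sub>M J D)"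
    unfolding int[OF f] int[OF fT]
  proof (rule nn_integral_cong)
    fix x assume x: "x \<in> space (Pi\<^sub>M K D)"
    define h where "h = (\<lambda>(w, z). f (x(j := w, i := z)))"
    have "(\<lambda>p. x(j := fst p)) \<in> borel \<Otimes>\<^sub>M borel \<rightarrow>\<^sub>M Pi\<^sub>M (insert j K) D"
      using x by (intro measurable_fun_upd[where J=K]) auto
    then have "(\<lambda>p. x(j := fst p, i := snd p)) \<in> borel \<Otimes>\<^sub>M borel \<rightarrow>\<^sub>M Pi\<^sub>M J D"
      unfolding K(5) by (intro measurable_fun_upd[where J="insert j K" and f="\<lambda>p. x(j := fst p)"]) auto
    from measurable_compose[OF this f]
    have h [measurable]: "h \<in> borel_measurable (borel \<Otimes>\<^sub>M borel)"
      unfolding h_def by (simp add: case_prod_beta')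
    \<comment> \<open>Coordinate j is integrated outside and coordinate i inside, so the pair
      appears as (j, i). Swapping the two axes reverses the angle, whence -s.\<close>
    have cs': "c\<^sup>2 + (- s)\<^sup>2 = 1" using cs by simp
    have "(\<integral>\<^sup>+w. \<integral>\<^sup>+z. h (c *\<^sub>R w + (- s) *\<^sub>R z, c *\<^sub>R z - (- s) *\<^sub>R w) \<partial>P \<partial>P) = (\<integral>\<^sup>+w. \<integral>\<^sup>+z. h (w, z) \<partial>P \<partial>P)"
      by (rule rotation_invariantD[OF rotP h cs'])
    then show "(\<integral>\<^sup>+w. \<integral>\<^sup>+z. f (?T (x(j := w, i := z))) \<partial>P \<partial>P) = (\<integral>\<^sup>+w. \<integral>\<^sup>+z. f (x(j := w, i := z)) \<partial>P \<partial>P)"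
      using J(4) by (simp add: h_def add.commute fun_upd_twist[of i j])
  qed
qed

section \<open>Linear maps acting on selected coordinates of a Gaussian product\<close>

definition act :: "nat \<Rightarrow> (nat \<Rightarrow> nat \<Rightarrow> complex) \<Rightarrow> (nat \<Rightarrow> complex) \<Rightarrow> nat \<Rightarrow> complex" where
  "act k R v i = (\<Sum>j<k. R i j * v j)"

definition act_at :: "nat \<Rightarrow> (nat \<Rightarrow> nat \<Rightarrow> complex) \<Rightarrow> (nat \<Rightarrow> 'i) \<Rightarrow> ('i \<Rightarrow> complex) \<Rightarrow> 'i \<Rightarrow> complex" where
  "act_at k R e x l = (if l \<in> e ` {..<k} then act k R (x \<circ> e) (inv_into {..<k} e l) else x l)"

text \<open>Every embedding of the \<open>k\<close> coordinates into a larger product is allowed, so that \<open>R\<close> can act on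
  the columns and on the rows of a random matrix.\<close>

definition gaussian_invariant :: "nat \<Rightarrow> nat \<Rightarrow> (nat \<Rightarrow> nat \<Rightarrow> complex) \<Rightarrow> bool" where
  "gaussian_invariant \<beta> k R \<longleftrightarrow> (\<forall>D J (e :: nat \<Rightarrow> nat \<times> nat).
     complex_product D \<longrightarrow> finite J \<longrightarrow> inj_on e {..<k} \<longrightarrow> e ` {..<k} \<subseteq> J \<longrightarrow>
     (\<forall>l<k. D (e l) = std_gaussian \<beta>) \<longrightarrow> preserves (Pi\<^sub>M J D) (act_at k R e))"

lemma gaussian_invariantD:
  fixes e :: "nat \<Rightarrow> nat \<times> nat"
  shows "gaussian_invariant \<beta> k R \<Longrightarrow> complex_product D \<Longrightarrow> finite J \<Longrightarrow> inj_on e {..<k} \<Longrightarrow> e ` {..<k} \<subseteq> J \<Longrightarrow>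
    (\<And>l. l < k \<Longrightarrow> D (e l) = std_gaussian \<beta>) \<Longrightarrow> preserves (Pi\<^sub>M J D) (act_at k R e)"
  by (simp add: gaussian_invariant_def)

definition phase_mat :: "nat \<Rightarrow> complex \<Rightarrow> nat \<Rightarrow> nat \<Rightarrow> complex" where
  "phase_mat p u i j = (if i = j then if i = p then u else 1 else 0)"

definition givens_mat :: "nat \<Rightarrow> nat \<Rightarrow> real \<Rightarrow> real \<Rightarrow> nat \<Rightarrow> nat \<Rightarrow> complex" where
  "givens_mat p q c s i j =
     (if i = p then (if j = p then of_real c else 0) + (if j = q then of_real s else 0)
      else if i = q then (if j = q then of_real c else 0) - (if j = p then of_real s else 0)
      else if i = j then 1 else 0)"

lemma act_phase_mat: "i < k \<Longrightarrow> act k (phase_mat p u) v i = (if i = p then u * v i else v i)"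
proof -
  assume "i < k"
  have "act k (phase_mat p u) v i = (\<Sum>j<k. if i = j then (if i = p then u else 1) * v j else 0)"
    unfolding act_def phase_mat_def by (intro sum.cong) auto
  with \<open>i < k\<close> show ?thesis by simp
qed

lemma act_givens_mat:
  assumes "p < k" "q < k" "p \<noteq> q" "i < k"
  shows "act k (givens_mat p q c s) v i =
    (if i = p then c *\<^sub>R v p + s *\<^sub>R v q else if i = q then c *\<^sub>R v q - s *\<^sub>R v p else v i)"
proof -
  have "act k (givens_mat p q c s) v i =
    (\<Sum>j<k. if i = p then (if p = j then of_real c * v j else 0) + (if q = j then of_real s * v j else 0)
      else if i = q then (if q = j then of_real c * v j else 0) - (if p = j then of_real s * v j else 0)
      else if i = j then v j else 0)"
    unfolding act_def givens_mat_def using assms by (intro sum.cong) auto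
  also have "\<dots> = (if i = p then c *\<^sub>R v p + s *\<^sub>R v q else if i = q then c *\<^sub>R v q - s *\<^sub>R v p else v i)"
    using assms by (auto simp: sum.distrib sum_subtractf scaleR_conv_of_real)
  finally show ?thesis .
qed

lemma gaussian_invariant_phase:
  assumes "p < k" and \<beta>: "\<beta> \<in> {1, 2}" and u: "cmod u = 1" "\<beta> = 1 \<Longrightarrow> u \<in> \<real>"
  shows "gaussian_invariant \<beta> k (phase_mat p u)"
  unfolding gaussian_invariant_def
proof (intro allI impI)
  fix D J and e :: "nat \<Rightarrow> nat \<times> nat"
  assume CP: "complex_product D" and J: "finite J" and e: "inj_on e {..<k}" "e ` {..<k} \<subseteq> J"
    and De: "\<forall>l<k. D (e l) = std_gaussian \<beta>"
  have "act_at k (phase_mat p u) e = (\<lambda>x. x(e p := u * x (e p)))"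
    using e(1) \<open>p < k\<close>
    by (auto simp: fun_eq_iff act_at_def act_phase_mat inv_into_f_f inj_on_eq_iff[OF e(1)])
  then show "preserves (Pi\<^sub>M J D) (act_at k (phase_mat p u) e)"
    using preserves_phase[OF CP, of J "e p" \<beta> u] J e De \<open>p < k\<close> \<beta> u by auto
qed

lemma gaussian_invariant_givens:
  assumes pq: "p < k" "q < k" "p \<noteq> q" and \<beta>: "\<beta> \<in> {1, 2}" and cs: "c\<^sup>2 + s\<^sup>2 = 1"
  shows "gaussian_invariant \<beta> k (givens_mat p q c s)"
  unfolding gaussian_invariant_def
proof (intro allI impI)
  fix D J and e :: "nat \<Rightarrow> nat \<times> nat"
  assume CP: "complex_product D" and J: "finite J" and e: "inj_on e {..<k}" "e ` {..<k} \<subseteq> J"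
    and De: "\<forall>l<k. D (e l) = std_gaussian \<beta>"
  have ne: "e p \<noteq> e q" using e(1) pq by (auto simp: inj_on_def)
  have "act_at k (givens_mat p q c s) e =
      (\<lambda>x. x(e p := c *\<^sub>R x (e p) + s *\<^sub>R x (e q), e q := c *\<^sub>R x (e q) - s *\<^sub>R x (e p)))"
    using pq ne
    by (auto simp: fun_eq_iff act_at_def act_givens_mat inv_into_f_f inj_on_eq_iff[OF e(1)] e(1))
  moreover have "e p \<in> J" "e q \<in> J" using e pq by auto
  ultimately show "preserves (Pi\<^sub>M J D) (act_at k (givens_mat p q c s) e)"
    using preserves_rotation[OF CP, of J "e p" "e q" "std_gaussian \<beta>" c s] J De pq cs ne
      rotation_invariant_std_gaussian[OF \<beta>] by simp
qed

definition col_op :: "nat \<Rightarrow> (nat \<Rightarrow> nat \<Rightarrow> complex) \<Rightarrow> nat set \<Rightarrow> (nat \<times> nat \<Rightarrow> complex) \<Rightarrow> nat \<times> nat \<Rightarrow> complex" where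
  "col_op k R C x = (\<lambda>(i, j). if i < k \<and> j \<in> C then act k R (\<lambda>l. x (l, j)) i else x (i, j))"

text \<open>On the affected block this is right multiplication by the transpose of \<open>R\<close>.
  For a conjugation it is therefore called with the transpose of the inverse matrix.\<close>

definition row_op :: "nat \<Rightarrow> (nat \<Rightarrow> nat \<Rightarrow> complex) \<Rightarrow> nat set \<Rightarrow> (nat \<times> nat \<Rightarrow> complex) \<Rightarrow> nat \<times> nat \<Rightarrow> complex" where
  "row_op k R C x = (\<lambda>(i, j). if i \<in> C \<and> j < k then act k R (\<lambda>l. x (i, l)) j else x (i, j))"

text \<open>Different columns use disjoint sets of coordinates, so the operation is a composition of
  actions on one column each, every one of which preserves the product.\<close>

lemma preserves_col_op:
  assumes R: "gaussian_invariant \<beta> k R" and "complex_product D" "finite J"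
    and "finite C" "{..<k} \<times> C \<subseteq> J" "\<And>l. l \<in> {..<k} \<times> C \<Longrightarrow> D l = std_gaussian \<beta>"
  shows "preserves (Pi\<^sub>M J D) (col_op k R C)"
  using assms(4-)
proof (induction C)
  case empty
  show ?case by (auto simp: col_op_def preserves_def distr_id2 case_prod_beta')
next
  case (insert c C)
  define e where "e l = (l, c)" for l :: nat
  have e: "inj_on e {..<k}" by (auto simp: e_def inj_on_def)
  then have "preserves (Pi\<^sub>M J D) (act_at k R e)"
    using insert.prems by (intro gaussian_invariantD[OF R assms(2,3)]) (auto simp: e_def)
  moreover have "preserves (Pi\<^sub>M J D) (col_op k R C)"
    using insert.prems by (intro insert.IH) auto
  moreover have "col_op k R (insert c C) = (\<lambda>x. act_at k R e (col_op k R C x))"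
  proof (intro ext, clarify)
    fix x i j
    have mem: "(i, j) \<in> e ` {..<k} \<longleftrightarrow> i < k \<and> j = c" by (auto simp: e_def)
    have inv: "inv_into {..<k} e (i, c) = i" if "i < k"
      using inv_into_f_f[OF e, of i] that by (simp add: e_def)
    show "col_op k R (insert c C) x (i, j) = act_at k R e (col_op k R C x) (i, j)"
      unfolding act_at_def mem using insert.hyps inv
      by (auto simp: col_op_def act_def e_def intro!: sum.cong)
  qed
  ultimately show ?case using preserves_comp by metis
qed

lemma preserves_row_op:
  assumes R: "gaussian_invariant \<beta> k R" and "complex_product D" "finite J"
    and "finite C" "C \<times> {..<k} \<subseteq> J" "\<And>l. l \<in> C \<times> {..<k} \<Longrightarrow> D l = std_gaussian \<beta>"
  shows "preserves (Pi\<^sub>M J D) (row_op k R C)"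
  using assms(4-)
proof (induction C)
  case empty
  show ?case by (auto simp: row_op_def preserves_def distr_id2 case_prod_beta')
next
  case (insert c C)
  define e where "e l = (c, l)" for l :: nat
  have e: "inj_on e {..<k}" by (auto simp: e_def inj_on_def)
  then have "preserves (Pi\<^sub>M J D) (act_at k R e)"
    using insert.prems by (intro gaussian_invariantD[OF R assms(2,3)]) (auto simp: e_def)
  moreover have "preserves (Pi\<^sub>M J D) (row_op k R C)"
    using insert.prems by (intro insert.IH) auto
  moreover have "row_op k R (insert c C) = (\<lambda>x. act_at k R e (row_op k R C x))"
  proof (intro ext, clarify)
    fix x i j
    have mem: "(i, j) \<in> e ` {..<k} \<longleftrightarrow> j < k \<and> i = c" by (auto simp: e_def)
    have inv: "inv_into {..<k} e (c, j) = j" if "j < k"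
      using inv_into_f_f[OF e, of j] that by (simp add: e_def)
    show "row_op k R (insert c C) x (i, j) = act_at k R e (row_op k R C x) (i, j)"
      unfolding act_at_def mem using insert.hyps inv
      by (auto simp: row_op_def act_def e_def intro!: sum.cong)
  qed
  ultimately show ?case using preserves_comp by metis
qed

subsection \<open>Conjugating a random matrix\<close>

lemma space_poly_space [simp]: "space poly_space = UNIV"
  by (simp add: poly_space_def)

lemma measurable_poly_space_iff:
  "f \<in> M \<rightarrow>\<^sub>M poly_space \<longleftrightarrow> (\<forall>i. (\<lambda>x. coeff (f x) i) \<in> borel_measurable M)"
proof
  assume f: "f \<in> M \<rightarrow>\<^sub>M poly_space"
  have "coeff \<in> poly_space \<rightarrow>\<^sub>M (\<Pi>\<^sub>M i\<in>(UNIV :: nat set). (borel :: complex measure))"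
    unfolding poly_space_def by (rule measurable_vimage_algebra1) (auto simp: space_PiM)
  from measurable_compose[OF measurable_compose[OF f this] measurable_component_singleton]
  show "\<forall>i. (\<lambda>x. coeff (f x) i) \<in> borel_measurable M" by simp
next
  assume "\<forall>i. (\<lambda>x. coeff (f x) i) \<in> borel_measurable M"
  then show "f \<in> M \<rightarrow>\<^sub>M poly_space"
    unfolding poly_space_def
    by (intro measurable_vimage_algebra2 measurable_PiM_single') (auto simp: space_PiM)
qed

lemma measurable_poly_mult:
  assumes "f \<in> M \<rightarrow>\<^sub>M poly_space" "g \<in> M \<rightarrow>\<^sub>M poly_space"
  shows "(\<lambda>x. f x * g x) \<in> M \<rightarrow>\<^sub>M poly_space"
  using assms by (simp add: measurable_poly_space_iff coeff_mult borel_measurable_sum borel_measurable_times)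

lemma measurable_poly_sum:
  assumes "\<And>i. i \<in> I \<Longrightarrow> f i \<in> M \<rightarrow>\<^sub>M poly_space"
  shows "(\<lambda>x. \<Sum>i\<in>I. f i x) \<in> M \<rightarrow>\<^sub>M poly_space"
  using assms by (auto simp: measurable_poly_space_iff coeff_sum intro!: borel_measurable_sum)

lemma measurable_poly_prod:
  assumes "\<And>i. i \<in> I \<Longrightarrow> f i \<in> M \<rightarrow>\<^sub>M poly_space"
  shows "(\<lambda>x. \<Prod>i\<in>I. f i x) \<in> M \<rightarrow>\<^sub>M poly_space"
  using assms by (induction I rule: infinite_finite_induct) (auto intro: measurable_poly_mult simp: space_PiM)

text \<open>The Leibniz formula reduces measurability of the determinant to that of finite sums and
  products of polynomials with measurable coefficients.\<close>

lemma measurable_char_poly: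
  assumes "\<And>i j. i < n \<Longrightarrow> j < n \<Longrightarrow> (\<lambda>x. g x (i, j)) \<in> borel_measurable M"
  shows "(\<lambda>x. char_poly (mat n n (g x))) \<in> M \<rightarrow>\<^sub>M poly_space"
proof -
  have entry: "(\<lambda>x. char_poly_matrix (mat n n (g x)) $$ (i, j)) \<in> M \<rightarrow>\<^sub>M poly_space" if "i < n" "j < n" for i j
    using that assms[OF that] unfolding measurable_poly_space_iff
    by (auto simp: char_poly_matrix_def coeff_pCons split: nat.split)
  have "char_poly (mat n n (g x)) = (\<Sum>p\<in>{p. p permutes {0..<n}}.
      signof p * (\<Prod>i = 0..<n. char_poly_matrix (mat n n (g x)) $$ (i, p i)))" for x
    unfolding char_poly_def by (rule det_def'[of _ n]) simp
  moreover have "(\<lambda>x. \<Sum>p\<in>{p. p permutes {0..<n}}.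
      signof p * (\<Prod>i = 0..<n. char_poly_matrix (mat n n (g x)) $$ (i, p i))) \<in> M \<rightarrow>\<^sub>M poly_space"
    by (intro measurable_poly_sum measurable_poly_mult measurable_poly_prod entry)
      (auto dest: permutes_in_image)
  ultimately show ?thesis by simp
qed

text \<open>The last columns are already in Hessenberg form; the superdiagonal entry of column \<open>c\<close> is the
  coordinate \<open>(n, c)\<close> of \<open>y\<close>.\<close>

definition border_mat :: "nat \<Rightarrow> nat \<Rightarrow> (nat \<Rightarrow> complex) \<Rightarrow> (nat \<times> nat \<Rightarrow> complex) \<Rightarrow> complex mat" where
  "border_mat n k v y = mat n n (\<lambda>(r, c).
     if c = k \<and> r < k then v r else if c \<le> r \<or> c < k then y (r, c)
     else if c = Suc r then y (n, c) else 0)"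

definition inverse_pair :: "nat \<Rightarrow> (nat \<Rightarrow> nat \<Rightarrow> complex) \<Rightarrow> (nat \<Rightarrow> nat \<Rightarrow> complex) \<Rightarrow> bool" where
  "inverse_pair k R S \<longleftrightarrow> (\<forall>i<k. \<forall>j<k. act k R (\<lambda>l. S l j) i = (if i = j then 1 else 0) \<and>
     act k S (\<lambda>l. R l j) i = (if i = j then 1 else 0))"

lemma char_poly_border_mat_conj:
  assumes k: "k < n" and RS: "inverse_pair k R S"
  shows "char_poly (border_mat n k (act k R v) (row_op k (\<lambda>i j. S j i) {..<n} (col_op k R {..<k} y))) =
    char_poly (border_mat n k v y)"
proof (rule char_poly_similar)
  define m where "m = n - k"
  have n: "n = k + m" using k by (simp add: m_def)
  define P where "P = mat k k (\<lambda>(i, j). R i j)"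
  define Q where "Q = mat k k (\<lambda>(i, j). S i j)"
  define Z where "Z = mat k k y"
  define V where "V = mat k m (\<lambda>(i, j). if j = 0 then v i else 0)"
  define W where "W = mat m k (\<lambda>(i, j). y (i + k, j))"
  define E where "E = mat m m (\<lambda>(i, j). if j \<le> i then y (i + k, j + k) else if j = Suc i then y (n, j + k) else 0)"
  note defs = P_def Q_def Z_def V_def W_def E_def
  have carr [simp]: "P \<in> carrier_mat k k" "Q \<in> carrier_mat k k" "Z \<in> carrier_mat k k"
    "V \<in> carrier_mat k m" "W \<in> carrier_mat m k" "E \<in> carrier_mat m m"
    by (auto simp: defs)
  have PQ: "P * Q = 1\<^sub>m k" "Q * P = 1\<^sub>m k"
    using RS by (auto intro!: eq_matI simp: defs inverse_pair_def act_def scalar_prod_def lessThan_atLeast0)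
  let ?P = "four_block_mat P (0\<^sub>m k m) (0\<^sub>m m k) (1\<^sub>m m)"
  let ?Q = "four_block_mat Q (0\<^sub>m k m) (0\<^sub>m m k) (1\<^sub>m m)"
  let ?B = "four_block_mat Z V W E"
  have B: "border_mat n k v y = ?B"
    by (rule eq_matI) (simp_all add: border_mat_def defs n, linarith?)
  have mult: "four_block_mat A1 A2 A3 A4 * four_block_mat B1 B2 B3 B4 =
      four_block_mat (A1 * B1 + A2 * B3) (A1 * B2 + A2 * B4) (A3 * B1 + A4 * B3) (A3 * B2 + A4 * B4)"
    if "A1 \<in> carrier_mat k k" "A2 \<in> carrier_mat k m" "A3 \<in> carrier_mat m k" "A4 \<in> carrier_mat m m"
      "B1 \<in> carrier_mat k k" "B2 \<in> carrier_mat k m" "B3 \<in> carrier_mat m k" "B4 \<in> carrier_mat m m"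
    for A1 A2 A3 A4 B1 B2 B3 B4 :: "complex mat"
    using that by (intro mult_four_block_mat) auto
  have prods [simp]: "P * Z \<in> carrier_mat k k" "P * V \<in> carrier_mat k m" "P * Z * Q \<in> carrier_mat k k" "W * Q \<in> carrier_mat m k"
    by (auto simp: defs)
  have zeros: "0\<^sub>m k m * W = 0\<^sub>m k k" "0\<^sub>m k m * E = 0\<^sub>m k m" "0\<^sub>m m k * Z = 0\<^sub>m m k" "0\<^sub>m m k * V = 0\<^sub>m m m"
      "P * V * 0\<^sub>m m k = 0\<^sub>m k k" "P * Z * 0\<^sub>m k m = 0\<^sub>m k m" "E * 0\<^sub>m m k = 0\<^sub>m m k" "W * 0\<^sub>m k m = 0\<^sub>m m m"
      "P * 0\<^sub>m k m = 0\<^sub>m k m" "Q * 0\<^sub>m k m = 0\<^sub>m k m" "0\<^sub>m m k * P = 0\<^sub>m m k" "0\<^sub>m m k * Q = 0\<^sub>m m k"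
    by (auto simp: defs)
  have ones: "1\<^sub>m m * W = W" "1\<^sub>m m * E = E" "E * 1\<^sub>m m = E" "P * V * 1\<^sub>m m = P * V"
    using left_mult_one_mat[of W m k] left_mult_one_mat[of E m m] right_mult_one_mat[of E m m]
      right_mult_one_mat[of "P * V" k m] by simp_all
  have PB: "?P * ?B = four_block_mat (P * Z) (P * V) W E"
    by (subst mult) (simp_all add: zeros ones)
  have PBQ: "?P * ?B * ?Q = four_block_mat (P * Z * Q) (P * V) (W * Q) E"
    unfolding PB by (subst mult) (simp_all add: zeros ones)
  have B': "border_mat n k (act k R v) (row_op k (\<lambda>i j. S j i) {..<n} (col_op k R {..<k} y)) = ?P * ?B * ?Q"
    (is "?B' = _")
    unfolding PBQ
  proof (rule eq_matI)
    fix i j assume "i < dim_row (four_block_mat (P * Z * Q) (P * V) (W * Q) E)"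
      "j < dim_col (four_block_mat (P * Z * Q) (P * V) (W * Q) E)"
    then have ij: "i < k + m" "j < k + m" by (auto simp: defs)
    consider "i < k" "j < k" | "i < k" "k \<le> j" | "k \<le> i" "j < k" | "k \<le> i" "k \<le> j" by linarith
    then show "?B' $$ (i, j) = four_block_mat (P * Z * Q) (P * V) (W * Q) E $$ (i, j)"
    proof cases
      case 1
      have "(P * Z * Q) $$ (i, j) = (\<Sum>l<k. (\<Sum>p<k. R i p * y (p, l)) * S l j)"
        using 1 by (simp add: defs scalar_prod_def lessThan_atLeast0)
      then show ?thesis using 1 ij
        by (simp add: border_mat_def n row_op_def col_op_def act_def defs mult.commute)
    next
      case 2
      have "(P * V) $$ (i, j - k) = (\<Sum>l<k. R i l * (if j - k = 0 then v l else 0))"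
        using 2 ij by (simp add: defs scalar_prod_def lessThan_atLeast0)
      then show ?thesis using 2 ij
        by (auto simp: border_mat_def n act_def defs)
    next
      case 3
      have "(W * Q) $$ (i - k, j) = (\<Sum>l<k. y (i, l) * S l j)"
        using 3 ij by (simp add: defs scalar_prod_def lessThan_atLeast0)
      then show ?thesis using 3 ij
        by (simp add: border_mat_def n row_op_def col_op_def act_def defs mult.commute)
    next
      case 4
      then show ?thesis using ij
        by (auto simp: border_mat_def n row_op_def col_op_def defs)
    qed
  qed (auto simp: border_mat_def defs n)
  have one: "four_block_mat (1\<^sub>m k) (0\<^sub>m k m) (0\<^sub>m m k) (1\<^sub>m m) = (1\<^sub>m n :: complex mat)"
    by (rule eq_matI) (auto simp: n)
  have "similar_mat_wit (?P * ?B * ?Q) ?B ?P ?Q"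
    unfolding similar_mat_wit_def Let_def
  proof (intro conjI)
    show "?P * ?Q = 1\<^sub>m (dim_row (?P * ?B * ?Q))" "?Q * ?P = 1\<^sub>m (dim_row (?P * ?B * ?Q))"
      by (subst mult, simp_all add: PQ zeros n one[unfolded n] carrier_matD[OF carr(1)])+
  qed (auto simp: defs)
  then show "similar_mat (border_mat n k (act k R v) (row_op k (\<lambda>i j. S j i) {..<n} (col_op k R {..<k} y)))
      (border_mat n k v y)"
    unfolding B' B similar_mat_def by blast
qed

text \<open>A change of variables: inserting the transformed \<open>y\<close> compensates for
  passing from \<open>v\<close> to \<open>R v\<close>. Both operations touch only coordinates in
  columns below k, all of them Gaussian, so the measure does not change.\<close>

lemma border_integral_invariant:
  assumes k: "k < n" and RS: "inverse_pair k R S"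
    and R: "gaussian_invariant \<beta> k R" and S: "gaussian_invariant \<beta> k (\<lambda>i j. S j i)"
    and D: "complex_product D" "finite J" "{..<n} \<times> {..<k} \<subseteq> J"
      "\<And>l. l \<in> {..<n} \<times> {..<k} \<Longrightarrow> D l = std_gaussian \<beta>"
    and meas: "(\<lambda>y. h (char_poly (border_mat n k (act k R v) y))) \<in> borel_measurable (Pi\<^sub>M J D)"
  shows "(\<integral>\<^sup>+y. h (char_poly (border_mat n k (act k R v) y)) \<partial>Pi\<^sub>M J D) =
    (\<integral>\<^sup>+y. h (char_poly (border_mat n k v y)) \<partial>Pi\<^sub>M J D)"
proof -
  have sub: "{..<k} \<times> {..<k} \<subseteq> {..<n} \<times> {..<k}" using k by auto
  have col: "preserves (Pi\<^sub>M J D) (col_op k R {..<k})"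
    using D(3,4) sub by (intro preserves_col_op[OF R D(1,2)]) (auto dest!: subsetD[OF sub])
  have row: "preserves (Pi\<^sub>M J D) (row_op k (\<lambda>i j. S j i) {..<n})"
    using D(3,4) by (intro preserves_row_op[OF S D(1,2)]) auto
  from preserves_nn_integral[OF preserves_comp[OF row col] meas] show ?thesis
    by (simp add: char_poly_border_mat_conj[OF k RS])
qed

lemma reduce_to_norm:
  fixes \<Phi> :: "(nat \<Rightarrow> complex) \<Rightarrow> 'b"
  assumes ext: "\<And>v w. (\<And>i. i < k \<Longrightarrow> v i = w i) \<Longrightarrow> \<Phi> v = \<Phi> w"
    and phase: "\<And>p u v. p < k \<Longrightarrow> cmod u = 1 \<Longrightarrow> (\<beta> = 1 \<Longrightarrow> u \<in> \<real>) \<Longrightarrow> \<Phi> (act k (phase_mat p u) v) = \<Phi> v"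
    and givens: "\<And>p q c s v. p < k \<Longrightarrow> q < k \<Longrightarrow> p \<noteq> q \<Longrightarrow> c\<^sup>2 + s\<^sup>2 = 1 \<Longrightarrow>
      \<Phi> (act k (givens_mat p q c s) v) = \<Phi> v"
    and k: "0 < k" and v: "\<And>i. i < k \<Longrightarrow> (\<beta> :: nat) = 1 \<Longrightarrow> v i \<in> \<real>"
  shows "\<Phi> v = \<Phi> (\<lambda>i. if i = k - 1 then complex_of_real (sqrt (\<Sum>j<k. (cmod (v j))\<^sup>2)) else 0)"
proof -
  have 1: "\<Phi> v = \<Phi> (\<lambda>i. if i < m then complex_of_real (cmod (v i)) else v i)" if "m \<le> k" for m
    using that
  proof (induction m)
    case 0
    show ?case by simp
  next
    case (Suc m)
    \<comment> \<open>The phase that turns \<open>v m\<close> into its modulus; a zero entry gets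
      the default phase 1.\<close>
    define u where "u = (if v m = 0 then 1 else cnj (v m) / cmod (v m))"
    have u: "cmod u = 1" by (simp add: u_def norm_divide)
    have "u \<in> \<real>" if "\<beta> = 1"
      using v[of m, OF _ that] Suc.prems by (auto simp: u_def Reals_cnj_iff)
    moreover have uv: "u * v m = cmod (v m)"
    proof (cases "v m = 0")
      case False
      then have "u * v m = (complex_of_real (cmod (v m)))\<^sup>2 / cmod (v m)"
        by (simp add: u_def mult.commute flip: complex_norm_square)
      then show ?thesis using False by (simp add: power2_eq_square)
    qed simp
    moreover have "m < k" using Suc.prems by simp
    ultimately have "\<Phi> (act k (phase_mat m u) (\<lambda>i. if i < m then complex_of_real (cmod (v i)) else v i)) =
        \<Phi> (\<lambda>i. if i < m then complex_of_real (cmod (v i)) else v i)"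
      by (intro phase u) auto
    moreover have "\<Phi> (act k (phase_mat m u) (\<lambda>i. if i < m then complex_of_real (cmod (v i)) else v i)) =
        \<Phi> (\<lambda>i. if i < Suc m then complex_of_real (cmod (v i)) else v i)"
      by (rule ext) (auto simp: act_phase_mat uv less_Suc_eq)
    ultimately show ?case using Suc by simp
  qed
  define S where "S m = sqrt (\<Sum>j<Suc m. (cmod (v j))\<^sup>2)" for m
  \<comment> \<open>The vector after m rotations: zeros before m, the norm of the first m + 1
    entries at m, and the remaining moduli still untouched.\<close>
  define w where "w m i = complex_of_real (if i < m then 0 else if i = m then S m else cmod (v i))" for m i
  have 2: "\<Phi> v = \<Phi> (w m)" if "m < k" for m
    using that
  proof (induction m)
    case 0
    have "\<Phi> v = \<Phi> (\<lambda>i. if i < k then complex_of_real (cmod (v i)) else v i)" by (rule 1) simp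
    also have "\<dots> = \<Phi> (w 0)" by (rule ext) (auto simp: w_def S_def)
    finally show ?case .
  next
    case (Suc m)
    define a b r where "a = S m" and "b = cmod (v (Suc m))" and "r = S (Suc m)"
    have r2: "r\<^sup>2 = a\<^sup>2 + b\<^sup>2" by (simp add: a_def b_def r_def S_def sum_nonneg)
    show ?case
    proof (cases "r = 0")
      case True
      then have "a = 0" "b = 0" using r2 by (auto simp: add_nonneg_eq_0_iff)
      then have "w m = w (Suc m)" using True by (auto simp: fun_eq_iff w_def a_def b_def r_def less_Suc_eq)
      then show ?thesis using Suc by simp
    next
      case False
      \<comment> \<open>The angle is chosen to send (a, b) to (0, r): \<open>c a + s b = 0\<close>
        and \<open>c b - s a = r\<close> for \<open>c = b / r\<close> and
        \<open>s = - a / r\<close>.\<close>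
      have "(b / r)\<^sup>2 + (- a / r)\<^sup>2 = (a\<^sup>2 + b\<^sup>2) / r\<^sup>2" by (simp add: power_divide add_divide_distrib)
      then have cs: "(b / r)\<^sup>2 + (- a / r)\<^sup>2 = 1" unfolding r2[symmetric] using False by simp
      have ba: "b * b / r + a * a / r = r"
        using False r2 by (simp add: power2_eq_square field_simps)
      have m: "m < k" "Suc m < k" using Suc.prems by auto
      have "\<Phi> (w m) = \<Phi> (act k (givens_mat m (Suc m) (b / r) (- a / r)) (w m))"
        using m by (intro givens[symmetric] cs) auto
      also have "\<dots> = \<Phi> (w (Suc m))"
      proof (rule ext)
        fix i assume i: "i < k"
        have wm: "w m m = a" "w m (Suc m) = b" "w (Suc m) m = 0" "w (Suc m) (Suc m) = r"
          by (auto simp: w_def a_def b_def r_def)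
        have eqs: "(b / r) *\<^sub>R complex_of_real a = (a / r) *\<^sub>R complex_of_real b"
          "(b / r) *\<^sub>R complex_of_real b + (a / r) *\<^sub>R complex_of_real a = complex_of_real r"
          using ba by (simp_all add: complex_eq_iff)
        have rest: "w m i = w (Suc m) i" if "i \<noteq> m" "i \<noteq> Suc m" using that by (auto simp: w_def less_Suc_eq)
        show "act k (givens_mat m (Suc m) (b / r) (- a / r)) (w m) i = w (Suc m) i"
          using i m by (simp add: act_givens_mat wm eqs rest)
      qed
      finally show ?thesis using Suc by simp
    qed
  qed
  have "\<Phi> v = \<Phi> (w (k - 1))" using k by (intro 2) simp
  also have "\<dots> = \<Phi> (\<lambda>i. if i = k - 1 then complex_of_real (sqrt (\<Sum>j<k. (cmod (v j))\<^sup>2)) else 0)"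
    using k by (intro ext) (auto simp: w_def S_def)
  finally show ?thesis .
qed

lemma inverse_pair_phase:
  assumes "cmod u = 1"
  shows "inverse_pair k (phase_mat p u) (phase_mat p (cnj u))"
proof -
  have "u * cnj u = 1" using assms by (simp add: complex_norm_square[symmetric])
  then show ?thesis
    unfolding inverse_pair_def
    by (auto simp: act_phase_mat mult.commute) (auto simp: phase_mat_def mult.commute)
qed

lemma inverse_pair_givens:
  assumes "p < k" "q < k" "p \<noteq> q" "c\<^sup>2 + s\<^sup>2 = 1"
  shows "inverse_pair k (givens_mat p q c s) (givens_mat p q c (- s))"
proof -
  have cs: "complex_of_real c * of_real c + of_real s * of_real s = 1"
    using assms(4) by (metis of_real_1 of_real_add of_real_mult power2_eq_square)
  then have cs': "complex_of_real s * of_real s + of_real c * of_real c = 1" by (simp add: add.commute)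
  show ?thesis
    unfolding inverse_pair_def
    using assms(1-3) cs cs'
    by (auto simp: act_givens_mat) (auto simp: givens_mat_def scaleR_conv_of_real mult.commute)
qed

lemma border_integral_reduce:
  assumes k: "0 < k" "k < n" and \<beta>: "\<beta> \<in> {1, 2}"
    and D: "complex_product D" "finite J" "{..<n} \<times> {..<k} \<subseteq> J"
      "\<And>l. l \<in> {..<n} \<times> {..<k} \<Longrightarrow> D l = std_gaussian \<beta>"
    and meas: "\<And>v. (\<lambda>y. h (char_poly (border_mat n k v y))) \<in> borel_measurable (Pi\<^sub>M J D)"
    and v: "\<And>i. i < k \<Longrightarrow> \<beta> = 1 \<Longrightarrow> v i \<in> \<real>"
  shows "(\<integral>\<^sup>+y. h (char_poly (border_mat n k v y)) \<partial>Pi\<^sub>M J D) =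
    (\<integral>\<^sup>+y. h (char_poly (border_mat n k
      (\<lambda>i. if i = k - 1 then complex_of_real (sqrt (\<Sum>j<k. (cmod (v j))\<^sup>2)) else 0) y)) \<partial>Pi\<^sub>M J D)"
proof (rule reduce_to_norm[where \<beta> = \<beta> and k = k and
    \<Phi> = "\<lambda>v. \<integral>\<^sup>+y. h (char_poly (border_mat n k v y)) \<partial>Pi\<^sub>M J D"])
  fix v w :: "nat \<Rightarrow> complex" assume "\<And>i. i < k \<Longrightarrow> v i = w i"
  then have "border_mat n k v y = border_mat n k w y" for y by (auto simp: border_mat_def)
  then show "(\<integral>\<^sup>+y. h (char_poly (border_mat n k v y)) \<partial>Pi\<^sub>M J D) =
    (\<integral>\<^sup>+y. h (char_poly (border_mat n k w y)) \<partial>Pi\<^sub>M J D)" by simp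
next
  fix p u v assume p: "p < k" and u: "cmod u = 1" "\<beta> = 1 \<Longrightarrow> u \<in> \<real>"
  have t: "(\<lambda>i j. phase_mat p (cnj u) j i) = phase_mat p (cnj u)" by (auto simp: fun_eq_iff phase_mat_def)
  have "gaussian_invariant \<beta> k (phase_mat p u)" "gaussian_invariant \<beta> k (phase_mat p (cnj u))"
    using u by (auto intro!: gaussian_invariant_phase p \<beta> simp: Reals_cnj_iff)
  then show "(\<integral>\<^sup>+y. h (char_poly (border_mat n k (act k (phase_mat p u) v) y)) \<partial>Pi\<^sub>M J D) =
    (\<integral>\<^sup>+y. h (char_poly (border_mat n k v y)) \<partial>Pi\<^sub>M J D)"
    using t by (intro border_integral_invariant[OF k(2) inverse_pair_phase[OF u(1)] _ _ D meas]) auto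
next
  fix p q c s v assume pq: "p < k" "q < k" "p \<noteq> q" and cs: "c\<^sup>2 + s\<^sup>2 = (1 :: real)"
  \<comment> \<open>Inverting the rotation changes the sign of s and transposing changes it back, so
    the row operation uses the same rotation as the column operation.\<close>
  have t: "(\<lambda>i j. givens_mat p q c (- s) j i) = givens_mat p q c s"
    using pq(3) by (auto simp: fun_eq_iff givens_mat_def)
  have "gaussian_invariant \<beta> k (givens_mat p q c s)"
    by (intro gaussian_invariant_givens pq \<beta> cs)
  then show "(\<integral>\<^sup>+y. h (char_poly (border_mat n k (act k (givens_mat p q c s) v) y)) \<partial>Pi\<^sub>M J D) =
    (\<integral>\<^sup>+y. h (char_poly (border_mat n k v y)) \<partial>Pi\<^sub>M J D)"
    using t by (intro border_integral_invariant[OF k(2) inverse_pair_givens[OF pq cs] _ _ D meas]) auto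
qed (use k v in auto)

subsection \<open>The Hessenberg reduction\<close>

lemma nn_integral_normal_scale:
  assumes \<sigma>: "0 < \<sigma>" and [measurable]: "f \<in> borel_measurable borel"
  shows "(\<integral>\<^sup>+x. f x \<partial>density lborel (normal_density 0 \<sigma>)) = (\<integral>\<^sup>+x. f (\<sigma> * x) \<partial>std_normal_distribution)"
proof -
  have d: "\<sigma> * normal_density 0 \<sigma> (\<sigma> * x) = std_normal_density x" for x
  proof -
    have "sqrt (2 * pi * \<sigma>\<^sup>2) = sqrt (2 * pi) * \<sigma>" using \<sigma> by (simp add: real_sqrt_mult)
    moreover have "(\<sigma> * x)\<^sup>2 / (2 * \<sigma>\<^sup>2) = x\<^sup>2 / 2" using \<sigma> by (simp add: power_mult_distrib)
    ultimately show ?thesis using \<sigma> by (simp add: normal_density_def)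
  qed
  have "(\<integral>\<^sup>+x. f x \<partial>density lborel (normal_density 0 \<sigma>)) = (\<integral>\<^sup>+x. ennreal (normal_density 0 \<sigma> x) * f x \<partial>lborel)"
    by (rule nn_integral_density) measurable
  also have "\<dots> = ennreal \<sigma> * (\<integral>\<^sup>+x. ennreal (normal_density 0 \<sigma> (\<sigma> * x)) * f (\<sigma> * x) \<partial>lborel)"
    using nn_integral_real_affine[of "\<lambda>x. ennreal (normal_density 0 \<sigma> x) * f x" \<sigma> 0] \<sigma> by simp
  also have "\<dots> = (\<integral>\<^sup>+x. ennreal \<sigma> * (ennreal (normal_density 0 \<sigma> (\<sigma> * x)) * f (\<sigma> * x)) \<partial>lborel)"
    by (rule nn_integral_cmult[symmetric]) measurable
  also have "\<dots> = (\<integral>\<^sup>+x. ennreal (std_normal_density x) * f (\<sigma> * x) \<partial>lborel)"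
    using \<sigma> by (intro nn_integral_cong) (simp add: d flip: ennreal_mult mult.assoc)
  also have "\<dots> = (\<integral>\<^sup>+x. f (\<sigma> * x) \<partial>std_normal_distribution)"
    by (rule nn_integral_density[symmetric]) measurable
  finally show ?thesis .
qed

lemma product_prob_space_std_normal: "product_prob_space (\<lambda>_. std_normal_distribution)"
  using prob_space_normal_density[of 1 0]
  by (intro product_prob_space.intro product_sigma_finite.intro product_prob_space_axioms.intro)
    (auto intro: prob_space_imp_sigma_finite)

lemma complex_product_std_gaussian: "complex_product (\<lambda>_. std_gaussian \<beta>)"
  by (simp add: complex_product_def prob_space_std_gaussian)

text \<open>One standard Gaussian z accounts for \<beta> real degrees of freedom. For \<beta> = 2
  its real and imaginary parts are standard normals times \<open>sqrt (1/2)\<close>, so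
  \<open>|z|^2\<close> is a sum of two squares divided by 2; this is where the division by \<beta>
  under the sum comes from.\<close>

lemma nn_integral_chi_step:
  assumes \<beta>: "\<beta> \<in> {1, 2}" and f [measurable]: "f \<in> borel_measurable borel"
  shows "(\<integral>\<^sup>+x. f (\<Sum>i<n + \<beta>. (x i)\<^sup>2 / real \<beta>) \<partial>Pi\<^sub>M {..<n + \<beta>} (\<lambda>_. std_normal_distribution)) =
    (\<integral>\<^sup>+x. \<integral>\<^sup>+z. f ((\<Sum>i<n. (x i)\<^sup>2 / real \<beta>) + (cmod z)\<^sup>2) \<partial>std_gaussian \<beta>
      \<partial>Pi\<^sub>M {..<n} (\<lambda>_. std_normal_distribution))"
proof -
  interpret product_prob_space "\<lambda>_. std_normal_distribution" by (rule product_prob_space_std_normal)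
  interpret N: prob_space std_normal_distribution by (rule prob_space_normal_density) simp
  have step: "(\<integral>\<^sup>+x. g (\<Sum>i<Suc m. (x i)\<^sup>2 / real \<beta>) \<partial>Pi\<^sub>M {..<Suc m} (\<lambda>_. std_normal_distribution)) =
    (\<integral>\<^sup>+x. \<integral>\<^sup>+y. g ((\<Sum>i<m. (x i)\<^sup>2 / real \<beta>) + y\<^sup>2 / real \<beta>) \<partial>std_normal_distribution
      \<partial>Pi\<^sub>M {..<m} (\<lambda>_. std_normal_distribution))"
    if [measurable]: "g \<in> borel_measurable borel" for g :: "real \<Rightarrow> ennreal" and m
  proof -
    have "{..<Suc m} = insert m {..<m}" by auto
    then have "(\<integral>\<^sup>+x. g (\<Sum>i<Suc m. (x i)\<^sup>2 / real \<beta>) \<partial>Pi\<^sub>M {..<Suc m} (\<lambda>_. std_normal_distribution)) =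
      (\<integral>\<^sup>+x. g (\<Sum>i<Suc m. (x i)\<^sup>2 / real \<beta>) \<partial>Pi\<^sub>M (insert m {..<m}) (\<lambda>_. std_normal_distribution))" by simp
    also have "\<dots> = (\<integral>\<^sup>+x. \<integral>\<^sup>+y. g (\<Sum>i<Suc m. ((x(m := y)) i)\<^sup>2 / real \<beta>) \<partial>std_normal_distribution
      \<partial>Pi\<^sub>M {..<m} (\<lambda>_. std_normal_distribution))"
      by (rule product_nn_integral_insert) (auto intro!: measurable_compose[OF _ that] borel_measurable_sum)
    finally show ?thesis by simp
  qed
  show ?thesis
  proof (cases "\<beta> = 1")
    case True
    then show ?thesis
      using step[OF f, of n] nn_integral_std_gaussian_1[of "\<lambda>z. f (_ + (cmod z)\<^sup>2)"] by simp
  next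
    case False
    then have \<beta>2: "\<beta> = 2" using \<beta> by simp
    \<comment> \<open>Averages over one of the two real normals that make up z. The last coordinate
      is removed first, with \<open>f\<close> at \<open>Suc n\<close>, and then the one before it,
      with \<open>g\<close> at \<open>n\<close>.\<close>
    define g where "g t = (\<integral>\<^sup>+y. f (t + y\<^sup>2 / 2) \<partial>std_normal_distribution)" for t
    have [measurable]: "g \<in> borel_measurable borel" unfolding g_def by measurable
    have z: "(\<integral>\<^sup>+z. f (t + (cmod z)\<^sup>2) \<partial>std_gaussian 2) = (\<integral>\<^sup>+y. g (t + y\<^sup>2 / 2) \<partial>std_normal_distribution)" for t
    proof -
      have "(\<integral>\<^sup>+z. f (t + (cmod z)\<^sup>2) \<partial>std_gaussian 2) = (\<integral>\<^sup>+x. \<integral>\<^sup>+y. f (t + (x\<^sup>2 + y\<^sup>2)) \<partial>half_normal \<partial>half_normal)"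
        by (subst nn_integral_std_gaussian_2) (simp_all add: cmod_power2)
      also have "\<dots> = (\<integral>\<^sup>+x. \<integral>\<^sup>+y. f (t + (x\<^sup>2 + (sqrt (1/2) * y)\<^sup>2)) \<partial>std_normal_distribution \<partial>half_normal)"
        by (intro nn_integral_cong nn_integral_normal_scale) auto
      also have "\<dots> = (\<integral>\<^sup>+x. \<integral>\<^sup>+y. f (t + ((sqrt (1/2) * x)\<^sup>2 + (sqrt (1/2) * y)\<^sup>2)) \<partial>std_normal_distribution \<partial>std_normal_distribution)"
        by (rule nn_integral_normal_scale) auto
      also have "\<dots> = (\<integral>\<^sup>+y. g (t + y\<^sup>2 / 2) \<partial>std_normal_distribution)"
        unfolding g_def power_mult_distrib by (simp add: add.assoc)
      finally show ?thesis .
    qed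
    show ?thesis
      unfolding \<beta>2 z
      using step[OF f, of "Suc n"] step[of g n] by (simp add: \<beta>2 g_def)
  qed
qed

definition scaled_chi :: "nat \<Rightarrow> nat \<Rightarrow> real measure" where
  "scaled_chi \<beta> k = distr (chi_distribution (k * \<beta>)) borel (\<lambda>x. 1 / sqrt (real \<beta>) * x)"

lemma borel_measurable_L2_set_coord [measurable]:
  "(\<lambda>x. L2_set x {..<m}) \<in> borel_measurable (Pi\<^sub>M {..<m} (\<lambda>_. std_normal_distribution))"
  unfolding L2_set_def by measurable

lemma prob_space_scaled_chi: "prob_space (scaled_chi \<beta> k)"
proof -
  interpret P: prob_space "Pi\<^sub>M {..<k * \<beta>} (\<lambda>_. std_normal_distribution)"
    by (rule prob_space_PiM) (simp add: prob_space_normal_density)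
  interpret C: prob_space "chi_distribution (k * \<beta>)"
    unfolding chi_distribution_def by (rule P.prob_space_distr) measurable
  show ?thesis unfolding scaled_chi_def by (rule C.prob_space_distr) (simp add: chi_distribution_def)
qed

lemma sets_scaled_chi [measurable_cong, simp]: "sets (scaled_chi \<beta> k) = sets borel"
  by (simp add: scaled_chi_def)

text \<open>The induction runs on the squared length with an arbitrary test function: a new
  coordinate replaces \<open>f\<close> by its average over shifts by \<open>|z|^2\<close>, which is
  again a test function. The square root and the scaling enter only at the end.\<close>

lemma nn_integral_norm_gaussian_vector:
  assumes \<beta>: "\<beta> \<in> {1, 2}" and A: "finite A" and [measurable]: "g \<in> borel_measurable borel"
  shows "(\<integral>\<^sup>+v. g (sqrt (\<Sum>l\<in>A. (cmod (v l))\<^sup>2)) \<partial>Pi\<^sub>M A (\<lambda>_. std_gaussian \<beta>)) = (\<integral>\<^sup>+t. g t \<partial>scaled_chi \<beta> (card A))"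
proof -
  have "(\<integral>\<^sup>+v. f (\<Sum>l\<in>A. (cmod (v l))\<^sup>2) \<partial>Pi\<^sub>M A (\<lambda>_. std_gaussian \<beta>)) =
      (\<integral>\<^sup>+x. f (\<Sum>i<card A * \<beta>. (x i)\<^sup>2 / real \<beta>) \<partial>Pi\<^sub>M {..<card A * \<beta>} (\<lambda>_. std_normal_distribution))"
    if "f \<in> borel_measurable borel" for f :: "real \<Rightarrow> ennreal"
    using A that
  proof (induction A arbitrary: f)
    case empty
    interpret product_prob_space "\<lambda>_. std_normal_distribution" by (rule product_prob_space_std_normal)
    show ?case by (simp add: PiM_empty)
  next
    case (insert a A)
    note [measurable] = insert.prems
    interpret product_prob_space "\<lambda>_. std_gaussian \<beta>"
      by (rule complex_productD) (rule complex_product_std_gaussian)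
    interpret G: prob_space "std_gaussian \<beta>" by (rule prob_space_std_gaussian)
    define h where "h t = (\<integral>\<^sup>+z. f (t + (cmod z)\<^sup>2) \<partial>std_gaussian \<beta>)" for t
    have [measurable]: "h \<in> borel_measurable borel" unfolding h_def by measurable
    have "(\<integral>\<^sup>+v. f (\<Sum>l\<in>insert a A. (cmod (v l))\<^sup>2) \<partial>Pi\<^sub>M (insert a A) (\<lambda>_. std_gaussian \<beta>)) =
        (\<integral>\<^sup>+v. \<integral>\<^sup>+z. f (\<Sum>l\<in>insert a A. (cmod ((v(a := z)) l))\<^sup>2) \<partial>std_gaussian \<beta> \<partial>Pi\<^sub>M A (\<lambda>_. std_gaussian \<beta>))"
      using insert.hyps
      by (intro product_nn_integral_insert) (auto intro!: measurable_compose[OF _ insert.prems] borel_measurable_sum)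
    also have "\<dots> = (\<integral>\<^sup>+v. h (\<Sum>l\<in>A. (cmod (v l))\<^sup>2) \<partial>Pi\<^sub>M A (\<lambda>_. std_gaussian \<beta>))"
    proof (intro nn_integral_cong)
      fix v
      have "(\<Sum>l\<in>A. (cmod ((v(a := z)) l))\<^sup>2) = (\<Sum>l\<in>A. (cmod (v l))\<^sup>2)" for z
        using insert.hyps by (intro sum.cong) auto
      then have "(\<Sum>l\<in>insert a A. (cmod ((v(a := z)) l))\<^sup>2) = (\<Sum>l\<in>A. (cmod (v l))\<^sup>2) + (cmod z)\<^sup>2" for z
        using insert.hyps by (simp del: fun_upd_apply add: add.commute) simp
      then show "(\<integral>\<^sup>+z. f (\<Sum>l\<in>insert a A. (cmod ((v(a := z)) l))\<^sup>2) \<partial>std_gaussian \<beta>) = h (\<Sum>l\<in>A. (cmod (v l))\<^sup>2)"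
        by (simp only: h_def)
    qed
    also have "\<dots> = (\<integral>\<^sup>+x. h (\<Sum>i<card A * \<beta>. (x i)\<^sup>2 / real \<beta>) \<partial>Pi\<^sub>M {..<card A * \<beta>} (\<lambda>_. std_normal_distribution))"
      by (rule insert.IH) measurable
    also have "\<dots> = (\<integral>\<^sup>+x. f (\<Sum>i<card A * \<beta> + \<beta>. (x i)\<^sup>2 / real \<beta>) \<partial>Pi\<^sub>M {..<card A * \<beta> + \<beta>} (\<lambda>_. std_normal_distribution))"
      unfolding h_def by (rule nn_integral_chi_step[symmetric, OF \<beta> insert.prems])
    finally show ?case using insert.hyps by (simp add: add.commute)
  qed
  from this[of "\<lambda>t. g (sqrt t)"]
  have "(\<integral>\<^sup>+v. g (sqrt (\<Sum>l\<in>A. (cmod (v l))\<^sup>2)) \<partial>Pi\<^sub>M A (\<lambda>_. std_gaussian \<beta>)) =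
      (\<integral>\<^sup>+x. g (1 / sqrt (real \<beta>) * L2_set x {..<card A * \<beta>}) \<partial>Pi\<^sub>M {..<card A * \<beta>} (\<lambda>_. std_normal_distribution))"
    by (simp add: L2_set_def real_sqrt_divide flip: sum_divide_distrib)
  also have "\<dots> = (\<integral>\<^sup>+t. g (1 / sqrt (real \<beta>) * t) \<partial>chi_distribution (card A * \<beta>))"
    unfolding chi_distribution_def by (rule nn_integral_distr[symmetric]) measurable
  also have "\<dots> = (\<integral>\<^sup>+t. g t \<partial>scaled_chi \<beta> (card A))"
    unfolding scaled_chi_def by (rule nn_integral_distr[symmetric]) (simp_all add: chi_distribution_def)
  finally show ?thesis .
qed

section \<open>Exchanging one column at a time\<close>

lemma AE_std_gaussian_real: "AE z in std_gaussian 1. z \<in> \<real>"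
  unfolding std_gaussian_1 by (subst AE_distr_iff) (auto intro: borel_closed closed_complex_Reals)

text \<open>Entries of a matrix with rows below \<open>n\<close>, and in row \<open>n\<close> the superdiagonal entries of the
  Hessenberg columns.\<close>

definition entry_law :: "nat \<Rightarrow> nat \<Rightarrow> nat \<times> nat \<Rightarrow> complex measure" where
  "entry_law n \<beta> = (\<lambda>(r, c). if r < n then std_gaussian \<beta> else distr (scaled_chi \<beta> c) borel complex_of_real)"

text \<open>Holds both the Gaussian entries above the diagonal and the chi entries that replace
  them, so that all stages are functions on one fixed product space and differ only in which
  coordinates they read.\<close>

definition entry_index :: "nat \<Rightarrow> (nat \<times> nat) set" where
  "entry_index n = {..<n} \<times> {..<n} \<union> {n} \<times> {1..<n}"

text \<open>Stage n is the matrix with i.i.d. entries. Stage 1 is already the Hessenberg matrix,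
  because column 0 has nothing above the diagonal.\<close>

definition stage_mat :: "nat \<Rightarrow> nat \<Rightarrow> (nat \<times> nat \<Rightarrow> complex) \<Rightarrow> complex mat" where
  "stage_mat n k x = mat n n (\<lambda>(r, c). if c \<le> r \<or> c < k then x (r, c) else if c = Suc r then x (n, c) else 0)"

lemma complex_product_entry_law: "complex_product (entry_law n \<beta>)"
proof -
  have "prob_space (distr (scaled_chi \<beta> c) borel complex_of_real)" for c
    by (rule prob_space.prob_space_distr[OF prob_space_scaled_chi]) (simp cong: measurable_cong_sets)
  then show ?thesis
    by (simp add: complex_product_def entry_law_def prob_space_std_gaussian split_beta)
qed

text \<open>The product splits into the coordinate \<open>(n, k)\<close>, the k entries
  \<open>V\<close> of column k above the diagonal, and the rest \<open>K\<close>. With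
  \<open>V\<close> frozen, the integral over \<open>K\<close> depends on \<open>V\<close> only
  through its length t and equals \<open>G t\<close>. The next stage reads \<open>(n, k)\<close> in
  place of that length, and the two have the same law.\<close>

lemma stage_mat_step:
  assumes k: "1 \<le> k" "k < n" and \<beta>: "\<beta> \<in> {1, 2}" and h [measurable]: "h \<in> borel_measurable poly_space"
  shows "(\<integral>\<^sup>+x. h (char_poly (stage_mat n (Suc k) x)) \<partial>Pi\<^sub>M (entry_index n) (entry_law n \<beta>)) =
    (\<integral>\<^sup>+x. h (char_poly (stage_mat n k x)) \<partial>Pi\<^sub>M (entry_index n) (entry_law n \<beta>))"
proof -
  define D where "D = entry_law n \<beta>"
  have CP: "complex_product D" unfolding D_def by (rule complex_product_entry_law)
  interpret product_prob_space D by (rule complex_productD[OF CP])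
  note [measurable_cong, simp] = complex_productD(2)[OF CP]
  note [simp] = complex_productD(3)[OF CP]
  define V where "V = {..<k} \<times> {k}"
  define K where "K = entry_index n - insert (n, k) V"
  have fin: "finite V" "finite (insert (n, k) V)" "finite K" "(n, k) \<notin> V" "insert (n, k) V \<inter> K = {}"
    using k by (auto simp: V_def K_def entry_index_def)
  have J: "entry_index n = insert (n, k) V \<union> K" using k by (auto simp: V_def K_def entry_index_def)
  have stage_meas: "(\<lambda>x. h (char_poly (stage_mat n m x))) \<in> borel_measurable (Pi\<^sub>M (insert (n, k) V \<union> K) D)" if "1 \<le> m" for m
    unfolding stage_mat_def J[symmetric]
  proof (intro measurable_compose[OF _ h] measurable_char_poly)
    fix i j assume "i < n" "j < n"
    then show "(\<lambda>x. case (i, j) of (r, c) \<Rightarrow> if c \<le> r \<or> c < m then x (r, c) else if c = Suc r then x (n, c) else 0)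
        \<in> borel_measurable (Pi\<^sub>M (entry_index n) D)"
      using that by (cases "j \<le> i \<or> j < m"; cases "j = Suc i") (auto simp: entry_index_def)
  qed
  have in_K: "(r, c) \<in> K" if "r < n" "c < n" "\<not> (c = k \<and> r < k)" for r c
    using that k by (auto simp: K_def entry_index_def V_def)
  have in_K': "(n, Suc r) \<in> K" if "Suc r < n" "Suc r \<noteq> k" for r
    using that k by (auto simp: K_def entry_index_def V_def)
  have border_meas2: "(\<lambda>p. h (char_poly (border_mat n k (w (fst p)) (snd p)))) \<in> borel_measurable (borel \<Otimes>\<^sub>M Pi\<^sub>M K D)"
    if w: "\<And>i. (\<lambda>z. w z i) \<in> borel_measurable borel" for w :: "complex \<Rightarrow> nat \<Rightarrow> complex"
    unfolding border_mat_def
  proof (intro measurable_compose[OF _ h] measurable_char_poly)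
    fix i j assume ij: "i < n" "j < n"
    have 1: "(\<lambda>p. snd p l) \<in> borel_measurable (borel \<Otimes>\<^sub>M Pi\<^sub>M K D)" if "l \<in> K" for l
      using that by measurable
    have 2: "(\<lambda>p. w (fst p) i) \<in> borel_measurable (borel \<Otimes>\<^sub>M Pi\<^sub>M K D)"
      using w by measurable
    consider "j = k \<and> i < k" | "\<not> (j = k \<and> i < k)" "j \<le> i \<or> j < k"
      | "\<not> (j = k \<and> i < k)" "\<not> (j \<le> i \<or> j < k)" "j = Suc i" | "\<not> (j = k \<and> i < k)" "\<not> (j \<le> i \<or> j < k)" "j \<noteq> Suc i" by blast
    then show "(\<lambda>p. case (i, j) of (r, c) \<Rightarrow> if c = k \<and> r < k then w (fst p) r else if c \<le> r \<or> c < k then snd p (r, c)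
        else if c = Suc r then snd p (n, c) else 0) \<in> borel_measurable (borel \<Otimes>\<^sub>M Pi\<^sub>M K D)"
    proof cases
      case 1
      then show ?thesis using 2 by simp
    next
      case 2
      then show ?thesis using 1[OF in_K[OF ij 2(1)]] by auto
    next
      case 3
      then show ?thesis using ij 1[OF in_K'[of i]] by auto
    next
      case 4
      then show ?thesis by auto
    qed
  qed
  define w where "w z i = (if i = k - 1 then z else 0 :: complex)" for z and i :: nat
  define G where "G z = (\<integral>\<^sup>+y. h (char_poly (border_mat n k (w z) y)) \<partial>Pi\<^sub>M K D)" for z
  have PK: "prob_space (Pi\<^sub>M K D)" by (rule prob_space_PiM) (rule complex_productD[OF CP])
  interpret PK: prob_space "Pi\<^sub>M K D" by (rule PK)
  have Gm [measurable]: "G \<in> borel_measurable borel"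
    unfolding G_def
    by (rule PK.borel_measurable_nn_integral) (use border_meas2[of w] in \<open>simp add: w_def case_prod_beta'\<close>)
  have border_meas: "(\<lambda>y. h (char_poly (border_mat n k v y))) \<in> borel_measurable (Pi\<^sub>M K D)" for v
    using measurable_compose[OF measurable_Pair1' border_meas2[of "\<lambda>_. v"], of 0] by simp
  have merge_border: "border_mat n k v (merge (insert (n, k) V) K (a, y)) = border_mat n k v y" for v a y
  proof -
    have "merge (insert (n, k) V) K (a, y) l = y l" if "l \<in> K" for l
      using that fin(5) by (auto simp: merge_def)
    then show ?thesis using in_K in_K' unfolding border_mat_def by (intro cong_mat) auto
  qed
  have st1: "stage_mat n (Suc k) x = border_mat n k (\<lambda>r. x (r, k)) x" for x
    unfolding border_mat_def stage_mat_def by (intro cong_mat) auto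
  have st2: "stage_mat n k x = border_mat n k (w (x (n, k))) x" for x
    unfolding border_mat_def stage_mat_def w_def using k by (intro cong_mat) auto
  have DK: "{..<n} \<times> {..<k} \<subseteq> K" "\<And>l. l \<in> {..<n} \<times> {..<k} \<Longrightarrow> D l = std_gaussian \<beta>"
    using in_K k by (auto simp: D_def entry_law_def)
  have DV: "Pi\<^sub>M V D = Pi\<^sub>M V (\<lambda>_. std_gaussian \<beta>)"
    using k by (intro PiM_cong) (auto simp: V_def D_def entry_law_def)
  have VK: "(n, k) \<notin> K" "\<And>r. r < k \<Longrightarrow> (r, k) \<notin> K" by (auto simp: K_def V_def)
  have "(\<integral>\<^sup>+x. h (char_poly (stage_mat n (Suc k) x)) \<partial>Pi\<^sub>M (entry_index n) D) =
      (\<integral>\<^sup>+a. \<integral>\<^sup>+y. h (char_poly (stage_mat n (Suc k) (merge (insert (n, k) V) K (a, y)))) \<partial>Pi\<^sub>M K D \<partial>Pi\<^sub>M (insert (n, k) V) D)"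
    unfolding J using fin stage_meas[of "Suc k"] by (intro product_nn_integral_fold) auto
  also have "\<dots> = (\<integral>\<^sup>+a. G (complex_of_real (sqrt (\<Sum>l\<in>V. (cmod (a l))\<^sup>2))) \<partial>Pi\<^sub>M (insert (n, k) V) D)"
  proof (rule nn_integral_cong_AE)
    \<comment> \<open>For \<beta> = 1 the reduction to the norm is valid for real columns only, and
      the coordinates are real only almost surely, being complex-valued by type.\<close>
    have "AE a in Pi\<^sub>M (insert (n, k) V) D. \<forall>r\<in>{..<k}. \<beta> = 1 \<longrightarrow> a (r, k) \<in> \<real>"
    proof (rule AE_finite_allI)
      fix r assume r: "r \<in> {..<k}"
      show "AE a in Pi\<^sub>M (insert (n, k) V) D. \<beta> = 1 \<longrightarrow> a (r, k) \<in> \<real>"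
      proof (rule AE_PiM_component)
        show "AE z in D (r, k). \<beta> = 1 \<longrightarrow> z \<in> \<real>"
        proof -
          have "D (r, k) = std_gaussian \<beta>" using r k by (simp add: D_def entry_law_def)
          then show ?thesis using AE_std_gaussian_real by (metis (mono_tags) AE_I2 eventually_mono)
        qed
      qed (use r complex_productD(4)[OF CP] in \<open>auto simp: V_def\<close>)
    qed simp
    then show "AE a in Pi\<^sub>M (insert (n, k) V) D.
      (\<integral>\<^sup>+y. h (char_poly (stage_mat n (Suc k) (merge (insert (n, k) V) K (a, y)))) \<partial>Pi\<^sub>M K D) =
      G (complex_of_real (sqrt (\<Sum>l\<in>V. (cmod (a l))\<^sup>2)))"
    proof eventually_elim
      case (elim a)
      have "border_mat n k (\<lambda>r. merge (insert (n, k) V) K (a, y) (r, k)) y = border_mat n k (\<lambda>r. a (r, k)) y" for y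
        unfolding border_mat_def by (intro cong_mat) (auto simp: merge_def V_def)
      then have "(\<integral>\<^sup>+y. h (char_poly (stage_mat n (Suc k) (merge (insert (n, k) V) K (a, y)))) \<partial>Pi\<^sub>M K D) =
          (\<integral>\<^sup>+y. h (char_poly (border_mat n k (\<lambda>r. a (r, k)) y)) \<partial>Pi\<^sub>M K D)"
        by (simp add: st1 merge_border)
      also have "\<dots> = G (complex_of_real (sqrt (\<Sum>j<k. (cmod (a (j, k)))\<^sup>2)))"
        unfolding G_def w_def using elim k DK fin
        by (intro border_integral_reduce[OF _ _ \<beta> CP _ _ _ border_meas]) auto
      also have "(\<Sum>j<k. (cmod (a (j, k)))\<^sup>2) = (\<Sum>l\<in>V. (cmod (a l))\<^sup>2)"
        unfolding V_def by (rule sum.reindex_bij_witness[of _ fst "\<lambda>j. (j, k)"]) auto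
      finally show ?case .
    qed
  qed
  also have "\<dots> = (\<integral>\<^sup>+a. \<integral>\<^sup>+z. G (complex_of_real (sqrt (\<Sum>l\<in>V. (cmod (a l))\<^sup>2))) \<partial>D (n, k) \<partial>Pi\<^sub>M V D)"
  proof (subst product_nn_integral_insert[OF fin(1,4)])
    show "(\<lambda>a. G (complex_of_real (sqrt (\<Sum>l\<in>V. (cmod (a l))\<^sup>2)))) \<in> borel_measurable (Pi\<^sub>M (insert (n, k) V) D)"
      by (intro measurable_compose[OF _ Gm]) (auto intro!: borel_measurable_of_real borel_measurable_sqrt borel_measurable_sum)
    have "(\<Sum>l\<in>V. (cmod ((a((n, k) := z)) l))\<^sup>2) = (\<Sum>l\<in>V. (cmod (a l))\<^sup>2)" for a z
      using fin(4) by (intro sum.cong) auto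
    then show "(\<integral>\<^sup>+a. \<integral>\<^sup>+z. G (complex_of_real (sqrt (\<Sum>l\<in>V. (cmod ((a((n, k) := z)) l))\<^sup>2))) \<partial>D (n, k) \<partial>Pi\<^sub>M V D) =
      (\<integral>\<^sup>+a. \<integral>\<^sup>+z. G (complex_of_real (sqrt (\<Sum>l\<in>V. (cmod (a l))\<^sup>2))) \<partial>D (n, k) \<partial>Pi\<^sub>M V D)" by simp
  qed
  also have "\<dots> = (\<integral>\<^sup>+a. G (complex_of_real (sqrt (\<Sum>l\<in>V. (cmod (a l))\<^sup>2))) \<partial>Pi\<^sub>M V D)"
    using prob_space.emeasure_space_1[OF complex_productD(4)[OF CP, of "(n, k)"]] by simp
  \<comment> \<open>The exchange itself: the length of the k frozen Gaussians gives way to a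
    variable with the scaled chi law for k, which is the law of coordinate
    \<open>(n, k)\<close>.\<close>
  also have "\<dots> = (\<integral>\<^sup>+t. G (complex_of_real t) \<partial>scaled_chi \<beta> (card V))"
    unfolding DV by (rule nn_integral_norm_gaussian_vector[OF \<beta> fin(1), of "\<lambda>t. G (complex_of_real t)"]) measurable
  also have "\<dots> = (\<integral>\<^sup>+z. G z \<partial>D (n, k))"
    using k by (simp add: V_def D_def entry_law_def nn_integral_distr)
  also have "\<dots> = (\<integral>\<^sup>+a. \<integral>\<^sup>+z. G z \<partial>D (n, k) \<partial>Pi\<^sub>M V D)"
    using prob_space.emeasure_space_1[OF prob_space_PiM[of V D]] complex_productD(4)[OF CP] by simp
  also have "\<dots> = (\<integral>\<^sup>+a. G (a (n, k)) \<partial>Pi\<^sub>M (insert (n, k) V) D)"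
    by (subst product_nn_integral_insert[OF fin(1,4)]) (auto intro!: measurable_compose[OF _ Gm])
  also have "\<dots> = (\<integral>\<^sup>+a. \<integral>\<^sup>+y. h (char_poly (stage_mat n k (merge (insert (n, k) V) K (a, y)))) \<partial>Pi\<^sub>M K D \<partial>Pi\<^sub>M (insert (n, k) V) D)"
    by (simp add: G_def st2 merge_border) (simp add: merge_def)
  also have "\<dots> = (\<integral>\<^sup>+x. h (char_poly (stage_mat n k x)) \<partial>Pi\<^sub>M (entry_index n) D)"
    unfolding J using fin stage_meas[of k] k by (intro product_nn_integral_fold[symmetric]) auto
  finally show ?thesis unfolding D_def .
qed

text \<open>Each new variable is read off the block \<open>{f j}\<close> of old ones; injectivity
  makes these blocks disjoint.\<close>

lemma (in prob_space) indep_vars_reindex: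
  assumes "indep_vars M' X I" "inj_on f J" "f ` J \<subseteq> I"
  shows "indep_vars (\<lambda>j. M' (f j)) (\<lambda>j. X (f j)) J"
proof -
  have "indep_vars (\<lambda>j. Pi\<^sub>M {f j} M') (\<lambda>j \<omega>. restrict (\<lambda>i. X i \<omega>) {f j}) J"
    using assms by (intro indep_vars_restrict[OF assms(1)]) (auto simp: disjoint_family_on_def inj_on_def)
  from indep_vars_compose2[OF this, of "\<lambda>j x. x (f j)" "\<lambda>j. M' (f j)"]
  show ?thesis by simp
qed

lemma stage_mat_all:
  assumes "1 \<le> k" "k \<le> n" "\<beta> \<in> {1, 2}" and "h \<in> borel_measurable poly_space"
  shows "(\<integral>\<^sup>+x. h (char_poly (stage_mat n k x)) \<partial>Pi\<^sub>M (entry_index n) (entry_law n \<beta>)) =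
    (\<integral>\<^sup>+x. h (char_poly (stage_mat n 1 x)) \<partial>Pi\<^sub>M (entry_index n) (entry_law n \<beta>))"
  using assms(1,2)
proof (induction k rule: dec_induct)
  case (step k)
  then show ?case using stage_mat_step[of k n \<beta> h] assms(3,4) by simp
qed simp

lemma char_poly_hessenberg_law:
  fixes N :: "nat \<Rightarrow> nat \<Rightarrow> 'w \<Rightarrow> complex" and b :: "nat \<Rightarrow> 'w \<Rightarrow> real"
  assumes "prob_space M" and \<beta>: "\<beta> \<in> {1, 2}"
    and indep: "prob_space.indep_vars M (\<lambda>_. borel)
           (case_sum (\<lambda>(k, j). N k j) (\<lambda>k \<omega>. complex_of_real (b k \<omega>)))
           ((SIGMA k:{1..}. {1..k}) <+> {1..})"
    and N: "\<And>k j. 1 \<le> j \<Longrightarrow> j \<le> k \<Longrightarrow> distr M borel (N k j) = std_gaussian \<beta>"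
    and b: "\<And>k. 1 \<le> k \<Longrightarrow> distr M borel (b k) = scaled_chi \<beta> k"
    and n: "1 \<le> n"
  shows "distr M poly_space (\<lambda>\<omega>. char_poly (hessenberg (\<lambda>k j. N k j \<omega>) (\<lambda>k. b k \<omega>) n)) =
        distr (\<Pi>\<^sub>M ij\<in>{..<n} \<times> {..<n}. std_gaussian \<beta>) poly_space (\<lambda>G. char_poly (mat n n G))"
proof -
  interpret W: prob_space M by fact
  define D where "D = entry_law n \<beta>"
  have CP: "complex_product D" unfolding D_def by (rule complex_product_entry_law)
  interpret product_prob_space D "entry_index n" by (rule complex_productD[OF CP])
  note [measurable_cong, simp] = complex_productD(2)[OF CP]
  \<comment> \<open>The coordinates that stage 1 reads: the lower triangle and the superdiagonal.
    The given variables determine these only; the remaining coordinates of the product are added as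
    a marginal extension and integrate out.\<close>
  define J where "J = {(r, c). c \<le> r \<and> r < n} \<union> {n} \<times> {1..<n}"
  have J: "J \<subseteq> entry_index n" "finite (entry_index n)" "finite J"
  proof -
    show "J \<subseteq> entry_index n" "finite (entry_index n)" by (auto simp: J_def entry_index_def)
    then show "finite J" by (rule finite_subset)
  qed
  \<comment> \<open>Matrix indices move from 0 to 1 for the Gaussian entries. The superdiagonal
    entry of column c counted from 0 lies in row c counted from 1, so it is \<open>b c\<close>
    without a shift.\<close>
  define f where "f = (\<lambda>(r, c). if r < n then Inl (Suc r, Suc c) else Inr c :: (nat \<times> nat) + nat)"
  define Y where "Y l = case_sum (\<lambda>(k, j). N k j) (\<lambda>k \<omega>. complex_of_real (b k \<omega>)) (f l)" for l
  have "W.indep_vars (\<lambda>_. borel) Y J"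
    unfolding Y_def
  proof (rule W.indep_vars_reindex[OF indep])
    show "inj_on f J" by (auto simp: inj_on_def f_def J_def)
    show "f ` J \<subseteq> (SIGMA k:{1..}. {1..k}) <+> {1..}" by (auto simp: f_def J_def)
  qed
  moreover have "(0, 0) \<in> J" using n by (simp add: J_def)
  moreover have Y: "Y l \<in> borel_measurable M" if "l \<in> J" for l
    using calculation(1) that by (auto simp: W.indep_vars_def)
  ultimately have law: "distr M (Pi\<^sub>M J (\<lambda>_. borel)) (\<lambda>\<omega>. \<lambda>l\<in>J. Y l \<omega>) = Pi\<^sub>M J (\<lambda>l. distr M borel (Y l))"
    by (subst W.indep_vars_iff_distr_eq_PiM'[symmetric]) auto
  have bm: "b k \<in> borel_measurable M" if "1 \<le> k" for k
  proof -
    have "(\<lambda>\<omega>. complex_of_real (b k \<omega>)) \<in> borel_measurable M"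
      using indep that unfolding W.indep_vars_def by force
    from measurable_compose[OF this borel_measurable_Re] show ?thesis by simp
  qed
  have "distr M borel (Y l) = D l" if "l \<in> J" for l
  proof (cases l)
    case (Pair r c)
    show ?thesis
    proof (cases "r < n")
      case True
      then show ?thesis using that N[of "Suc c" "Suc r"] by (auto simp: Pair Y_def f_def J_def D_def entry_law_def)
    next
      case False
      then have c: "1 \<le> c" using that by (auto simp: Pair J_def)
      have "distr M borel (\<lambda>\<omega>. complex_of_real (b c \<omega>)) = distr (distr M borel (b c)) borel complex_of_real"
        using bm[OF c] by (subst distr_distr) (auto simp: comp_def)
      then show ?thesis using False b[OF c] by (simp add: Pair Y_def f_def D_def entry_law_def)
    qed
  qed
  then have law: "distr M (Pi\<^sub>M J (\<lambda>_. borel)) (\<lambda>\<omega>. \<lambda>l\<in>J. Y l \<omega>) = Pi\<^sub>M J D"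
    unfolding law by (intro PiM_cong) auto
  have hess: "hessenberg (\<lambda>k j. N k j \<omega>) (\<lambda>k. b k \<omega>) n = stage_mat n 1 (\<lambda>l\<in>J. Y l \<omega>)" for \<omega>
    unfolding hessenberg_def stage_mat_def Let_def
    by (intro cong_mat) (auto simp: J_def Y_def f_def)
  have stage_J: "stage_mat n 1 (restrict x J) = stage_mat n 1 x" for x
    unfolding stage_mat_def by (intro cong_mat) (auto simp: J_def)
  have vec: "(\<lambda>\<omega>. \<lambda>l\<in>J. Y l \<omega>) \<in> M \<rightarrow>\<^sub>M Pi\<^sub>M J (\<lambda>_. borel)" by (intro measurable_restrict Y)
  have stage_meas: "(\<lambda>x. char_poly (stage_mat n 1 x)) \<in> Pi\<^sub>M J (\<lambda>_. borel) \<rightarrow>\<^sub>M poly_space"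
    unfolding stage_mat_def
  proof (rule measurable_char_poly)
    fix i j assume "i < n" "j < n"
    then show "(\<lambda>x. case (i, j) of (r, c) \<Rightarrow> if c \<le> r \<or> c < 1 then x (r, c) else if c = Suc r then x (n, c) else 0)
        \<in> borel_measurable (Pi\<^sub>M J (\<lambda>_. borel))"
      by (cases "j \<le> i \<or> j < 1"; cases "j = Suc i") (auto simp: J_def)
  qed
  have ginibre_meas: "(\<lambda>G. char_poly (mat n n G)) \<in> Pi\<^sub>M ({..<n} \<times> {..<n}) (\<lambda>_. std_gaussian \<beta>) \<rightarrow>\<^sub>M poly_space"
    by (rule measurable_char_poly) auto
  show ?thesis
  proof (rule measure_eqI_nn_integral)
    fix h :: "complex poly \<Rightarrow> ennreal"
    assume "h \<in> borel_measurable (distr (\<Pi>\<^sub>M ij\<in>{..<n} \<times> {..<n}. std_gaussian \<beta>) poly_space (\<lambda>G. char_poly (mat n n G)))"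
    then have h: "h \<in> borel_measurable poly_space" by simp
    have hm: "(\<lambda>x. h (char_poly (stage_mat n 1 x))) \<in> borel_measurable (Pi\<^sub>M J (\<lambda>_. borel))"
      by (rule measurable_compose[OF stage_meas h])
    then have hm': "(\<lambda>x. h (char_poly (stage_mat n 1 x))) \<in> borel_measurable (Pi\<^sub>M J D)"
      by (simp cong: measurable_cong_sets sets_PiM_cong)
    have "(\<integral>\<^sup>+p. h p \<partial>distr M poly_space (\<lambda>\<omega>. char_poly (hessenberg (\<lambda>k j. N k j \<omega>) (\<lambda>k. b k \<omega>) n)))
        = (\<integral>\<^sup>+\<omega>. h (char_poly (stage_mat n 1 (\<lambda>l\<in>J. Y l \<omega>))) \<partial>M)"
      unfolding hess using h measurable_compose[OF vec stage_meas] by (subst nn_integral_distr) auto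
    also have "\<dots> = (\<integral>\<^sup>+x. h (char_poly (stage_mat n 1 x)) \<partial>Pi\<^sub>M J D)"
      unfolding law[symmetric] using hm vec by (subst nn_integral_distr) auto
    also have "\<dots> = (\<integral>\<^sup>+x. h (char_poly (stage_mat n 1 (restrict x J))) \<partial>Pi\<^sub>M (entry_index n) D)"
      using hm' measurable_restrict_subset[OF J(1)]
      by (subst distr_PiM_restrict_finite[OF J(3,1), symmetric], subst nn_integral_distr) auto
    also have "\<dots> = (\<integral>\<^sup>+x. h (char_poly (stage_mat n n x)) \<partial>Pi\<^sub>M (entry_index n) D)"
      unfolding stage_J D_def by (rule stage_mat_all[symmetric]) (use n \<beta> h in auto)
    also have "\<dots> = (\<integral>\<^sup>+x. h (char_poly (mat n n (restrict x ({..<n} \<times> {..<n})))) \<partial>Pi\<^sub>M (entry_index n) D)"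
    proof -
      have "stage_mat n n x = mat n n (restrict x ({..<n} \<times> {..<n}))" for x
        unfolding stage_mat_def by (intro cong_mat) auto
      then show ?thesis by simp
    qed
    also have "\<dots> = (\<integral>\<^sup>+x. h (char_poly (mat n n x)) \<partial>Pi\<^sub>M ({..<n} \<times> {..<n}) (\<lambda>_. std_gaussian \<beta>))"
    proof -
      have sub: "{..<n} \<times> {..<n} \<subseteq> entry_index n" by (auto simp: entry_index_def)
      have "Pi\<^sub>M ({..<n} \<times> {..<n}) (\<lambda>_. std_gaussian \<beta>) = Pi\<^sub>M ({..<n} \<times> {..<n}) D"
        by (intro PiM_cong) (auto simp: D_def entry_law_def)
      also have "\<dots> = distr (Pi\<^sub>M (entry_index n) D) (Pi\<^sub>M ({..<n} \<times> {..<n}) D) (\<lambda>x. restrict x ({..<n} \<times> {..<n}))"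
        by (rule distr_PiM_restrict_finite[symmetric]) (auto simp: sub)
      finally have eq: "Pi\<^sub>M ({..<n} \<times> {..<n}) (\<lambda>_. std_gaussian \<beta>) = \<dots>" .
      have "(\<lambda>G. h (char_poly (mat n n G))) \<in> borel_measurable (Pi\<^sub>M ({..<n} \<times> {..<n}) D)"
        by (rule measurable_compose[OF measurable_char_poly h]) auto
      then show ?thesis
        using measurable_restrict_subset[OF sub] by (subst eq, subst nn_integral_distr) auto
    qed
    also have "\<dots> = (\<integral>\<^sup>+p. h p \<partial>distr (\<Pi>\<^sub>M ij\<in>{..<n} \<times> {..<n}. std_gaussian \<beta>) poly_space (\<lambda>G. char_poly (mat n n G)))"
      using ginibre_meas h by (subst nn_integral_distr) auto
    finally show "(\<integral>\<^sup>+p. h p \<partial>distr M poly_space (\<lambda>\<omega>. char_poly (hessenberg (\<lambda>k j. N k j \<omega>) (\<lambda>k. b k \<omega>) n)))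
      = (\<integral>\<^sup>+p. h p \<partial>distr (\<Pi>\<^sub>M ij\<in>{..<n} \<times> {..<n}. std_gaussian \<beta>) poly_space (\<lambda>G. char_poly (mat n n G)))" .
  qed simp
qed

subsection \<open>The recursion and the characteristic polynomial\<close>

definition with_first_col :: "nat \<Rightarrow> (nat \<Rightarrow> complex) \<Rightarrow> complex mat" where
  "with_first_col n x = mat n n (\<lambda>(r, c). if c = 0 then x (Suc r) else if r = c then 1 else 0)"

text \<open>Multiplying \<open>z - H\<close> by the identity matrix with first column \<open>(X\<^sub>1, \<dots>, X\<^sub>n)\<close>, which has
  determinant 1, turns the first column into \<open>(0, \<dots>, 0, b\<^sub>n X\<^sub>n\<^sub>+\<^sub>1)\<close>.\<close>

lemma hessenberg_recursion_char_poly: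
  fixes N :: "nat \<Rightarrow> nat \<Rightarrow> complex" and b :: "nat \<Rightarrow> real" and x :: "nat \<Rightarrow> complex"
  assumes x1: "x 1 = 1"
    and rec: "\<And>k. 1 \<le> k \<Longrightarrow> k \<le> n \<Longrightarrow> (\<Sum>j=1..k. N k j * x j) + complex_of_real (b k) * x (k + 1) = z * x k"
    and n: "1 \<le> n"
  shows "poly (char_poly (hessenberg N b n)) z = (\<Prod>k=1..n. complex_of_real (b k)) * x (n + 1)"
proof -
  define H where "H = hessenberg N b n"
  define A where "A = mat n n (\<lambda>(r, c). (if r = c then z else 0) - H $$ (r, c))"
  define U where "U = with_first_col n x"
  have H: "H \<in> carrier_mat n n" and A: "A \<in> carrier_mat n n" and U: "U \<in> carrier_mat n n"
    by (auto simp: H_def hessenberg_def A_def U_def with_first_col_def)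
  have "poly (char_poly H) z = det (- char_matrix H z)" by (rule char_poly_matrix[OF H])
  also have "- char_matrix H z = A"
    using H by (intro eq_matI) (auto simp: A_def char_matrix_def)
  finally have pA: "poly (char_poly H) z = det A" .
  have "det U = prod_list (diag_mat U)"
    by (rule det_lower_triangular[OF _ U]) (auto simp: U_def with_first_col_def)
  also have "\<dots> = (\<Prod>i = 0..<n. U $$ (i, i))" using U by (simp add: prod_list_diag_prod)
  also have "\<dots> = 1" using x1 by (intro prod.neutral) (auto simp: U_def with_first_col_def)
  finally have detU: "det U = 1" .
  obtain m where m: "n = Suc m" using n by (cases n) auto
  have n0: "0 < n" using m by simp
  define B where "B = A * U"
  have B: "B \<in> carrier_mat n n" unfolding B_def using A U by simp
  have Bentry: "B $$ (i, j) = (\<Sum>l = 0..<n. A $$ (i, l) * U $$ (l, j))" if "i < n" "j < n" for i j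
    unfolding B_def using A U that by (simp add: scalar_prod_def)
  \<comment> \<open>Row i against the new first column is the recursion at k = i + 1. Every term of
    it is present in the matrix except in the last row, where the term with \<open>b n\<close> falls
    outside and is what remains.\<close>
  have B0: "B $$ (i, 0) = (if i = m then complex_of_real (b n) * x (n + 1) else 0)" if i: "i < n" for i
  proof -
    have "B $$ (i, 0) = (\<Sum>l = 0..<n. (if l = i then z * x (Suc i) else 0) - H $$ (i, l) * x (Suc l))"
      unfolding Bentry[OF i n0]
      using i by (intro sum.cong) (auto simp: A_def U_def with_first_col_def algebra_simps)
    also have "\<dots> = z * x (Suc i) - (\<Sum>l = 0..<n. H $$ (i, l) * x (Suc l))"
      using i by (simp add: sum_subtractf)
    also have "(\<Sum>l = 0..<n. H $$ (i, l) * x (Suc l)) =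
        (\<Sum>l\<in>{0..<Suc i}. N (Suc i) (Suc l) * x (Suc l)) + (if Suc i < n then b (Suc i) * x (Suc (Suc i)) else 0)"
    proof -
      have "(\<Sum>l = 0..<n. H $$ (i, l) * x (Suc l)) =
          (\<Sum>l = 0..<n. (if l \<in> {0..<Suc i} then N (Suc i) (Suc l) * x (Suc l) else 0) +
            (if l = Suc i then b (Suc i) * x (Suc (Suc i)) else 0))"
        using i by (intro sum.cong) (auto simp: H_def hessenberg_def Let_def)
      also have "\<dots> = (\<Sum>l\<in>{0..<n} \<inter> {0..<Suc i}. N (Suc i) (Suc l) * x (Suc l)) +
          (if Suc i < n then b (Suc i) * x (Suc (Suc i)) else 0)"
        unfolding sum.distrib by (subst sum.inter_restrict) simp_all
      also have "{0..<n} \<inter> {0..<Suc i} = {0..<Suc i}" using i by auto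
      finally show ?thesis .
    qed
    also have "(\<Sum>l\<in>{0..<Suc i}. N (Suc i) (Suc l) * x (Suc l)) = (\<Sum>j=1..Suc i. N (Suc i) j * x j)"
      by (rule sum.reindex_bij_witness[of _ "\<lambda>j. j - 1" Suc]) auto
    finally have "B $$ (i, 0) = z * x (Suc i) - ((\<Sum>j=1..Suc i. N (Suc i) j * x j) +
      (if Suc i < n then b (Suc i) * x (Suc (Suc i)) else 0))" .
    moreover have "z * x (Suc i) = (\<Sum>j=1..Suc i. N (Suc i) j * x j) + b (Suc i) * x (Suc (Suc i))"
      using rec[of "Suc i"] i by (simp del: sum.cl_ivl_Suc)
    ultimately show ?thesis using i by (auto simp: m simp del: sum.cl_ivl_Suc)
  qed
  have Bj: "B $$ (i, j) = A $$ (i, j)" if "i < n" "j < n" "0 < j" for i j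
  proof -
    have "B $$ (i, j) = (\<Sum>l = 0..<n. if l = j then A $$ (i, j) else 0)"
      unfolding Bentry[OF that(1,2)] using that
      by (intro sum.cong) (auto simp: U_def with_first_col_def)
    then show ?thesis using that by simp
  qed
  have "det A = det B" unfolding B_def using det_mult[OF A U] detU by simp
  also have "\<dots> = (\<Sum>i<n. B $$ (i, 0) * cofactor B i 0)"
    by (rule laplace_expansion_column[OF B]) (simp add: m)
  also have "\<dots> = (\<Sum>i<n. if i = m then complex_of_real (b n) * x (n + 1) * cofactor B m 0 else 0)"
    by (intro sum.cong) (auto simp: B0)
  also have "\<dots> = complex_of_real (b n) * x (n + 1) * cofactor B m 0" by (simp add: m)
  also have "cofactor B m 0 = (- 1) ^ m * det (mat_delete B m 0)" by (simp add: cofactor_def)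
  \<comment> \<open>Without the first column and the last row, the superdiagonal of \<open>A\<close>
    becomes the diagonal of a lower triangular matrix with entries \<open>- b 1, ..., - b m\<close>.
    Their m signs cancel the sign of the cofactor.\<close>
  also have "det (mat_delete B m 0) = (\<Prod>i = 0..<m. - complex_of_real (b (Suc i)))"
  proof -
    have C: "mat_delete B m 0 \<in> carrier_mat m m" using mat_delete_carrier[of B n n m 0] B by (simp add: m)
    have entry: "mat_delete B m 0 $$ (i, j) = A $$ (i, Suc j)" if "i < m" "j < m" for i j
      using that B Bj[of i "Suc j"] by (simp add: mat_delete_def m)
    have "det (mat_delete B m 0) = prod_list (diag_mat (mat_delete B m 0))"
      by (rule det_lower_triangular[OF _ C])
        (auto simp: entry A_def m H_def hessenberg_def)
    also have "\<dots> = (\<Prod>i = 0..<m. mat_delete B m 0 $$ (i, i))" using B by (simp add: prod_list_diag_prod m)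
    also have "\<dots> = (\<Prod>i = 0..<m. - complex_of_real (b (Suc i)))"
      by (intro prod.cong) (auto simp: entry A_def m H_def hessenberg_def)
    finally show ?thesis .
  qed
  also have "(- 1) ^ m * (\<Prod>i = 0..<m. - complex_of_real (b (Suc i))) = (\<Prod>i = 0..<m. complex_of_real (b (Suc i)))"
    by (simp add: prod_uminus power_add[symmetric] flip: mult.assoc power_mult_distrib)
  also have "(\<Prod>i = 0..<m. complex_of_real (b (Suc i))) = (\<Prod>k=1..m. complex_of_real (b k))"
    by (rule prod.reindex_bij_witness[of _ "\<lambda>j. j - 1" Suc]) auto
  finally show ?thesis using pA by (simp add: H_def m mult_ac)
qed

subsection \<open>Freezing and Gaussian linear combinations\<close>

text \<open>\<open>indep_var\<close> does not apply here, since it requires both variables to have the same type.\<close>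

definition independent_of :: "'w measure \<Rightarrow> 'w measure \<Rightarrow> 'a measure \<Rightarrow> ('w \<Rightarrow> 'a) \<Rightarrow> bool" where
  "independent_of M F S Y \<longleftrightarrow> Y \<in> M \<rightarrow>\<^sub>M S \<and>
     distr M F (\<lambda>\<omega>. \<omega>) \<Otimes>\<^sub>M distr M S Y = distr M (F \<Otimes>\<^sub>M S) (\<lambda>\<omega>. (\<omega>, Y \<omega>))"

lemma measurable_to_subalgebra:
  assumes "subalgebra M F"
  shows "(\<lambda>\<omega>. \<omega>) \<in> M \<rightarrow>\<^sub>M F"
proof (rule measurableI)
  fix A assume A: "A \<in> sets F"
  then have "A \<in> sets M" using assms by (auto simp: subalgebra_def)
  moreover from this have "(\<lambda>\<omega>. \<omega>) -` A \<inter> space M = A" using sets.sets_into_space by blast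
  ultimately show "(\<lambda>\<omega>. \<omega>) -` A \<inter> space M \<in> sets M" by simp
qed (use assms in \<open>simp add: subalgebra_def\<close>)

text \<open>The identity map into \<open>F\<close> makes the whole \<sigma>-field one random
  element, and independence turns its joint law with \<open>Y\<close> into a product. Tonelli over
  \<open>A\<close> times the space of \<open>Y\<close> is then exactly the defining identity of the
  conditional expectation.\<close>

lemma (in prob_space) nn_cond_exp_freeze:
  assumes F: "subalgebra M F" and ind: "independent_of M F S Y"
    and h [measurable]: "h \<in> borel_measurable (F \<Otimes>\<^sub>M S)"
    and f: "\<And>\<omega>. \<omega> \<in> space M \<Longrightarrow> f \<omega> = h (\<omega>, Y \<omega>)"
  shows "AE \<omega> in M. nn_cond_exp M F f \<omega> = (\<integral>\<^sup>+y. h (\<omega>, y) \<partial>distr M S Y)"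
proof -
  interpret finite_measure_subalgebra M F by unfold_locales (rule F)
  have idF: "(\<lambda>\<omega>. \<omega>) \<in> M \<rightarrow>\<^sub>M F"
    by (rule measurable_to_subalgebra[OF F])
  have Y [measurable]: "Y \<in> M \<rightarrow>\<^sub>M S"
    and dist: "distr M F (\<lambda>\<omega>. \<omega>) \<Otimes>\<^sub>M distr M S Y = distr M (F \<Otimes>\<^sub>M S) (\<lambda>\<omega>. (\<omega>, Y \<omega>))"
    using ind unfolding independent_of_def by auto
  have pair [measurable]: "(\<lambda>\<omega>. (\<omega>, Y \<omega>)) \<in> M \<rightarrow>\<^sub>M F \<Otimes>\<^sub>M S" using idF by measurable
  interpret Q: prob_space "distr M S Y" by (rule prob_space_distr) (rule Y)
  have g [measurable]: "(\<lambda>\<omega>. \<integral>\<^sup>+y. h (\<omega>, y) \<partial>distr M S Y) \<in> borel_measurable F"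
    by measurable
  have fm: "f \<in> borel_measurable M"
    by (subst measurable_cong[OF f]) (auto intro: measurable_compose[OF pair h])
  have "AE \<omega> in M. (\<integral>\<^sup>+y. h (\<omega>, y) \<partial>distr M S Y) = nn_cond_exp M F f \<omega>"
  proof (rule nn_cond_exp_charact[OF _ fm g])
    fix A assume A [measurable]: "A \<in> sets F"
    have "(\<integral>\<^sup>+\<omega>\<in>A. f \<omega> \<partial>M) = (\<integral>\<^sup>+\<omega>. (\<lambda>(\<omega>, y). h (\<omega>, y) * indicator A \<omega>) (\<omega>, Y \<omega>) \<partial>M)"
      by (intro nn_integral_cong) (simp add: f)
    also have "\<dots> = (\<integral>\<^sup>+p. (\<lambda>(\<omega>, y). h (\<omega>, y) * indicator A \<omega>) p \<partial>(distr M F (\<lambda>\<omega>. \<omega>) \<Otimes>\<^sub>M distr M S Y))"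
      unfolding dist by (rule nn_integral_distr[symmetric]) measurable
    also have "\<dots> = (\<integral>\<^sup>+\<omega>. \<integral>\<^sup>+y. h (\<omega>, y) * indicator A \<omega> \<partial>distr M S Y \<partial>distr M F (\<lambda>\<omega>. \<omega>))"
      by (subst Q.nn_integral_fst[symmetric]) simp_all
    also have "\<dots> = (\<integral>\<^sup>+\<omega>. \<integral>\<^sup>+y. h (\<omega>, y) * indicator A \<omega> \<partial>distr M S Y \<partial>M)"
      by (rule nn_integral_distr) (use idF in measurable)
    also have "\<dots> = (\<integral>\<^sup>+\<omega>\<in>A. (\<integral>\<^sup>+y. h (\<omega>, y) \<partial>distr M S Y) \<partial>M)"
    proof (intro nn_integral_cong)
      fix \<omega> assume "\<omega> \<in> space M"
      then have "\<omega> \<in> space F" using F by (simp add: subalgebra_def)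
      then have "(\<lambda>y. h (\<omega>, y)) \<in> borel_measurable (distr M S Y)" by measurable
      then show "(\<integral>\<^sup>+y. h (\<omega>, y) * indicator A \<omega> \<partial>distr M S Y) = (\<integral>\<^sup>+y. h (\<omega>, y) \<partial>distr M S Y) * indicator A \<omega>"
        by (rule nn_integral_multc)
    qed
    finally show "(\<integral>\<^sup>+\<omega>\<in>A. f \<omega> \<partial>M) = (\<integral>\<^sup>+\<omega>\<in>A. (\<integral>\<^sup>+y. h (\<omega>, y) \<partial>distr M S Y) \<partial>M)" .
  qed
  then show ?thesis by eventually_elim simp
qed

lemma (in prob_space) real_cond_exp_freeze:
  assumes F: "subalgebra M F" and ind: "independent_of M F S Y"
    and h [measurable]: "h \<in> borel_measurable (F \<Otimes>\<^sub>M S)"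
    and f: "\<And>\<omega>. \<omega> \<in> space M \<Longrightarrow> f \<omega> = h (\<omega>, Y \<omega>)"
    and int: "\<And>\<omega>. \<omega> \<in> space M \<Longrightarrow> integrable (distr M S Y) (\<lambda>y. h (\<omega>, y))"
  shows "AE \<omega> in M. real_cond_exp M F f \<omega> = (\<integral>y. h (\<omega>, y) \<partial>distr M S Y)"
proof -
  have "AE \<omega> in M. nn_cond_exp M F (\<lambda>\<omega>. ennreal (f \<omega>)) \<omega> = (\<integral>\<^sup>+y. ennreal (h (\<omega>, y)) \<partial>distr M S Y)"
    by (rule nn_cond_exp_freeze[OF F ind]) (auto simp: f)
  moreover have "AE \<omega> in M. nn_cond_exp M F (\<lambda>\<omega>. ennreal (- f \<omega>)) \<omega> = (\<integral>\<^sup>+y. ennreal (- h (\<omega>, y)) \<partial>distr M S Y)"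
    by (rule nn_cond_exp_freeze[OF F ind]) (auto simp: f)
  moreover have "AE \<omega> in M. \<omega> \<in> space M" by simp
  ultimately show ?thesis
    by eventually_elim (simp add: real_cond_exp_def real_lebesgue_integral_def int)
qed

lemma (in prob_space) complex_cond_exp_freeze:
  assumes F: "subalgebra M F" and ind: "independent_of M F S Y"
    and h [measurable]: "h \<in> borel_measurable (F \<Otimes>\<^sub>M S)"
    and f: "\<And>\<omega>. \<omega> \<in> space M \<Longrightarrow> f \<omega> = h (\<omega>, Y \<omega>)"
    and int: "\<And>\<omega>. \<omega> \<in> space M \<Longrightarrow> integrable (distr M S Y) (\<lambda>y. h (\<omega>, y))"
  shows "AE \<omega> in M. complex_cond_exp M F f \<omega> = (\<integral>y. h (\<omega>, y) \<partial>distr M S Y)"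
proof -
  have "AE \<omega> in M. real_cond_exp M F (\<lambda>\<omega>. Re (f \<omega>)) \<omega> = (\<integral>y. Re (h (\<omega>, y)) \<partial>distr M S Y)"
    by (rule real_cond_exp_freeze[OF F ind]) (auto simp: f int intro!: integrable_Re)
  moreover have "AE \<omega> in M. real_cond_exp M F (\<lambda>\<omega>. Im (f \<omega>)) \<omega> = (\<integral>y. Im (h (\<omega>, y)) \<partial>distr M S Y)"
    by (rule real_cond_exp_freeze[OF F ind]) (auto simp: f int intro!: integrable_Im)
  moreover have "AE \<omega> in M. \<omega> \<in> space M" by simp
  ultimately show ?thesis
    by eventually_elim (simp add: complex_cond_exp_def complex_eq_iff int)
qed

section \<open>Linear combinations of independent Gaussians\<close>

text \<open>With \<open>r = sqrt (a^2 + d^2)\<close>, the rotation with \<open>c = a / r\<close> and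
  \<open>s = d / r\<close> turns \<open>a x + d y\<close> into r times a single coordinate, and the
  other coordinate integrates out. If r = 0 both sides are \<open>f 0\<close>.\<close>

lemma nn_integral_std_normal_linear2:
  assumes [measurable]: "f \<in> borel_measurable borel"
  shows "(\<integral>\<^sup>+x. \<integral>\<^sup>+y. f (a * x + d * y) \<partial>std_normal_distribution \<partial>std_normal_distribution) =
    (\<integral>\<^sup>+x. f (sqrt (a\<^sup>2 + d\<^sup>2) * x) \<partial>std_normal_distribution)"
proof -
  interpret N: prob_space std_normal_distribution by (rule prob_space_normal_density) simp
  define r where "r = sqrt (a\<^sup>2 + d\<^sup>2)"
  show ?thesis
  proof (cases "r = 0")
    case True
    then have "a = 0" "d = 0" by (auto simp: r_def add_nonneg_eq_0_iff)
    then show ?thesis using N.emeasure_space_1 by simp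
  next
    case False
    have "(a / r)\<^sup>2 + (d / r)\<^sup>2 = (a\<^sup>2 + d\<^sup>2) / r\<^sup>2" by (simp add: power_divide add_divide_distrib)
    also have "\<dots> = 1" using False by (simp add: r_def)
    finally have cs: "(a / r)\<^sup>2 + (d / r)\<^sup>2 = 1" .
    have "r * (a / r * x + d / r * y) = a * x + d * y" for x y using False by (simp add: field_simps)
    then show ?thesis
      using rotation_invariantD[OF rotation_invariant_normal[of 1] _ cs, of "\<lambda>(x, y). f (r * x)"] N.emeasure_space_1
      by (simp add: r_def)
  qed
qed

text \<open>For \<beta> = 1 the imaginary part vanishes and s = a. For \<beta> = 2 both parts have
  variance 1/2 and \<open>s = sqrt ((a^2 + d^2) / 2)\<close>.\<close>

lemma nn_integral_std_gaussian_linear: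
  assumes \<beta>: "\<beta> \<in> {1, 2}"
  shows "\<exists>s. \<forall>f\<in>borel_measurable borel. (\<integral>\<^sup>+z. f (a * Re z + d * Im z) \<partial>std_gaussian \<beta>) =
    (\<integral>\<^sup>+x. f (s * x) \<partial>std_normal_distribution)"
proof (cases "\<beta> = 1")
  case True
  then show ?thesis by (intro exI[of _ a] ballI) (simp add: nn_integral_std_gaussian_1[simplified])
next
  case False
  then have \<beta>2: "\<beta> = 2" using \<beta> by simp
  interpret N: prob_space std_normal_distribution by (rule prob_space_normal_density) simp
  define q :: real where "q = sqrt (1/2)"
  have q: "0 < q" by (simp add: q_def)
  show ?thesis
  proof (intro exI ballI)
    fix f :: "real \<Rightarrow> ennreal" assume [measurable]: "f \<in> borel_measurable borel"
    have "(\<integral>\<^sup>+z. f (a * Re z + d * Im z) \<partial>std_gaussian 2) = (\<integral>\<^sup>+x. \<integral>\<^sup>+y. f (a * x + d * y) \<partial>half_normal \<partial>half_normal)"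
      by (subst nn_integral_std_gaussian_2) simp_all
    also have "\<dots> = (\<integral>\<^sup>+x. \<integral>\<^sup>+y. f (a * x + d * (q * y)) \<partial>std_normal_distribution \<partial>half_normal)"
      unfolding q_def by (intro nn_integral_cong nn_integral_normal_scale) auto
    also have "\<dots> = (\<integral>\<^sup>+x. \<integral>\<^sup>+y. f (a * (q * x) + d * (q * y)) \<partial>std_normal_distribution \<partial>std_normal_distribution)"
      unfolding q_def by (rule nn_integral_normal_scale) (simp, measurable)
    also have "\<dots> = (\<integral>\<^sup>+x. \<integral>\<^sup>+y. f ((a * q) * x + (d * q) * y) \<partial>std_normal_distribution \<partial>std_normal_distribution)"
      by (simp add: mult.assoc)
    also have "\<dots> = (\<integral>\<^sup>+x. f (sqrt ((a * q)\<^sup>2 + (d * q)\<^sup>2) * x) \<partial>std_normal_distribution)"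
      by (rule nn_integral_std_normal_linear2) measurable
    finally show "(\<integral>\<^sup>+z. f (a * Re z + d * Im z) \<partial>std_gaussian \<beta>) =
      (\<integral>\<^sup>+x. f (sqrt ((a * q)\<^sup>2 + (d * q)\<^sup>2) * x) \<partial>std_normal_distribution)" by (simp only: \<beta>2)
  qed
qed

lemma nn_integral_PiM_std_gaussian_linear:
  assumes \<beta>: "\<beta> \<in> {1, 2}" and A: "finite A"
  shows "\<exists>s. \<forall>f\<in>borel_measurable borel.
    (\<integral>\<^sup>+y. f (\<Sum>j\<in>A. a j * Re (y j) + d j * Im (y j)) \<partial>Pi\<^sub>M A (\<lambda>_. std_gaussian \<beta>)) =
    (\<integral>\<^sup>+x. f (s * x) \<partial>std_normal_distribution)"
  using A
proof (induction A)
  case empty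
  interpret N: prob_space std_normal_distribution by (rule prob_space_normal_density) simp
  show ?case using N.emeasure_space_1 by (intro exI[of _ 0]) (simp add: PiM_empty)
next
  case (insert i A)
  interpret product_prob_space "\<lambda>_. std_gaussian \<beta>"
    by (rule complex_productD) (rule complex_product_std_gaussian)
  interpret N: prob_space std_normal_distribution by (rule prob_space_normal_density) simp
  from insert.IH obtain s where s: "\<And>f. f \<in> borel_measurable borel \<Longrightarrow>
    (\<integral>\<^sup>+y. f (\<Sum>j\<in>A. a j * Re (y j) + d j * Im (y j)) \<partial>Pi\<^sub>M A (\<lambda>_. std_gaussian \<beta>)) =
    (\<integral>\<^sup>+x. f (s * x) \<partial>std_normal_distribution)" by blast
  from nn_integral_std_gaussian_linear[OF \<beta>, of "a i" "d i"] obtain t where t: "\<And>f. f \<in> borel_measurable borel \<Longrightarrow>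
    (\<integral>\<^sup>+z. f (a i * Re z + d i * Im z) \<partial>std_gaussian \<beta>) = (\<integral>\<^sup>+x. f (t * x) \<partial>std_normal_distribution)" by blast
  show ?case
  proof (intro exI ballI)
    fix f :: "real \<Rightarrow> ennreal" assume fm [measurable]: "f \<in> borel_measurable borel"
    define S where "S y = (\<Sum>j\<in>A. a j * Re (y j) + d j * Im (y j))" for y :: "'a \<Rightarrow> complex"
    define g where "g u = (\<integral>\<^sup>+x. f (u + t * x) \<partial>std_normal_distribution)" for u
    have [measurable]: "g \<in> borel_measurable borel" unfolding g_def by measurable
    have S: "(\<Sum>j\<in>insert i A. a j * Re ((y(i := z)) j) + d j * Im ((y(i := z)) j)) = S y + (a i * Re z + d i * Im z)" for y z
    proof -
      have "S (y(i := z)) = S y" unfolding S_def using insert.hyps by (intro sum.cong) auto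
      then show ?thesis using insert.hyps by (simp add: S_def del: fun_upd_apply) simp
    qed
    have "(\<integral>\<^sup>+y. f (\<Sum>j\<in>insert i A. a j * Re (y j) + d j * Im (y j)) \<partial>Pi\<^sub>M (insert i A) (\<lambda>_. std_gaussian \<beta>)) =
      (\<integral>\<^sup>+y. \<integral>\<^sup>+z. f (\<Sum>j\<in>insert i A. a j * Re ((y(i := z)) j) + d j * Im ((y(i := z)) j)) \<partial>std_gaussian \<beta> \<partial>Pi\<^sub>M A (\<lambda>_. std_gaussian \<beta>))"
      using insert.hyps by (intro product_nn_integral_insert measurable_compose[OF _ fm] borel_measurable_sum) auto
    also have "\<dots> = (\<integral>\<^sup>+y. \<integral>\<^sup>+z. f (S y + (a i * Re z + d i * Im z)) \<partial>std_gaussian \<beta> \<partial>Pi\<^sub>M A (\<lambda>_. std_gaussian \<beta>))"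
      unfolding S ..
    also have "\<dots> = (\<integral>\<^sup>+y. g (S y) \<partial>Pi\<^sub>M A (\<lambda>_. std_gaussian \<beta>))"
      unfolding g_def by (intro nn_integral_cong t[of "\<lambda>x. f (S _ + x)"]) measurable
    also have "\<dots> = (\<integral>\<^sup>+x. g (s * x) \<partial>std_normal_distribution)"
      unfolding S_def by (rule s) measurable
    \<comment> \<open>The scale s from the old coordinates and t from the new one belong to
      independent normals, so they combine as the legs of a right triangle.\<close>
    also have "\<dots> = (\<integral>\<^sup>+x. f (sqrt (s\<^sup>2 + t\<^sup>2) * x) \<partial>std_normal_distribution)"
      unfolding g_def by (rule nn_integral_std_normal_linear2) measurable
    finally show "(\<integral>\<^sup>+y. f (\<Sum>j\<in>insert i A. a j * Re (y j) + d j * Im (y j)) \<partial>Pi\<^sub>M (insert i A) (\<lambda>_. std_gaussian \<beta>)) =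
      (\<integral>\<^sup>+x. f (sqrt (s\<^sup>2 + t\<^sup>2) * x) \<partial>std_normal_distribution)" .
  qed
qed

lemma gaussian_law_affine:
  assumes \<beta>: "\<beta> \<in> {1, 2}" and A: "finite A"
  shows "gaussian_law (distr (Pi\<^sub>M A (\<lambda>_. std_gaussian \<beta>)) borel (\<lambda>y. m + (\<Sum>j\<in>A. a j * Re (y j) + d j * Im (y j))))"
proof -
  from nn_integral_PiM_std_gaussian_linear[OF assms] obtain s where s: "\<And>f. f \<in> borel_measurable borel \<Longrightarrow>
    (\<integral>\<^sup>+y. f (\<Sum>j\<in>A. a j * Re (y j) + d j * Im (y j)) \<partial>Pi\<^sub>M A (\<lambda>_. std_gaussian \<beta>)) =
    (\<integral>\<^sup>+x. f (s * x) \<partial>std_normal_distribution)" by blast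
  have "distr (Pi\<^sub>M A (\<lambda>_. std_gaussian \<beta>)) borel (\<lambda>y. m + (\<Sum>j\<in>A. a j * Re (y j) + d j * Im (y j))) =
    distr std_normal_distribution borel (\<lambda>x. m + s * x)"
  proof (rule measure_eqI_nn_integral)
    fix f :: "real \<Rightarrow> ennreal" assume "f \<in> borel_measurable (distr std_normal_distribution borel (\<lambda>x. m + s * x))"
    then have [measurable]: "f \<in> borel_measurable borel" by simp
    have "(\<lambda>y. m + (\<Sum>j\<in>A. a j * Re (y j) + d j * Im (y j))) \<in> borel_measurable (Pi\<^sub>M A (\<lambda>_. std_gaussian \<beta>))"
      by (intro borel_measurable_add borel_measurable_sum) auto
    then show "(\<integral>\<^sup>+x. f x \<partial>distr (Pi\<^sub>M A (\<lambda>_. std_gaussian \<beta>)) borel (\<lambda>y. m + (\<Sum>j\<in>A. a j * Re (y j) + d j * Im (y j)))) =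
      (\<integral>\<^sup>+x. f x \<partial>distr std_normal_distribution borel (\<lambda>x. m + s * x))"
      using s[of "\<lambda>x. f (m + x)"] by (simp add: nn_integral_distr)
  qed simp
  then show ?thesis unfolding gaussian_law_def by blast
qed

subsection \<open>Moments of a Gaussian vector\<close>

lemma nn_integral_norm_square_std_gaussian:
  assumes \<beta>: "\<beta> \<in> {1, 2}"
  shows "(\<integral>\<^sup>+z. ennreal ((cmod z)\<^sup>2) \<partial>std_gaussian \<beta>) = 1"
proof -
  interpret N: prob_space std_normal_distribution by (rule prob_space_normal_density) simp
  interpret H: prob_space half_normal by (rule prob_space_normal_density) simp
  have 1: "(\<integral>\<^sup>+x. ennreal (x\<^sup>2) \<partial>std_normal_distribution) = 1"
  proof -
    have hb: "has_bochner_integral lborel (\<lambda>x. std_normal_density x * x ^ (2 * 1)) (fact (2 * 1) / (2 ^ 1 * fact 1))"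
      by (rule std_normal_moment_even)
    have "(\<integral>\<^sup>+x. ennreal (x\<^sup>2) \<partial>std_normal_distribution) = (\<integral>\<^sup>+x. ennreal (std_normal_density x * x\<^sup>2) \<partial>lborel)"
      by (subst nn_integral_density) (simp_all add: ennreal_mult)
    also have "\<dots> = ennreal (\<integral>x. std_normal_density x * x\<^sup>2 \<partial>lborel)"
      using hb by (intro nn_integral_eq_integral) (auto intro: integrable.intros)
    also have "\<dots> = 1" using hb by (simp add: has_bochner_integral_integral_eq fact_2)
    finally show ?thesis .
  qed
  show ?thesis
  proof (cases "\<beta> = 1")
    case True
    then show ?thesis by (simp add: nn_integral_std_gaussian_1[simplified] 1)
  next
    case False
    then have "\<beta> = 2" using \<beta> by simp
    have 2: "(\<integral>\<^sup>+x. ennreal (x\<^sup>2) \<partial>half_normal) = ennreal (1/2)"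
    proof -
      have "(\<integral>\<^sup>+x. ennreal (x\<^sup>2) \<partial>half_normal) = (\<integral>\<^sup>+x. ennreal ((sqrt (1/2) * x)\<^sup>2) \<partial>std_normal_distribution)"
        by (rule nn_integral_normal_scale) (simp, measurable)
      also have "\<dots> = (\<integral>\<^sup>+x. ennreal (1/2) * ennreal (x\<^sup>2) \<partial>std_normal_distribution)"
      proof (intro nn_integral_cong)
        fix x :: real
        show "ennreal ((sqrt (1/2) * x)\<^sup>2) = ennreal (1/2) * ennreal (x\<^sup>2)"
          by (subst ennreal_mult[symmetric]) (simp_all add: power_mult_distrib)
      qed
      also have "\<dots> = ennreal (1/2)" by (subst nn_integral_cmult) (simp_all add: 1)
      finally show ?thesis .
    qed
    have "(\<integral>\<^sup>+z. ennreal ((cmod z)\<^sup>2) \<partial>std_gaussian 2) = (\<integral>\<^sup>+x. \<integral>\<^sup>+y. ennreal (x\<^sup>2) + ennreal (y\<^sup>2) \<partial>half_normal \<partial>half_normal)"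
      by (subst nn_integral_std_gaussian_2) (simp_all add: cmod_power2 ennreal_plus)
    also have "\<dots> = (\<integral>\<^sup>+x. ennreal (x\<^sup>2) + ennreal (1/2) \<partial>half_normal)"
      using H.emeasure_space_1 by (intro nn_integral_cong, subst nn_integral_add) (simp_all only: 2, simp_all)
    also have "\<dots> = ennreal (1/2) + ennreal (1/2)"
      using H.emeasure_space_1 by (subst nn_integral_add) (simp_all only: 2, simp_all)
    also have "\<dots> = ennreal (1/2 + 1/2)" by (rule ennreal_plus[symmetric]) simp_all
    finally show ?thesis by (simp add: \<open>\<beta> = 2\<close>)
  qed
qed

lemma preserves_integral:
  fixes f :: "'a \<Rightarrow> 'b::{banach, second_countable_topology}"
  assumes "preserves P T" "f \<in> borel_measurable P"
  shows "(\<integral>x. f (T x) \<partial>P) = (\<integral>x. f x \<partial>P)"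
  using integral_distr[of T P P f] assms unfolding preserves_def by simp

lemma borel_measurable_cnj [measurable (raw)]:
  assumes "f \<in> borel_measurable M"
  shows "(\<lambda>x. cnj (f x)) \<in> borel_measurable M"
proof -
  have "cnj \<in> borel_measurable borel" by (intro borel_measurable_continuous_onI continuous_intros)
  from measurable_compose[OF assms this] show ?thesis .
qed

context
  fixes \<beta> :: nat and A :: "'i set" and Q :: "('i \<Rightarrow> complex) measure"
  assumes \<beta>: "\<beta> \<in> {1, 2}" and A: "finite A"
  defines "Q \<equiv> Pi\<^sub>M A (\<lambda>_. std_gaussian \<beta>)"
begin

lemma prob_space_gaussian_vector: "prob_space Q"
  unfolding Q_def by (rule prob_space_PiM) (rule prob_space_std_gaussian)

lemma measurable_gaussian_vector_coord: "i \<in> A \<Longrightarrow> (\<lambda>y. y i) \<in> borel_measurable Q"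
  unfolding Q_def by measurable

lemma nn_integral_gaussian_vector_coord_square: "i \<in> A \<Longrightarrow> (\<integral>\<^sup>+y. ennreal ((cmod (y i))\<^sup>2) \<partial>Q) = 1"
proof -
  assume i: "i \<in> A"
  have "(\<integral>\<^sup>+z. ennreal ((cmod z)\<^sup>2) \<partial>distr Q (std_gaussian \<beta>) (\<lambda>y. y i)) = (\<integral>\<^sup>+y. ennreal ((cmod (y i))\<^sup>2) \<partial>Q)"
    by (rule nn_integral_distr) (use i in \<open>auto simp: Q_def\<close>)
  moreover have "distr Q (std_gaussian \<beta>) (\<lambda>y. y i) = std_gaussian \<beta>"
    unfolding Q_def by (rule distr_PiM_component) (auto simp: i prob_space_std_gaussian)
  ultimately show ?thesis using nn_integral_norm_square_std_gaussian[OF \<beta>] by simp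
qed

lemma integrable_gaussian_vector_coord_square: "i \<in> A \<Longrightarrow> integrable Q (\<lambda>y. (cmod (y i))\<^sup>2)"
  using measurable_gaussian_vector_coord nn_integral_gaussian_vector_coord_square
  by (intro integrableI_nonneg) (auto intro!: borel_measurable_power borel_measurable_norm)

lemma integral_gaussian_vector_coord_square: "i \<in> A \<Longrightarrow> (\<integral>y. (cmod (y i))\<^sup>2 \<partial>Q) = 1"
  using measurable_gaussian_vector_coord nn_integral_gaussian_vector_coord_square
  by (subst integral_eq_nn_integral) (auto intro!: borel_measurable_power borel_measurable_norm)

lemma integrable_gaussian_vector_coord: "i \<in> A \<Longrightarrow> integrable Q (\<lambda>y. y i)"
proof -
  assume i: "i \<in> A"
  interpret prob_space Q by (rule prob_space_gaussian_vector)
  have "integrable Q (\<lambda>y. 1 + (cmod (y i))\<^sup>2)" using integrable_gaussian_vector_coord_square[OF i] by simp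
  then show ?thesis
  proof (rule Bochner_Integration.integrable_bound)
    have "t \<le> 1 + t\<^sup>2" if "0 \<le> t" for t :: real
    proof (cases "t \<le> 1")
      case False
      then have "t * 1 \<le> t * t" by (intro mult_left_mono) auto
      then show ?thesis by (simp add: power2_eq_square)
    qed (simp add: add_increasing2)
    then show "AE y in Q. norm (y i) \<le> norm (1 + (cmod (y i))\<^sup>2)" by auto
  qed (rule measurable_gaussian_vector_coord[OF i])
qed

text \<open>Serves plain and conjugated products alike, since they have the same modulus; the
  dominating function is the sum of the two squares.\<close>

lemma integrable_gaussian_vector_bounded_mult:
  assumes "i \<in> A" "j \<in> A" "f \<in> borel_measurable Q" "\<And>y. cmod (f y) \<le> cmod (y i) * cmod (y j)"
  shows "integrable Q f"
proof (rule Bochner_Integration.integrable_bound)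
  show "integrable Q (\<lambda>y. (cmod (y i))\<^sup>2 + (cmod (y j))\<^sup>2)" using integrable_gaussian_vector_coord_square assms(1,2) by simp
  have "s * t \<le> s\<^sup>2 + t\<^sup>2" if "0 \<le> s" "0 \<le> t" for s t :: real
    using sum_squares_bound[of s t] mult_nonneg_nonneg[OF that] by (simp only: mult.assoc)
  then have "cmod (f y) \<le> (cmod (y i))\<^sup>2 + (cmod (y j))\<^sup>2" for y
    using assms(4) order_trans norm_ge_zero by blast
  then show "AE y in Q. norm (f y) \<le> norm ((cmod (y i))\<^sup>2 + (cmod (y j))\<^sup>2)" by auto
qed fact

lemma integrable_gaussian_vector_mult: "i \<in> A \<Longrightarrow> j \<in> A \<Longrightarrow> integrable Q (\<lambda>y. y i * y j)"
  using measurable_gaussian_vector_coord by (intro integrable_gaussian_vector_bounded_mult[of i j]) (auto simp: norm_mult)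

lemma integrable_gaussian_vector_mult_cnj: "i \<in> A \<Longrightarrow> j \<in> A \<Longrightarrow> integrable Q (\<lambda>y. y i * cnj (y j))"
  using measurable_gaussian_vector_coord
  by (intro integrable_gaussian_vector_bounded_mult[of i j] borel_measurable_times borel_measurable_cnj) (auto simp: norm_mult)

lemma preserves_gaussian_vector_phase:
  "i \<in> A \<Longrightarrow> cmod u = 1 \<Longrightarrow> (\<beta> = 1 \<Longrightarrow> u \<in> \<real>) \<Longrightarrow> preserves Q (\<lambda>y. y(i := u * y i))"
  unfolding Q_def by (rule preserves_phase[OF complex_product_std_gaussian A _ refl \<beta>])

text \<open>Changing the sign of one coordinate is a phase allowed for both values of \<beta>, and
  it turns the integral into its negative. The mixed second moments vanish for the same
  reason.\<close>

lemma integral_gaussian_vector_coord: "i \<in> A \<Longrightarrow> (\<integral>y. y i \<partial>Q) = 0"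
  using preserves_integral[OF preserves_gaussian_vector_phase[of i "-1"], of "\<lambda>y. y i"] measurable_gaussian_vector_coord[of i] by simp

lemma integral_gaussian_vector_mult_neq: "i \<in> A \<Longrightarrow> j \<in> A \<Longrightarrow> i \<noteq> j \<Longrightarrow> (\<integral>y. y i * y j \<partial>Q) = 0"
  using preserves_integral[OF preserves_gaussian_vector_phase[of i "-1"], of "\<lambda>y. y i * y j"] measurable_gaussian_vector_coord by simp

lemma integral_gaussian_vector_mult_cnj:
  assumes "i \<in> A" "j \<in> A"
  shows "(\<integral>y. y i * cnj (y j) \<partial>Q) = (if i = j then 1 else 0)"
proof (cases "i = j")
  case True
  have "(\<integral>y. y i * cnj (y j) \<partial>Q) = (\<integral>y. complex_of_real ((cmod (y i))\<^sup>2) \<partial>Q)"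
    by (intro Bochner_Integration.integral_cong) (simp_all add: True flip: complex_norm_square)
  then show ?thesis
    unfolding integral_complex_of_real integral_gaussian_vector_coord_square[OF assms(1)] by (simp add: True)
next
  case False
  then show ?thesis
    using preserves_integral[OF preserves_gaussian_vector_phase[of i "-1"], of "\<lambda>y. y i * cnj (y j)"] measurable_gaussian_vector_coord assms
    by (simp add: borel_measurable_cnj)
qed

text \<open>The source of the case distinction in the covariance. For \<beta> = 1 a coordinate is
  almost surely real, so its square is its squared modulus. For \<beta> = 2 multiplying it by
  \<open>\<i>\<close> preserves the law and negates the square, whose mean is therefore 0.\<close>

lemma integral_gaussian_vector_mult:
  assumes i: "i \<in> A" and j: "j \<in> A"
  shows "(\<integral>y. y i * y j \<partial>Q) = (if i = j \<and> \<beta> = 1 then 1 else 0)"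
proof (cases "i = j")
  case True
  note [measurable] = measurable_gaussian_vector_coord[OF i]
  show ?thesis
  proof (cases "\<beta> = 1")
    case True
    have "AE z in std_gaussian \<beta>. z \<in> \<real>" by (metis True AE_std_gaussian_real)
    then have "AE y in Q. y i \<in> \<real>"
      unfolding Q_def by (intro AE_PiM_component) (auto simp: i prob_space_std_gaussian)
    then have "(\<integral>y. y i * y i \<partial>Q) = (\<integral>y. y i * cnj (y i) \<partial>Q)"
      by (intro integral_cong_AE) (auto simp: Reals_cnj_iff)
    then show ?thesis using integral_gaussian_vector_mult_cnj[OF i i] True \<open>i = j\<close> by simp
  next
    case False
    have "(\<integral>y. y i * y i \<partial>Q) = (\<integral>y. (\<i> * y i) * (\<i> * y i) \<partial>Q)"
      using preserves_integral[OF preserves_gaussian_vector_phase[of i \<i>], of "\<lambda>y. y i * y i"] i False by simp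
    also have "\<dots> = - (\<integral>y. y i * y i \<partial>Q)" by (simp add: algebra_simps)
    finally show ?thesis using False True by simp
  qed
qed (simp add: integral_gaussian_vector_mult_neq[OF assms])

end

subsection \<open>The conditional law of the next polynomial\<close>

text \<open>One step of the recursion in abstract form: a field that is affine in a Gaussian row
  \<open>Y\<close>, with coefficients known to \<open>F\<close>. Its conditional moments expand into
  the second moments \<open>y i * cnj (y j)\<close> and \<open>y i * y j\<close> of the row, where
  only i = j survives, and for the unconjugated product only if \<beta> = 1.\<close>

lemma conditional_gaussian_field:
  fixes c :: "'w \<Rightarrow> complex \<Rightarrow> complex" and x :: "'i \<Rightarrow> 'w \<Rightarrow> complex \<Rightarrow> complex" and b :: "'w \<Rightarrow> real"
  assumes M: "prob_space M" and \<beta>: "\<beta> \<in> {1, 2}" and A: "finite A"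
    and F: "subalgebra M F"
    and S: "S = Pi\<^sub>M A (\<lambda>_. borel)"
    and ind: "independent_of M F S Y"
    and law: "distr M S Y = Pi\<^sub>M A (\<lambda>_. std_gaussian \<beta>)"
    and x: "\<And>j z. j \<in> A \<Longrightarrow> (\<lambda>\<omega>. x j \<omega> z) \<in> borel_measurable F"
    and c [measurable]: "\<And>z. (\<lambda>\<omega>. c \<omega> z) \<in> borel_measurable F" and b [measurable]: "b \<in> borel_measurable F"
    and f: "\<And>\<omega> z. \<omega> \<in> space M \<Longrightarrow> f \<omega> z = (c \<omega> z - (\<Sum>j\<in>A. Y \<omega> j * x j \<omega> z)) / complex_of_real (b \<omega>)"
    and m: "\<And>\<omega> z. \<omega> \<in> space M \<Longrightarrow> m \<omega> z = c \<omega> z / complex_of_real (b \<omega>)"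
  shows "\<exists>\<kappa>. regular_cond_distr M F field_space f \<kappa> \<and> (\<forall>\<omega>\<in>space M. jointly_gaussian_field (\<kappa> \<omega>))" (is ?regular)
    and "AE \<omega> in M. complex_cond_exp M F (\<lambda>\<omega>. f \<omega> z) \<omega> = m \<omega> z" (is ?mean)
    and "AE \<omega> in M. complex_cond_exp M F (\<lambda>\<omega>. (f \<omega> z - m \<omega> z) * cnj (f \<omega> w - m \<omega> w)) \<omega> =
           1 / complex_of_real (b \<omega>) ^ 2 * (\<Sum>j\<in>A. x j \<omega> z * cnj (x j \<omega> w))" (is ?cov)
    and "AE \<omega> in M. complex_cond_exp M F (\<lambda>\<omega>. (f \<omega> z - m \<omega> z) * (f \<omega> w - m \<omega> w)) \<omega> =
           (if \<beta> = 1 then 1 / complex_of_real (b \<omega>) ^ 2 * (\<Sum>j\<in>A. x j \<omega> z * x j \<omega> w) else 0)" (is ?pcov)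
proof -
  interpret prob_space M by (rule M)
  define Q where "Q = Pi\<^sub>M A (\<lambda>_. std_gaussian \<beta>)"
  note law' = law[folded Q_def]
  interpret Q: prob_space Q unfolding Q_def by (rule prob_space_gaussian_vector[OF \<beta> A])
  note Qint = integrable_gaussian_vector_coord[OF \<beta> A, folded Q_def] integrable_gaussian_vector_mult[OF \<beta> A, folded Q_def]
    integrable_gaussian_vector_mult_cnj[OF \<beta> A, folded Q_def]
  note Qval = integral_gaussian_vector_coord[OF \<beta> A, folded Q_def] integral_gaussian_vector_mult[OF \<beta> A, folded Q_def]
    integral_gaussian_vector_mult_cnj[OF \<beta> A, folded Q_def]
  have sF: "space F = space M" using F by (simp add: subalgebra_def)
  have sQ: "sets Q = sets S" unfolding Q_def S by (intro sets_PiM_cong) auto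
  have spQ: "space Q = space S" by (rule sets_eq_imp_space_eq[OF sQ])
  have Y: "Y \<in> M \<rightarrow>\<^sub>M S" using ind by (simp add: independent_of_def)
  define T where "T \<omega> y z = (\<Sum>j\<in>A. y j * x j \<omega> z)" for \<omega> y z
  define \<Xi> where "\<Xi> \<omega> y z = (c \<omega> z - T \<omega> y z) / complex_of_real (b \<omega>)" for \<omega> y z
  have f\<Xi>: "f \<omega> z = \<Xi> \<omega> (Y \<omega>) z" if "\<omega> \<in> space M" for \<omega> z
    using f[OF that] by (simp add: \<Xi>_def T_def)
  have T_meas [measurable]: "(\<lambda>p. T (fst p) (snd p) z) \<in> borel_measurable (F \<Otimes>\<^sub>M S)" for z
    unfolding T_def
  proof (intro borel_measurable_sum borel_measurable_times)
    fix j assume j: "j \<in> A"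
    show "(\<lambda>p. snd p j) \<in> borel_measurable (F \<Otimes>\<^sub>M S)" unfolding S using j by measurable
    show "(\<lambda>p. x j (fst p) z) \<in> borel_measurable (F \<Otimes>\<^sub>M S)"
      by (rule measurable_compose[OF measurable_fst x[OF j]])
  qed
  have \<Xi>_meas [measurable]: "(\<lambda>p. \<Xi> (fst p) (snd p) z) \<in> borel_measurable (F \<Otimes>\<^sub>M S)" for z
    unfolding \<Xi>_def by measurable
  have T_int: "integrable Q (\<lambda>y. T \<omega> y z)" for \<omega> z
    unfolding T_def by (intro Bochner_Integration.integrable_sum integrable_mult_left Qint)
  have T_0: "(\<integral>y. T \<omega> y z \<partial>Q) = 0" for \<omega> z
    unfolding T_def using Qint by (subst Bochner_Integration.integral_sum) (simp_all add: Qval)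
  show ?mean
  proof -
    have "AE \<omega> in M. complex_cond_exp M F (\<lambda>\<omega>. f \<omega> z) \<omega> = (\<integral>y. (\<lambda>p. \<Xi> (fst p) (snd p) z) (\<omega>, y) \<partial>distr M S Y)"
      by (rule complex_cond_exp_freeze[OF F ind])
        (use T_int in \<open>auto simp: f\<Xi> law' \<Xi>_def[abs_def]\<close>)
    note 1 = this
    have 2: "(\<integral>y. \<Xi> \<omega> y z \<partial>Q) = c \<omega> z / complex_of_real (b \<omega>)" for \<omega>
      unfolding \<Xi>_def using T_int by (simp add: T_0 Q.prob_space)
    have "AE \<omega> in M. \<omega> \<in> space M" by simp
    with 1 show ?thesis by eventually_elim (simp add: law' m 2)
  qed
  have diff: "f \<omega> z - m \<omega> z = - T \<omega> (Y \<omega>) z / complex_of_real (b \<omega>)" if "\<omega> \<in> space M" for \<omega> z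
    using m[OF that] f[OF that] by (simp add: T_def diff_divide_distrib)
  show ?cov
  proof -
    define h where "h p = T (fst p) (snd p) z * cnj (T (fst p) (snd p) w) / complex_of_real (b (fst p)) ^ 2" for p
    have h_sum: "h (\<omega>, y) = (\<Sum>i\<in>A. \<Sum>j\<in>A. y i * cnj (y j) * (x i \<omega> z * cnj (x j \<omega> w))) / complex_of_real (b \<omega>) ^ 2" for \<omega> y
      unfolding h_def T_def fst_conv snd_conv cnj_sum sum_product by (simp add: mult_ac)
    have h_int: "integrable Q (\<lambda>y. h (\<omega>, y))" for \<omega>
      unfolding h_sum by (intro integrable_divide_zero Bochner_Integration.integrable_sum integrable_mult_left Qint) auto
    have "AE \<omega> in M. complex_cond_exp M F (\<lambda>\<omega>. (f \<omega> z - m \<omega> z) * cnj (f \<omega> w - m \<omega> w)) \<omega> = (\<integral>y. h (\<omega>, y) \<partial>distr M S Y)"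
    proof (rule complex_cond_exp_freeze[OF F ind])
      show "h \<in> borel_measurable (F \<Otimes>\<^sub>M S)" unfolding h_def by measurable
      show "integrable (distr M S Y) (\<lambda>y. h (\<omega>, y))" for \<omega> unfolding law' by (rule h_int)
    qed (simp add: diff h_def power2_eq_square)
    moreover have "(\<integral>y. h (\<omega>, y) \<partial>Q) = 1 / complex_of_real (b \<omega>) ^ 2 * (\<Sum>j\<in>A. x j \<omega> z * cnj (x j \<omega> w))" for \<omega>
    proof -
      have "(\<integral>y. h (\<omega>, y) \<partial>Q) = (\<Sum>i\<in>A. \<Sum>j\<in>A. (\<integral>y. y i * cnj (y j) \<partial>Q) * (x i \<omega> z * cnj (x j \<omega> w))) / complex_of_real (b \<omega>) ^ 2"
        unfolding h_sum using Qint
        by (simp add: Bochner_Integration.integral_sum Bochner_Integration.integrable_sum)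
      also have "(\<Sum>i\<in>A. \<Sum>j\<in>A. (\<integral>y. y i * cnj (y j) \<partial>Q) * (x i \<omega> z * cnj (x j \<omega> w))) = (\<Sum>i\<in>A. \<Sum>j\<in>A. if i = j then x i \<omega> z * cnj (x j \<omega> w) else 0)"
        by (intro sum.cong refl) (simp add: Qval)
      also have "\<dots> = (\<Sum>j\<in>A. x j \<omega> z * cnj (x j \<omega> w))" using A by simp
      finally show ?thesis by simp
    qed
    ultimately show ?thesis by (simp add: law')
  qed
  show ?pcov
  proof -
    define h where "h p = T (fst p) (snd p) z * T (fst p) (snd p) w / complex_of_real (b (fst p)) ^ 2" for p
    have h_sum: "h (\<omega>, y) = (\<Sum>i\<in>A. \<Sum>j\<in>A. y i * y j * (x i \<omega> z * x j \<omega> w)) / complex_of_real (b \<omega>) ^ 2" for \<omega> y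
      unfolding h_def T_def fst_conv snd_conv cnj_sum sum_product by (simp add: mult_ac)
    have h_int: "integrable Q (\<lambda>y. h (\<omega>, y))" for \<omega>
      unfolding h_sum by (intro integrable_divide_zero Bochner_Integration.integrable_sum integrable_mult_left Qint) auto
    have "AE \<omega> in M. complex_cond_exp M F (\<lambda>\<omega>. (f \<omega> z - m \<omega> z) * (f \<omega> w - m \<omega> w)) \<omega> = (\<integral>y. h (\<omega>, y) \<partial>distr M S Y)"
    proof (rule complex_cond_exp_freeze[OF F ind])
      show "h \<in> borel_measurable (F \<Otimes>\<^sub>M S)" unfolding h_def by measurable
      show "integrable (distr M S Y) (\<lambda>y. h (\<omega>, y))" for \<omega> unfolding law' by (rule h_int)
    qed (simp add: diff h_def power2_eq_square)
    moreover have "(\<integral>y. h (\<omega>, y) \<partial>Q) = (if \<beta> = 1 then 1 / complex_of_real (b \<omega>) ^ 2 * (\<Sum>j\<in>A. x j \<omega> z * x j \<omega> w) else 0)" for \<omega>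
    proof -
      have "(\<integral>y. h (\<omega>, y) \<partial>Q) = (\<Sum>i\<in>A. \<Sum>j\<in>A. (\<integral>y. y i * y j \<partial>Q) * (x i \<omega> z * x j \<omega> w)) / complex_of_real (b \<omega>) ^ 2"
        unfolding h_sum using Qint
        by (simp add: Bochner_Integration.integral_sum Bochner_Integration.integrable_sum)
      also have "(\<Sum>i\<in>A. \<Sum>j\<in>A. (\<integral>y. y i * y j \<partial>Q) * (x i \<omega> z * x j \<omega> w)) = (\<Sum>i\<in>A. \<Sum>j\<in>A. if i = j then if \<beta> = 1 then x i \<omega> z * x j \<omega> w else 0 else 0)"
        by (intro sum.cong refl) (simp add: Qval)
      also have "\<dots> = (\<Sum>j\<in>A. if \<beta> = 1 then x j \<omega> z * x j \<omega> w else 0)" using A by simp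
      finally show ?thesis by simp
    qed
    ultimately show ?thesis by (simp add: law')
  qed
  show ?regular
  proof (intro exI conjI)
    \<comment> \<open>The candidate for the conditional law: the fixed law of the row, transported
      by the field with the past frozen.\<close>
    define \<kappa> where "\<kappa> \<omega> = distr Q field_space (\<Xi> \<omega>)" for \<omega>
    \<comment> \<open>The index set of the product is uncountable, but its \<sigma>-algebra is
      generated by coordinates, so measurability at each single z suffices.\<close>
    have \<Xi>_field: "(\<lambda>(\<omega>, y). \<Xi> \<omega> y) \<in> F \<Otimes>\<^sub>M S \<rightarrow>\<^sub>M field_space"
      unfolding field_space_def using \<Xi>_meas
      by (intro measurable_PiM_single') (auto simp: case_prod_beta' space_PiM)
    have \<Xi>_fix: "\<Xi> \<omega> \<in> Q \<rightarrow>\<^sub>M field_space" if "\<omega> \<in> space M" for \<omega>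
    proof -
      have "(\<lambda>y. (\<omega>, y)) \<in> Q \<rightarrow>\<^sub>M F \<Otimes>\<^sub>M S"
        using that measurable_Pair1'[of \<omega> F S] by (simp add: sF sQ cong: measurable_cong_sets)
      from measurable_compose[OF this \<Xi>_field] show ?thesis by simp
    qed
    show "regular_cond_distr M F field_space f \<kappa>"
      unfolding regular_cond_distr_def
    proof (intro conjI ballI)
      have "(\<lambda>\<omega>. (\<omega>, Y \<omega>)) \<in> M \<rightarrow>\<^sub>M F \<Otimes>\<^sub>M S"
        using Y by (intro measurable_Pair measurable_to_subalgebra[OF F])
      from measurable_compose[OF this \<Xi>_field]
      have "(\<lambda>\<omega>. \<Xi> \<omega> (Y \<omega>)) \<in> M \<rightarrow>\<^sub>M field_space" by simp
      then show fm: "f \<in> M \<rightarrow>\<^sub>M field_space"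
        by (subst measurable_cong[where g = "\<lambda>\<omega>. \<Xi> \<omega> (Y \<omega>)"]) (auto simp: f\<Xi>)
      have "Q \<in> space (prob_algebra S)" by (simp add: space_prob_algebra sQ Q.prob_space_axioms)
      then show "\<kappa> \<in> F \<rightarrow>\<^sub>M prob_algebra field_space"
        unfolding \<kappa>_def by (intro measurable_distr_prob_space2[OF measurable_const \<Xi>_field])
      fix B assume B [measurable]: "B \<in> sets field_space"
      have "AE \<omega> in M. real_cond_exp M F (\<lambda>\<omega>. indicator B (f \<omega>)) \<omega> =
          (\<integral>y. (\<lambda>(\<omega>, y). indicator B (\<Xi> \<omega> y)) (\<omega>, y) \<partial>distr M S Y)"
      proof (rule real_cond_exp_freeze[OF F ind])
        show "(\<lambda>(\<omega>, y). indicator B (\<Xi> \<omega> y) :: real) \<in> borel_measurable (F \<Otimes>\<^sub>M S)"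
          using measurable_compose[OF \<Xi>_field borel_measurable_indicator[OF B]] by (simp add: case_prod_beta')
        fix \<omega> assume \<omega>: "\<omega> \<in> space M"
        have "f \<omega> = \<Xi> \<omega> (Y \<omega>)" using f\<Xi>[OF \<omega>] by (intro ext)
        then show "indicator B (f \<omega>) = (\<lambda>(\<omega>, y). (indicator B (\<Xi> \<omega> y) :: real)) (\<omega>, Y \<omega>)"
          by simp
        show "integrable (distr M S Y) (\<lambda>y. (\<lambda>(\<omega>, y). (indicator B (\<Xi> \<omega> y) :: real)) (\<omega>, y))"
          unfolding law' prod.case
          by (rule Q.integrable_const_bound[of _ 1]) (use measurable_compose[OF \<Xi>_fix[OF \<omega>] borel_measurable_indicator[OF B]] in auto)
      qed
      moreover have "AE \<omega> in M. \<omega> \<in> space M" by simp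
      ultimately show "AE \<omega> in M. real_cond_exp M F (\<lambda>\<omega>. indicator B (f \<omega>)) \<omega> = measure (\<kappa> \<omega>) B"
      proof eventually_elim
        case (elim \<omega>)
        have "measure (\<kappa> \<omega>) B = (\<integral>u. indicator B u \<partial>\<kappa> \<omega>)"
          using B by (simp add: \<kappa>_def)
        also have "\<dots> = (\<integral>y. indicator B (\<Xi> \<omega> y) \<partial>Q)"
          unfolding \<kappa>_def by (rule integral_distr[OF \<Xi>_fix[OF elim(2)]]) measurable
        finally show ?case using elim(1) by (simp add: law')
      qed
    qed
    show "\<forall>\<omega>\<in>space M. jointly_gaussian_field (\<kappa> \<omega>)"
      unfolding jointly_gaussian_field_def
    proof (intro ballI allI impI)
      fix \<omega> \<Lambda> s t assume \<omega>: "\<omega> \<in> space M" and "finite (\<Lambda> :: complex set)"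
      define L where "L g = (\<Sum>z\<in>\<Lambda>. s z * Re (g z) + t z * Im (g z))" for g :: "complex \<Rightarrow> complex"
      define u where "u j z = x j \<omega> z / complex_of_real (b \<omega>)" for j z
      \<comment> \<open>\<open>L\<close> is linear over the reals only, so a complex factor acts by
        \<open>L (v g) = Re v * L g + Im v * L (\<i> g)\<close>. Hence \<open>a j\<close> and
        \<open>d j\<close> are the coefficients of \<open>Re (y j)\<close> and
        \<open>Im (y j)\<close>; the minus signs come from the row sum being subtracted in the
        recursion.\<close>
      define a where "a j = - L (u j)" for j
      define d where "d j = - L (\<lambda>z. \<i> * u j z)" for j
      have L_meas: "L \<in> borel_measurable field_space"
        unfolding L_def field_space_def by measurable
      have L_diff: "L (\<lambda>z. g z - h z) = L g - L h" for g h
        unfolding L_def by (simp add: sum_subtractf[symmetric] algebra_simps)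
      have L_sum: "L (\<lambda>z. \<Sum>j\<in>A. g j z) = (\<Sum>j\<in>A. L (g j))" for g
        unfolding L_def by (subst sum.swap) (simp add: sum_distrib_left sum.distrib)
      have L_mult: "L (\<lambda>z. v * g z) = Re v * L g + Im v * L (\<lambda>z. \<i> * g z)" for v g
        unfolding L_def by (simp add: sum_distrib_left sum.distrib[symmetric] algebra_simps)
      have "L (\<Xi> \<omega> y) = L (\<lambda>z. c \<omega> z / complex_of_real (b \<omega>)) + (\<Sum>j\<in>A. a j * Re (y j) + d j * Im (y j))" for y
      proof -
        have "\<Xi> \<omega> y = (\<lambda>z. c \<omega> z / complex_of_real (b \<omega>) - (\<Sum>j\<in>A. y j * u j z))"
          by (simp add: fun_eq_iff \<Xi>_def T_def u_def diff_divide_distrib sum_divide_distrib)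
        then have "L (\<Xi> \<omega> y) = L (\<lambda>z. c \<omega> z / complex_of_real (b \<omega>)) - (\<Sum>j\<in>A. L (\<lambda>z. y j * u j z))"
          by (simp add: L_diff L_sum)
        moreover have "- (\<Sum>j\<in>A. L (\<lambda>z. y j * u j z)) = (\<Sum>j\<in>A. a j * Re (y j) + d j * Im (y j))"
          unfolding sum_negf[symmetric] by (intro sum.cong refl) (subst L_mult, simp add: a_def d_def mult.commute)
        ultimately show ?thesis by simp
      qed
      then have "distr (\<kappa> \<omega>) borel L = distr Q borel (\<lambda>y. L (\<lambda>z. c \<omega> z / complex_of_real (b \<omega>)) + (\<Sum>j\<in>A. a j * Re (y j) + d j * Im (y j)))"
        unfolding \<kappa>_def by (subst distr_distr[OF L_meas \<Xi>_fix[OF \<omega>]]) (simp add: comp_def)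
      then show "gaussian_law (distr (\<kappa> \<omega>) borel (\<lambda>x. \<Sum>z\<in>\<Lambda>. s z * Re (x z) + t z * Im (x z)))"
        unfolding L_def[abs_def, symmetric] Q_def using gaussian_law_affine[OF \<beta> A] by simp
    qed
  qed
qed

section \<open>Row k is independent of the \<sigma>-field of the past\<close>

lemma (in prob_space) independent_ofI:
  assumes F: "subalgebra M F" and Y: "Y \<in> M \<rightarrow>\<^sub>M S"
    and ind: "\<And>A B. A \<in> sets F \<Longrightarrow> B \<in> sets S \<Longrightarrow>
      prob (A \<inter> (Y -` B \<inter> space M)) = prob A * prob (Y -` B \<inter> space M)"
  shows "independent_of M F S Y"
  unfolding independent_of_def
proof (intro conjI pair_measure_eqI)
  have id: "(\<lambda>\<omega>. \<omega>) \<in> M \<rightarrow>\<^sub>M F" by (rule measurable_to_subalgebra[OF F])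
  show "sigma_finite_measure (distr M F (\<lambda>\<omega>. \<omega>))" "sigma_finite_measure (distr M S Y)"
    by (intro prob_space_imp_sigma_finite prob_space_distr id Y)+
  fix A B assume "A \<in> sets (distr M F (\<lambda>\<omega>. \<omega>))" "B \<in> sets (distr M S Y)"
  then have A: "A \<in> sets F" and B: "B \<in> sets S" by simp_all
  have AM: "A \<in> sets M" using A F by (auto simp: subalgebra_def)
  then have AM': "(\<lambda>\<omega>. \<omega>) -` A \<inter> space M = A" using sets.sets_into_space by blast
  have pre: "(\<lambda>\<omega>. (\<omega>, Y \<omega>)) -` (A \<times> B) \<inter> space M = A \<inter> (Y -` B \<inter> space M)"
    using sets.sets_into_space[OF AM] by auto
  have "(\<lambda>\<omega>. (\<omega>, Y \<omega>)) \<in> M \<rightarrow>\<^sub>M F \<Otimes>\<^sub>M S" using id Y by (intro measurable_Pair)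
  then show "emeasure (distr M F (\<lambda>\<omega>. \<omega>)) A * emeasure (distr M S Y) B =
    emeasure (distr M (F \<Otimes>\<^sub>M S) (\<lambda>\<omega>. (\<omega>, Y \<omega>))) (A \<times> B)"
    using A B id Y by (simp add: emeasure_distr AM' Int_absorb2[OF sets.sets_into_space[OF AM]] pre emeasure_eq_measure ind flip: ennreal_mult)
qed (simp_all add: Y)

lemma sets_row_filtration:
  "sets (row_filtration M N b k) = sigma_sets (space M)
     ({N i j -` A \<inter> space M | i j A. 1 \<le> j \<and> j \<le> i \<and> i < k \<and> A \<in> sets borel} \<union>
      {b i -` A \<inter> space M | i A. 1 \<le> i \<and> i \<le> k \<and> A \<in> sets borel})"
  unfolding row_filtration_def by (rule sets_measure_of) auto

lemma space_row_filtration: "space (row_filtration M N b k) = space M"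
  unfolding row_filtration_def by (rule space_measure_of) auto

lemma measurable_row_filtration:
  "1 \<le> j \<Longrightarrow> j \<le> i \<Longrightarrow> i < k \<Longrightarrow> N i j \<in> borel_measurable (row_filtration M N b k)"
  "1 \<le> i \<Longrightarrow> i \<le> k \<Longrightarrow> b i \<in> borel_measurable (row_filtration M N b k)"
  by (rule measurableI; force simp: sets_row_filtration space_row_filtration intro!: sigma_sets.Basic)+

text \<open>The variables behind the \<sigma>-field and those of row k have disjoint index sets. The
  events of a single variable are stable under intersection, so independence passes from the
  individual families to the \<sigma>-algebras generated by the two groups.\<close>

lemma row_filtration_independent:
  fixes N :: "nat \<Rightarrow> nat \<Rightarrow> 'w \<Rightarrow> complex" and b :: "nat \<Rightarrow> 'w \<Rightarrow> real"
  assumes M: "prob_space M"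
    and indep: "prob_space.indep_vars M (\<lambda>_. borel)
           (case_sum (\<lambda>(k, j). N k j) (\<lambda>k \<omega>. complex_of_real (b k \<omega>)))
           ((SIGMA k:{1..}. {1..k}) <+> {1..})"
    and k: "1 \<le> k"
  shows "subalgebra M (row_filtration M N b k)"
    and "independent_of M (row_filtration M N b k) (Pi\<^sub>M {1..k} (\<lambda>_. borel)) (\<lambda>\<omega>. \<lambda>j\<in>{1..k}. N k j \<omega>)"
proof -
  interpret prob_space M by (rule M)
  define Z where "Z = case_sum (\<lambda>(k, j). N k j) (\<lambda>k \<omega>. complex_of_real (b k \<omega>))"
  define I :: "((nat \<times> nat) + nat) set" where "I = (SIGMA k:{1..}. {1..k}) <+> {1..}"
  define E where "E i = {Z i -` A \<inter> space M | A. A \<in> sets borel}" for i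
  \<comment> \<open>\<open>b k\<close> belongs to the past although it sits in row k of the matrix;
    only the Gaussian entries of that row are averaged.\<close>
  define past where "past = Inl ` {(i, j). 1 \<le> j \<and> j \<le> i \<and> i < k} \<union> Inr ` {1..k}"
  define row where "row = (\<lambda>j. Inl (k, j) :: (nat \<times> nat) + nat) ` {1..k}"
  define G where "G J = sigma_sets (space M) (\<Union>i\<in>J. E i)" for J
  have sub: "past \<subseteq> I" "row \<subseteq> I" using k by (auto simp: past_def row_def I_def)
  have Zm: "Z i \<in> borel_measurable M" if "i \<in> I" for i
    using indep that unfolding indep_vars_def Z_def I_def by blast
  have EM: "E i \<subseteq> events" if "i \<in> I" for i
    using Zm[OF that] by (auto simp: E_def dest: measurable_sets)
  have E: "indep_sets E I"
    using indep unfolding indep_vars_def2 E_def Z_def I_def by simp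
  have "indep_sets (\<lambda>t. G (case_bool past row t)) UNIV"
    unfolding G_def
  proof (rule indep_sets_collect_sigma)
    show "indep_sets E (\<Union>t\<in>UNIV. case_bool past row t)"
      using sub by (intro indep_sets_mono_index[OF _ E]) (auto split: bool.splits)
    show "Int_stable (E i)" for i
    proof (rule Int_stableI)
      fix a a' assume "a \<in> E i" "a' \<in> E i"
      then obtain A A' where "a = Z i -` A \<inter> space M" "a' = Z i -` A' \<inter> space M" "A \<in> sets borel" "A' \<in> sets borel"
        by (auto simp: E_def)
      then show "a \<inter> a' \<in> E i" unfolding E_def by (auto intro!: exI[of _ "A \<inter> A'"])
    qed
    show "disjoint_family_on (case_bool past row) UNIV"
      by (auto simp: disjoint_family_on_def past_def row_def split: bool.splits)
  qed
  moreover have "(\<lambda>t. G (case_bool past row t)) = case_bool (G past) (G row)"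
    by (auto simp: fun_eq_iff split: bool.splits)
  ultimately have "indep_set (G past) (G row)" by (simp add: indep_set_def)
  then have GM: "G past \<subseteq> events" and prod: "\<And>a c. a \<in> G past \<Longrightarrow> c \<in> G row \<Longrightarrow> prob (a \<inter> c) = prob a * prob c"
    unfolding indep_sets2_eq by auto
  have F_past: "sets (row_filtration M N b k) \<subseteq> G past"
    unfolding sets_row_filtration G_def
  proof (rule sigma_sets_mono, safe)
    fix i j A assume "1 \<le> j" "j \<le> i" "i < k" "A \<in> sets (borel :: complex measure)"
    then have "Inl (i, j) \<in> past" and "N i j -` A \<inter> space M \<in> E (Inl (i, j))" by (auto simp: past_def E_def Z_def)
    then show "N i j -` A \<inter> space M \<in> sigma_sets (space M) (\<Union>i\<in>past. E i)" by (intro sigma_sets.Basic UN_I)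
  next
    fix i A assume i: "1 \<le> i" "i \<le> k" and A: "A \<in> sets (borel :: real measure)"
    \<comment> \<open>The real \<open>b i\<close> enters the independent family as a complex number,
      so its events are rewritten as preimages under \<open>Re\<close>.\<close>
    have "Re -` A \<in> sets borel" using measurable_sets[OF borel_measurable_Re A] by simp
    moreover have "b i -` A \<inter> space M = Z (Inr i) -` (Re -` A) \<inter> space M" by (auto simp: Z_def)
    ultimately have "Inr i \<in> past" "b i -` A \<inter> space M \<in> E (Inr i)" using i by (auto simp: past_def E_def)
    then show "b i -` A \<inter> space M \<in> sigma_sets (space M) (\<Union>i\<in>past. E i)" by (intro sigma_sets.Basic UN_I)
  qed
  show F: "subalgebra M (row_filtration M N b k)"
    using F_past GM by (auto simp: subalgebra_def space_row_filtration)
  have sG: "sets (sigma (space M) (\<Union>i\<in>row. E i)) = G row"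
    unfolding G_def by (rule sets_measure_of) (auto simp: E_def)
  have spG: "space (sigma (space M) (\<Union>i\<in>row. E i)) = space M"
    by (rule space_measure_of) (auto simp: E_def)
  have "N k j \<in> borel_measurable (sigma (space M) (\<Union>i\<in>row. E i))" if "j \<in> {1..k}" for j
  proof (rule measurableI)
    fix A assume "A \<in> sets (borel :: complex measure)"
    then have "N k j -` A \<inter> space M \<in> E (Inl (k, j))" by (auto simp: E_def Z_def)
    then show "N k j -` A \<inter> space (sigma (space M) (\<Union>i\<in>row. E i)) \<in> sets (sigma (space M) (\<Union>i\<in>row. E i))"
      unfolding sG spG G_def using that by (intro sigma_sets.Basic UN_I[of "Inl (k, j)"]) (auto simp: row_def)
  qed simp
  then have Y_row: "(\<lambda>\<omega>. \<lambda>j\<in>{1..k}. N k j \<omega>) \<in> sigma (space M) (\<Union>i\<in>row. E i) \<rightarrow>\<^sub>M Pi\<^sub>M {1..k} (\<lambda>_. borel)"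
    by (rule measurable_restrict)
  have "N k j \<in> borel_measurable M" if "j \<in> {1..k}" for j
  proof -
    have "Inl (k, j) \<in> I" unfolding I_def using that k by (intro InlI) auto
    from Zm[OF this] show ?thesis by (simp add: Z_def)
  qed
  then have Y: "(\<lambda>\<omega>. \<lambda>j\<in>{1..k}. N k j \<omega>) \<in> M \<rightarrow>\<^sub>M Pi\<^sub>M {1..k} (\<lambda>_. borel)"
    by (rule measurable_restrict)
  show "independent_of M (row_filtration M N b k) (Pi\<^sub>M {1..k} (\<lambda>_. borel)) (\<lambda>\<omega>. \<lambda>j\<in>{1..k}. N k j \<omega>)"
  proof (rule independent_ofI[OF F Y])
    fix A B assume "A \<in> sets (row_filtration M N b k)" and B: "B \<in> sets (Pi\<^sub>M {1..k} (\<lambda>_. borel :: complex measure))"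
    then have "A \<in> G past" using F_past by blast
    moreover have "(\<lambda>\<omega>. \<lambda>j\<in>{1..k}. N k j \<omega>) -` B \<inter> space M \<in> G row"
      using measurable_sets[OF Y_row B] by (simp add: sG spG)
    ultimately show "prob (A \<inter> ((\<lambda>\<omega>. \<lambda>j\<in>{1..k}. N k j \<omega>) -` B \<inter> space M)) =
      prob A * prob ((\<lambda>\<omega>. \<lambda>j\<in>{1..k}. N k j \<omega>) -` B \<inter> space M)"
      by (rule prod)
  qed
qed

lemma row_law:
  fixes N :: "nat \<Rightarrow> nat \<Rightarrow> 'w \<Rightarrow> complex" and b :: "nat \<Rightarrow> 'w \<Rightarrow> real"
  assumes M: "prob_space M"
    and indep: "prob_space.indep_vars M (\<lambda>_. borel)
           (case_sum (\<lambda>(k, j). N k j) (\<lambda>k \<omega>. complex_of_real (b k \<omega>)))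
           ((SIGMA k:{1..}. {1..k}) <+> {1..})"
    and N: "\<And>k j. 1 \<le> j \<Longrightarrow> j \<le> k \<Longrightarrow> distr M borel (N k j) = std_gaussian \<beta>"
    and k: "1 \<le> k"
  shows "distr M (Pi\<^sub>M {1..k} (\<lambda>_. borel)) (\<lambda>\<omega>. \<lambda>j\<in>{1..k}. N k j \<omega>) = Pi\<^sub>M {1..k} (\<lambda>_. std_gaussian \<beta>)"
proof -
  interpret prob_space M by (rule M)
  have "indep_vars (\<lambda>_. borel) (\<lambda>j. case_sum (\<lambda>(k, j). N k j) (\<lambda>k \<omega>. complex_of_real (b k \<omega>)) (Inl (k, j))) {1..k}"
    using k by (intro indep_vars_reindex[OF indep]) (auto simp: inj_on_def)
  then have ind: "indep_vars (\<lambda>_. borel) (\<lambda>j. N k j) {1..k}" by simp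
  then have "distr M (Pi\<^sub>M {1..k} (\<lambda>_. borel)) (\<lambda>\<omega>. \<lambda>j\<in>{1..k}. N k j \<omega>) = Pi\<^sub>M {1..k} (\<lambda>j. distr M borel (N k j))"
    using k by (subst indep_vars_iff_distr_eq_PiM'[symmetric]) (auto simp: indep_vars_def)
  also have "\<dots> = Pi\<^sub>M {1..k} (\<lambda>_. std_gaussian \<beta>)" by (intro PiM_cong) (auto simp: N)
  finally show ?thesis .
qed

theorem mainTheorem4:
  fixes M :: "'w measure" and \<beta> :: nat
    and N :: "nat \<Rightarrow> nat \<Rightarrow> 'w \<Rightarrow> complex" and b :: "nat \<Rightarrow> 'w \<Rightarrow> real"
    and X m :: "nat \<Rightarrow> 'w \<Rightarrow> complex \<Rightarrow> complex"
  assumes "prob_space M"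
    and "\<beta> \<in> {1, 2}"
    and "prob_space.indep_vars M (\<lambda>_. borel)
           (case_sum (\<lambda>(k, j). N k j) (\<lambda>k \<omega>. complex_of_real (b k \<omega>)))
           ((SIGMA k:{1..}. {1..k}) <+> {1..})"
    and "\<And>k j. 1 \<le> j \<Longrightarrow> j \<le> k \<Longrightarrow> distr M borel (N k j) = std_gaussian \<beta>"
    and "\<And>k. 1 \<le> k \<Longrightarrow>
           distr M borel (b k) = distr (chi_distribution (k * \<beta>)) borel (\<lambda>x. 1 / sqrt (real \<beta>) * x)"
    and "\<And>k \<omega>. 1 \<le> k \<Longrightarrow> \<omega> \<in> space M \<Longrightarrow> b k \<omega> > 0"
    and "\<And>\<omega> z. \<omega> \<in> space M \<Longrightarrow> X 1 \<omega> z = 1"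
    and "\<And>k \<omega> z. 1 \<le> k \<Longrightarrow> \<omega> \<in> space M \<Longrightarrow>
           (\<Sum>j=1..k. N k j \<omega> * X j \<omega> z) + complex_of_real (b k \<omega>) * X (k + 1) \<omega> z = z * X k \<omega> z"
    and "\<And>k \<omega> z. m k \<omega> z = z * X k \<omega> z / complex_of_real (b k \<omega>)"
  shows
    "(\<forall>n\<ge>1.
        distr M poly_space (\<lambda>\<omega>. char_poly (hessenberg (\<lambda>k j. N k j \<omega>) (\<lambda>k. b k \<omega>) n)) =
        distr (\<Pi>\<^sub>M ij\<in>{..<n} \<times> {..<n}. std_gaussian \<beta>) poly_space (\<lambda>G. char_poly (mat n n G))) \<and>
     (\<forall>n\<ge>1. \<exists>c\<in>borel_measurable M. \<forall>\<omega>\<in>space M. c \<omega> \<noteq> 0 \<and>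
        (\<forall>z. X (n + 1) \<omega> z =
           c \<omega> * poly (char_poly (hessenberg (\<lambda>k j. N k j \<omega>) (\<lambda>k. b k \<omega>) n)) z)) \<and>
     (\<forall>k\<ge>1.
        (\<exists>\<kappa>. regular_cond_distr M (row_filtration M N b k) field_space (X (k + 1)) \<kappa> \<and>
             (\<forall>\<omega>\<in>space M. jointly_gaussian_field (\<kappa> \<omega>))) \<and>
        (\<forall>z. AE \<omega> in M.
           complex_cond_exp M (row_filtration M N b k) (\<lambda>\<omega>. X (k + 1) \<omega> z) \<omega> = m k \<omega> z) \<and>
        (\<forall>z w. AE \<omega> in M.
           complex_cond_exp M (row_filtration M N b k)
             (\<lambda>\<omega>. (X (k + 1) \<omega> z - m k \<omega> z) * cnj (X (k + 1) \<omega> w - m k \<omega> w)) \<omega> =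
           1 / complex_of_real (b k \<omega>) ^ 2 * (\<Sum>j=1..k. X j \<omega> z * cnj (X j \<omega> w))) \<and>
        (\<forall>z w. AE \<omega> in M.
           complex_cond_exp M (row_filtration M N b k)
             (\<lambda>\<omega>. (X (k + 1) \<omega> z - m k \<omega> z) * (X (k + 1) \<omega> w - m k \<omega> w)) \<omega> =
           (if \<beta> = 1
            then 1 / complex_of_real (b k \<omega>) ^ 2 * (\<Sum>j=1..k. X j \<omega> z * X j \<omega> w)
            else 0)))"
proof -
  interpret prob_space M by (rule assms(1))
  note \<beta> = assms(2) and indep = assms(3) and N = assms(4) and b_pos = assms(6)
  have b: "distr M borel (b k) = scaled_chi \<beta> k" if "1 \<le> k" for k
    using assms(5)[OF that] by (simp add: scaled_chi_def)
  have rec: "X (k + 1) \<omega> z = (z * X k \<omega> z - (\<Sum>j=1..k. N k j \<omega> * X j \<omega> z)) / complex_of_real (b k \<omega>)"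
    if "1 \<le> k" "\<omega> \<in> space M" for k \<omega> z
    using assms(8)[OF that, of z] b_pos[OF that] by (simp add: field_simps)
  \<comment> \<open>By the recursion, \<open>X j\<close> uses only rows before j, together with
    their \<open>b\<close>. So every \<open>X j\<close> with \<open>j \<le> k\<close> is known to
    the \<sigma>-field with index k, which makes the mean and the coefficients of row k measurable
    for it.\<close>
  have X_meas: "(\<lambda>\<omega>. X j \<omega> z) \<in> borel_measurable (row_filtration M N b k)" if "1 \<le> j" "j \<le> k" for j k z
    using that
  proof (induction j rule: less_induct)
    case (less j)
    show ?case
    proof (cases "j = 1")
      case True
      then show ?thesis
        by (subst measurable_cong[where g = "\<lambda>_. 1"]) (auto simp: space_row_filtration assms(7)[simplified])
    next
      case False
      then obtain i where i: "j = i + 1" "1 \<le> i" using less.prems by (metis Suc_eq_plus1 Suc_le_mono One_nat_def not0_implies_Suc le_antisym not_less_eq_eq le0)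
      have "b i \<in> borel_measurable (row_filtration M N b k)"
        using i less.prems by (intro measurable_row_filtration) auto
      then have bi: "(\<lambda>\<omega>. complex_of_real (b i \<omega>)) \<in> borel_measurable (row_filtration M N b k)"
        by simp
      have "(\<lambda>\<omega>. (z * X i \<omega> z - (\<Sum>l=1..i. N i l \<omega> * X l \<omega> z)) / complex_of_real (b i \<omega>))
          \<in> borel_measurable (row_filtration M N b k)"
        using i less.prems
        by (intro borel_measurable_divide borel_measurable_diff borel_measurable_times borel_measurable_sum
            borel_measurable_const bi less.IH measurable_row_filtration) auto
      then show ?thesis
        unfolding i(1) by (subst measurable_cong[OF rec[OF i(2)]]) (auto simp: space_row_filtration)
    qed
  qed
  show ?thesis
  proof (intro conjI allI impI)
    fix n :: nat assume n: "1 \<le> n"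
    show "distr M poly_space (\<lambda>\<omega>. char_poly (hessenberg (\<lambda>k j. N k j \<omega>) (\<lambda>k. b k \<omega>) n)) =
        distr (\<Pi>\<^sub>M ij\<in>{..<n} \<times> {..<n}. std_gaussian \<beta>) poly_space (\<lambda>G. char_poly (mat n n G))"
      by (rule char_poly_hessenberg_law[OF assms(1) \<beta> indep N b n])
  next
    fix n :: nat assume n: "1 \<le> n"
    \<comment> \<open>The reciprocal of the factor in the determinant identity. It contains
      \<open>b n\<close>, which is not an entry of the n by n matrix but is used to define
      \<open>X (n + 1)\<close>.\<close>
    define c where "c \<omega> = 1 / (\<Prod>k=1..n. complex_of_real (b k \<omega>))" for \<omega>
    have "b k \<in> borel_measurable M" if "1 \<le> k" for k
      using measurable_from_subalg[OF row_filtration_independent(1)[OF assms(1) indep that] measurable_row_filtration(2)[of k k]] that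
      by simp
    then have "c \<in> borel_measurable M"
      unfolding c_def by (intro borel_measurable_divide borel_measurable_const borel_measurable_prod borel_measurable_of_real) auto
    moreover have "c \<omega> \<noteq> 0 \<and> (\<forall>z. X (n + 1) \<omega> z =
           c \<omega> * poly (char_poly (hessenberg (\<lambda>k j. N k j \<omega>) (\<lambda>k. b k \<omega>) n)) z)" if \<omega>: "\<omega> \<in> space M" for \<omega>
    proof -
      have nz: "(\<Prod>k=1..n. complex_of_real (b k \<omega>)) \<noteq> 0" using b_pos[OF _ \<omega>] by (force simp: prod_zero_iff)
      have "poly (char_poly (hessenberg (\<lambda>k j. N k j \<omega>) (\<lambda>k. b k \<omega>) n)) z = (\<Prod>k=1..n. complex_of_real (b k \<omega>)) * X (n + 1) \<omega> z" for z
        using hessenberg_recursion_char_poly[of "\<lambda>j. X j \<omega> z" n "\<lambda>k j. N k j \<omega>" "\<lambda>k. b k \<omega>" z]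
          assms(7)[OF \<omega>] assms(8)[OF _ \<omega>] n by simp
      then show ?thesis using nz by (simp add: c_def)
    qed
    ultimately show "\<exists>c\<in>borel_measurable M. \<forall>\<omega>\<in>space M. c \<omega> \<noteq> 0 \<and>
        (\<forall>z. X (n + 1) \<omega> z =
           c \<omega> * poly (char_poly (hessenberg (\<lambda>k j. N k j \<omega>) (\<lambda>k. b k \<omega>) n)) z)"
      by blast
  next
    fix k :: nat assume k: "1 \<le> k"
    have kk: "k \<in> {1..k}" using k by simp
    have law: "distr M (Pi\<^sub>M {1..k} (\<lambda>_. borel)) (\<lambda>\<omega>. \<lambda>j\<in>{1..k}. N k j \<omega>) = Pi\<^sub>M {1..k} (\<lambda>_. std_gaussian \<beta>)"
      by (rule row_law[OF assms(1) indep N k])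
    note C = conditional_gaussian_field[OF assms(1) \<beta> finite_atLeastAtMost
        row_filtration_independent(1)[OF assms(1) indep k] refl row_filtration_independent(2)[OF assms(1) indep k]
        law, where x = X and c = "\<lambda>\<omega> z. z * X k \<omega> z" and b = "b k"
          and f = "X (k + 1)" and m = "m k"]
    have x: "(\<lambda>\<omega>. X j \<omega> z) \<in> borel_measurable (row_filtration M N b k)" if "j \<in> {1..k}" for j z
      using that by (intro X_meas) auto
    have c: "(\<lambda>\<omega>. z * X k \<omega> z) \<in> borel_measurable (row_filtration M N b k)" for z
      using x[OF kk] by (intro borel_measurable_times borel_measurable_const)
    have bk: "b k \<in> borel_measurable (row_filtration M N b k)" using k by (intro measurable_row_filtration) auto
    have f: "X (k + 1) \<omega> z = (z * X k \<omega> z - (\<Sum>j=1..k. (\<lambda>j\<in>{1..k}. N k j \<omega>) j * X j \<omega> z)) / complex_of_real (b k \<omega>)"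
      if "\<omega> \<in> space M" for \<omega> z
      using rec[OF k that, of z] by simp
    note C = C[OF x c bk f assms(9)]
    show "\<exists>\<kappa>. regular_cond_distr M (row_filtration M N b k) field_space (X (k + 1)) \<kappa> \<and>
             (\<forall>\<omega>\<in>space M. jointly_gaussian_field (\<kappa> \<omega>))"
      by (rule C(1))
    show "AE \<omega> in M. complex_cond_exp M (row_filtration M N b k) (\<lambda>\<omega>. X (k + 1) \<omega> z) \<omega> = m k \<omega> z" for z
      by (rule C(2))
    show "AE \<omega> in M.
           complex_cond_exp M (row_filtration M N b k)
             (\<lambda>\<omega>. (X (k + 1) \<omega> z - m k \<omega> z) * cnj (X (k + 1) \<omega> w - m k \<omega> w)) \<omega> =
           1 / complex_of_real (b k \<omega>) ^ 2 * (\<Sum>j=1..k. X j \<omega> z * cnj (X j \<omega> w))" for z w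
      by (rule C(3))
    show "AE \<omega> in M.
           complex_cond_exp M (row_filtration M N b k)
             (\<lambda>\<omega>. (X (k + 1) \<omega> z - m k \<omega> z) * (X (k + 1) \<omega> w - m k \<omega> w)) \<omega> =
           (if \<beta> = 1
            then 1 / complex_of_real (b k \<omega>) ^ 2 * (\<Sum>j=1..k. X j \<omega> z * X j \<omega> w)
            else 0)" for z w
      by (rule C(4))
  qed
qed

end
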